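(* Let $\alpha,\beta\in\mathbb{R}$. Suppose there exists a twice continuously differentiable function $v\colon \mathbb{R}^n\to \mathbb{R}$ satisfying $$\begin{cases}\mathcal{L}v(x)\leq \alpha v(x)+\beta, & \forall x\in \mathcal{X},\\ 0\leq \alpha v(x)+\beta, & \forall x\in \partial \mathcal{X},\\ v(x)\geq 1_{\mathcal{X}_s}(x), & \forall x\in \overline{\mathcal{X}}.\end{cases}$$ Then, for every $x_0\in \mathcal{X}\setminus \mathcal{X}_s$, $$\mathbb{P}_{x_0}^{T}\leq \begin{cases} v(x_0)+\beta T, & \text{if } \alpha=0,\\ e^{\alpha T}v(x_0)+\frac{\beta}{\alpha}(e^{\alpha T}-1), & \text{if } \alpha\neq 0.\end{cases}$$
   Context: Let $b\colon\mathbb{R}^n\to\mathbb{R}^n$ and $\sigma\colon\mathbb{R}^n\to\mathbb{R}^{n\times k}$ be locally Lipschitz continuous, and let $W$ be a standard $k$-dimensional Wiener process on a probability space $(\Omega,\mathbb{P})$. For $x_0\in\mathbb{R}^n$, the SDE $dX=b(X)\,dt+\sigma(X)\,dW$ with initial state $x_0$ has a unique maximal local strong solution $X_{x_0}^{w}(t)$, $t\in[0,T^{x_0}(w))$, with continuous sample paths, where $T^{x_0}(w)\in(0,\infty]$. Let $\mathcal{X}\subseteq\mathbb{R}^n$ be open and bounded, $\mathcal{X}_s\subseteq\mathcal{X}$ a closed set, and $0<T<\infty$. An overline denotes closure, $\partial$ denotes topological boundary, and $1_A$ is the indicator function of $A$. For $x_0\in\mathcal{X}\setminus\mathcal{X}_s$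 define $$\mathbb{P}_{x_0}^{T}:=\mathbb{P}\big(\{w\in\Omega \mid X_{x_0}^{w}(T)\in\mathcal{X}_s\ \wedge\ \forall\tau\in[0,T).\ X_{x_0}^{w}(\tau)\in\mathcal{X}\}\big),$$ where the path is required to be defined at the times involved. For a twice continuously differentiable $v\colon\mathbb{R}^n\to\mathbb{R}$, $$\mathcal{L}v(x)=\frac{\partial v(x)}{\partial x}b(x)+\frac12\mathrm{tr}\Big(\sigma(x)^{\top}\frac{\partial^2 v(x)}{\partial x^2}\sigma(x)\Big).$$ *)

theory Defs
  imports "HOL-Probability.Probability"
begin

section \<open>Twice continuously differentiable functions and the generator\<close>

definition gradient :: "(real^'n \<Rightarrow> real) \<Rightarrow> real^'n \<Rightarrow> real^'n" where
  "gradient v x = (\<chi> i. frechet_derivative v (at x) (axis i 1))"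

definition hessian :: "(real^'n \<Rightarrow> real) \<Rightarrow> real^'n \<Rightarrow> real^'n^'n" where
  "hessian v x = jacobian (gradient v) (at x)"

definition twice_cont_diff :: "(real^'n \<Rightarrow> real) \<Rightarrow> bool" where
  "twice_cont_diff v \<longleftrightarrow>
     (\<forall>x. v differentiable (at x)) \<and>
     (\<forall>x. gradient v differentiable (at x)) \<and>
     continuous_on UNIV (hessian v)"

text \<open>The type \<open>real^'k^'n\<close> is the type of real matrices with \<open>n\<close> rows and \<open>k\<close> columns.\<close>

definition generator ::
  "(real^'n \<Rightarrow> real^'n) \<Rightarrow> (real^'n \<Rightarrow> real^'k^'n) \<Rightarrow> (real^'n \<Rightarrow> real) \<Rightarrow> real^'n \<Rightarrow> real" where
  "generator b \<sigma> v x =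
     gradient v x \<bullet> b x + 1/2 * trace (transpose (\<sigma> x) ** hessian v x ** \<sigma> x)"

section \<open>Wiener processes\<close>

text \<open>Processes have type \<open>real \<Rightarrow> 'a \<Rightarrow> _\<close>; only their values at times \<open>t \<ge> 0\<close> matter.\<close>

definition past_events :: "'a measure \<Rightarrow> (real \<Rightarrow> 'a \<Rightarrow> 'b::topological_space) \<Rightarrow> real \<Rightarrow> 'a set set" where
  "past_events M W t = {W s -` A \<inter> space M | s A. 0 \<le> s \<and> s \<le> t \<and> A \<in> sets borel}"

definition wiener_process :: "'a measure \<Rightarrow> (real \<Rightarrow> 'a \<Rightarrow> real^'k) \<Rightarrow> bool" where
  "wiener_process M W \<longleftrightarrow>
     (\<forall>t\<ge>0. W t \<in> borel_measurable M) \<and>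
     (AE w in M. W 0 w = 0) \<and>
     (AE w in M. continuous_on {0..} (\<lambda>t. W t w)) \<and>
     (\<forall>s t. 0 \<le> s \<and> s < t \<longrightarrow>
        prob_space.indep_set M
          (sets (vimage_algebra (space M) (\<lambda>w. W t w - W s w) borel))
          (sigma_sets (space M) (past_events M W s)) \<and>
        prob_space.indep_vars M (\<lambda>_. borel) (\<lambda>i w. (W t w - W s w) $ i) UNIV \<and>
        (\<forall>i. distributed M lborel (\<lambda>w. (W t w - W s w) $ i) (normal_density 0 (sqrt (t - s)))))"

text \<open>The filtration generated by \<open>W\<close>, augmented by the null sets; it consists of
  sub-\<open>\<sigma>\<close>-algebras of \<^term>\<open>completion M\<close>, as \<open>M\<close> itself need not be complete.\<close>

definition augmented_filtration ::
  "'a measure \<Rightarrow> (real \<Rightarrow> 'a \<Rightarrow> 'b::topological_space) \<Rightarrow> real \<Rightarrow> 'a measure" where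
  "augmented_filtration M W t = sigma (space M) (past_events M W t \<union> null_sets (completion M))"

section \<open>The Ito integral\<close>

definition vanishes_in_prob :: "'a measure \<Rightarrow> (nat \<Rightarrow> 'a \<Rightarrow> ennreal) \<Rightarrow> bool" where
  "vanishes_in_prob M f \<longleftrightarrow>
     (\<forall>\<epsilon>>0. (\<lambda>j. measure M {w \<in> space M. f j w > ennreal \<epsilon>}) \<longlonglongrightarrow> 0)"

text \<open>\<open>V\<close> is a bounded simple predictable process, and \<open>J\<close> is its integral process,
  \<open>J s = \<integral>\<^sub>0\<^sup>s V dW\<close>.\<close>

definition simple_ito ::
  "'a measure \<Rightarrow> (real \<Rightarrow> 'a measure) \<Rightarrow> (real \<Rightarrow> 'a \<Rightarrow> real^'k) \<Rightarrow>
   (real \<Rightarrow> 'a \<Rightarrow> real^'k^'n) \<Rightarrow> (real \<Rightarrow> 'a \<Rightarrow> real^'n) \<Rightarrow> bool" where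
  "simple_ito M F W V J \<longleftrightarrow>
     (\<exists>(m::nat) (t::nat \<Rightarrow> real) (\<xi>::nat \<Rightarrow> 'a \<Rightarrow> real^'k^'n).
        0 \<le> t 0 \<and> (\<forall>i<m. t i < t (Suc i)) \<and>
        (\<forall>i<m. \<xi> i \<in> borel_measurable (F (t i)) \<and> bounded (\<xi> i ` space M)) \<and>
        V = (\<lambda>s w. \<Sum>i<m. indicator {t i <.. t (Suc i)} s *\<^sub>R \<xi> i w) \<and>
        J = (\<lambda>s w. \<Sum>i<m. \<xi> i w *v (W (min s (t (Suc i))) w - W (min s (t i)) w)))"

definition progressive :: "(real \<Rightarrow> 'a measure) \<Rightarrow> (real \<Rightarrow> 'a \<Rightarrow> 'b::topological_space) \<Rightarrow> bool" where
  "progressive F H \<longleftrightarrow>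
     (\<forall>t\<ge>0. (\<lambda>(s, w). H s w) \<in> borel_measurable (restrict_space borel {0..t} \<Otimes>\<^sub>M F t))"

text \<open>\<open>I\<close> is a continuous version of the Ito integral process \<open>I t = \<integral>\<^sub>0\<^sup>t H dW\<close> of an integrand
  \<open>H\<close> that is progressively measurable with almost surely locally square integrable paths:
  \<open>I\<close> is the limit, locally uniformly in time in probability, of the integrals of simple
  processes that approximate \<open>H\<close> in \<open>L\<^sup>2([0,t])\<close> in probability. The norm on matrices is the
  Frobenius norm.\<close>

definition has_ito_integral ::
  "'a measure \<Rightarrow> (real \<Rightarrow> 'a measure) \<Rightarrow> (real \<Rightarrow> 'a \<Rightarrow> real^'k) \<Rightarrow>
   (real \<Rightarrow> 'a \<Rightarrow> real^'k^'n) \<Rightarrow> (real \<Rightarrow> 'a \<Rightarrow> real^'n) \<Rightarrow> bool" where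
  "has_ito_integral M F W H I \<longleftrightarrow>
     progressive F H \<and>
     (\<forall>t\<ge>0. AE w in M. (\<integral>\<^sup>+s\<in>{0..t}. ennreal ((norm (H s w))\<^sup>2) \<partial>lborel) < \<infinity>) \<and>
     (\<forall>t\<ge>0. I t \<in> borel_measurable (F t)) \<and>
     (\<forall>w\<in>space M. continuous_on {0..} (\<lambda>t. I t w)) \<and>
     (\<exists>V J. (\<forall>j. simple_ito M F W (V j) (J j)) \<and>
        (\<forall>t\<ge>0.
           vanishes_in_prob M
             (\<lambda>j w. \<integral>\<^sup>+s\<in>{0..t}. ennreal ((norm (V j s w - H s w))\<^sup>2) \<partial>lborel) \<and>
           vanishes_in_prob M
             (\<lambda>j w. SUP s\<in>{0..t}. ennreal (norm (J j s w - I s w)))))"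

section \<open>Maximal local strong solutions\<close>

text \<open>A local solution on the random interval \<open>[0, \<zeta>)\<close> of \<open>dX = b(X) dt + \<sigma>(X) dW\<close>, \<open>X 0 = x0\<close>;
  the values \<open>X t w\<close> for \<open>t \<ge> \<zeta> w\<close> are irrelevant. The stochastic integral equation is required
  up to each stopping time \<open>\<tau> n\<close> of a sequence announcing \<open>\<zeta>\<close>; the integral of \<open>\<sigma>(X)\<close> up
  to \<open>t \<and> \<tau> n\<close> is the Ito integral up to \<open>t\<close> of \<open>\<sigma>(X)\<close> cut off after \<open>\<tau> n\<close>.\<close>

definition local_solution ::
  "'a measure \<Rightarrow> (real \<Rightarrow> 'a measure) \<Rightarrow> (real \<Rightarrow> 'a \<Rightarrow> real^'k) \<Rightarrow>
   (real^'n \<Rightarrow> real^'n) \<Rightarrow> (real^'n \<Rightarrow> real^'k^'n) \<Rightarrow> real^'n \<Rightarrow>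
   (real \<Rightarrow> 'a \<Rightarrow> real^'n) \<Rightarrow> ('a \<Rightarrow> ereal) \<Rightarrow> bool" where
  "local_solution M F W b \<sigma> x0 X \<zeta> \<longleftrightarrow>
     (\<forall>w\<in>space M. 0 < \<zeta> w) \<and>
     (\<forall>w\<in>space M. continuous_on {t. 0 \<le> t \<and> ereal t < \<zeta> w} (\<lambda>t. X t w)) \<and>
     (\<forall>t\<ge>0. \<forall>A\<in>sets borel. {w\<in>space M. ereal t < \<zeta> w \<and> X t w \<in> A} \<in> sets (F t)) \<and>
     (\<exists>(\<tau>::nat \<Rightarrow> 'a \<Rightarrow> real) I.
        (\<forall>n. stopping_time F (\<tau> n)) \<and>
        (\<forall>w\<in>space M. incseq (\<lambda>n. \<tau> n w) \<and> (\<forall>n. 0 \<le> \<tau> n w \<and> ereal (\<tau> n w) < \<zeta> w) \<and>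
           (\<lambda>n. ereal (\<tau> n w)) \<longlonglongrightarrow> \<zeta> w) \<and>
        (\<forall>n. has_ito_integral M F W (\<lambda>s w. if s \<le> \<tau> n w then \<sigma> (X s w) else 0) (I n)) \<and>
        (\<forall>n. AE w in M. \<forall>t\<ge>0.
           X (min t (\<tau> n w)) w =
             x0 + integral {0..min t (\<tau> n w)} (\<lambda>s. b (X s w)) + I n t w))"

text \<open>A solution is strong because it is adapted to the augmented filtration of \<open>W\<close>, and
  maximal because every other local solution is, up to a null set, a restriction of it.\<close>

definition maximal_local_strong_solution ::
  "'a measure \<Rightarrow> (real \<Rightarrow> 'a \<Rightarrow> real^'k) \<Rightarrow>
   (real^'n \<Rightarrow> real^'n) \<Rightarrow> (real^'n \<Rightarrow> real^'k^'n) \<Rightarrow> real^'n \<Rightarrow>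
   (real \<Rightarrow> 'a \<Rightarrow> real^'n) \<Rightarrow> ('a \<Rightarrow> ereal) \<Rightarrow> bool" where
  "maximal_local_strong_solution M W b \<sigma> x0 X \<zeta> \<longleftrightarrow>
     local_solution (completion M) (augmented_filtration M W) W b \<sigma> x0 X \<zeta> \<and>
     (\<forall>Y \<eta>. local_solution (completion M) (augmented_filtration M W) W b \<sigma> x0 Y \<eta> \<longrightarrow>
        (AE w in completion M. \<eta> w \<le> \<zeta> w \<and> (\<forall>t\<ge>0. ereal t < \<eta> w \<longrightarrow> Y t w = X t w)))"

text \<open>The probability that \<open>X\<close> is in \<open>D\<^sub>s\<close> at time \<open>T\<close> and stays in \<open>D\<close> before time \<open>T\<close>.\<close>

definition reach_avoid_prob ::
  "'a measure \<Rightarrow> (real \<Rightarrow> 'a \<Rightarrow> real^'n) \<Rightarrow> ('a \<Rightarrow> ereal) \<Rightarrow>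
   (real^'n) set \<Rightarrow> (real^'n) set \<Rightarrow> real \<Rightarrow> real" where
  "reach_avoid_prob M X \<zeta> D D\<^sub>s T =
     measure (completion M)
       {w \<in> space M. ereal T < \<zeta> w \<and> X T w \<in> D\<^sub>s \<and> (\<forall>t\<in>{0..<T}. X t w \<in> D)}"

end

theory Submission
  imports Defs
begin

text \<open>Put \<open>g r x = exp (\<alpha> r) v x + \<beta> \<integral>\<^sub>0\<^sup>r exp (\<alpha> s) ds\<close>, where \<open>r\<close> is the remaining time. Inside \<open>D\<close> it is a
  supersolution of the backward equation, so \<open>g (T - t) (X t)\<close> is a supermartingale while \<open>X\<close> stays
  in \<open>D\<close>. Moreover \<open>g \<ge> 0\<close> on the closure of \<open>D\<close> by an elliptic minimum principle, so stopping the
  process early for any reason only loses nonnegative mass; in particular maximality of the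
  solution is irrelevant. Since \<open>g 0 = v \<ge> 1\<close> on \<open>D\<^sub>s\<close>, the probability is at most \<open>g T x0\<close>.

  No Ito formula is used. On a fine grid the solution is shadowed by an Euler chain whose noise is
  that of a simple integrand approximating \<open>\<sigma>(X)\<close>, so that every step is a Gaussian increment
  independent of the past, and one step is estimated by a one-sided Taylor bound and Gaussian
  moments. The chain is stopped as soon as it leaves a compact part of \<open>D\<close>, separates from \<open>X\<close>, or
  accumulates too large an error in the integrand; this makes all error terms deterministic.\<close>

section \<open>Second-order Taylor expansion\<close>

text \<open>The argument is shaped by how the Ito integral is given: only as a limit in probability
  of integrals of simple processes V, which are close to \<sigma>(X) in L2 of time and whose bounds
  are not controlled along the sequence. The estimates are therefore made for one fixed V, and the
  constants must be fixed in a definite order: the tolerance e, then the admissible distance \<eta>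
  between chain and path, the factor C of the integrand error and the budget \<theta> for that
  error; only then V, whose bound \<kappa> determines the last constant C'; then the mesh tends to
  0, which removes C', and at the very end e tends to 0.

  The drift of the chain is evaluated along the true path, so chain and path are compared by Riemann
  sums, with no Gronwall argument. Their closeness is needed only pathwise: for each good outcome
  the stopping rule is not triggered once the mesh is fine enough, at a rate that may depend on the
  outcome. Expectations are taken only of the cut-off envelope along the chain, a bounded quantity,
  so no moment bounds for X enter.\<close>

lemma norm_matrix_vector_mult_le:
  fixes A :: "real^'n^'m"
  shows "norm (A *v x) \<le> norm A * norm x"
proof -
  have "norm (A *v x) = L2_set (\<lambda>i. \<bar>A $ i \<bullet> x\<bar>) UNIV"
    by (simp add: norm_vec_def matrix_vector_mul_component)
  also have "\<dots> \<le> L2_set (\<lambda>i. norm (A $ i) * norm x) UNIV"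
    by (intro L2_set_mono) (auto simp: Cauchy_Schwarz_ineq2)
  also have "\<dots> = norm A * norm x"
    by (simp add: norm_vec_def L2_set_left_distrib)
  finally show ?thesis .
qed

lemma norm_column_le_norm:
  fixes S :: "real^'k^'n"
  shows "norm (column k S) \<le> norm S"
  using norm_matrix_vector_mult_le[of S "axis k 1"]
  by (simp add: matrix_vector_mult_basis)

text \<open>A sum of quadratic forms over the columns is the shape in which second moments of
  \<open>S *v U\<close> appear, and it makes the sign of the trace visible in the second derivative
  test.\<close>

lemma trace_transpose_mult:
  fixes A :: "real^'n^'n" and S :: "real^'k^'n"
  shows "trace (transpose S ** A ** S) = (\<Sum>k\<in>UNIV. column k S \<bullet> (A *v column k S))"
proof -
  have "(transpose S ** A ** S) $ k $ k = column k S \<bullet> (A *v column k S)" for k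
  proof -
    have "(transpose S ** A ** S) $ k $ k = (\<Sum>j\<in>UNIV. \<Sum>i\<in>UNIV. S$i$k * A$i$j * S$j$k)"
      by (simp add: matrix_matrix_mult_def transpose_def sum_distrib_right)
    also have "\<dots> = (\<Sum>i\<in>UNIV. \<Sum>j\<in>UNIV. S$i$k * A$i$j * S$j$k)"
      by (rule sum.swap)
    also have "\<dots> = column k S \<bullet> (A *v column k S)"
      by (simp add: inner_vec_def matrix_vector_mult_def column_def sum_distrib_left mult.assoc)
    finally show ?thesis .
  qed
  then show ?thesis by (simp add: trace_def)
qed

lemma abs_quadratic_form_diff_le:
  fixes A :: "real^'n^'n"
  shows "\<bar>x \<bullet> (A *v x) - y \<bullet> (A *v y)\<bar> \<le> norm A * norm (x - y) * (norm x + norm y)"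
proof -
  have "x \<bullet> (A *v x) - y \<bullet> (A *v y) = (x - y) \<bullet> (A *v x) + y \<bullet> (A *v (x - y))"
    by (simp add: algebra_simps matrix_vector_mult_diff_distrib)
  also have "\<bar>\<dots>\<bar> \<le> norm (x - y) * (norm A * norm x) + norm y * (norm A * norm (x - y))"
    by (intro order_trans[OF abs_triangle_ineq] add_mono order_trans[OF Cauchy_Schwarz_ineq2]
        mult_left_mono norm_matrix_vector_mult_le) auto
  finally show ?thesis by (simp add: algebra_simps)
qed

lemma abs_trace_transpose_mult_diff_le:
  fixes A :: "real^'n^'n" and S R :: "real^'k^'n"
  shows "\<bar>trace (transpose S ** A ** S) - trace (transpose R ** A ** R)\<bar>
    \<le> CARD('k) * (norm A * norm (S - R) * (norm S + norm R))"
proof -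
  have "\<bar>trace (transpose S ** A ** S) - trace (transpose R ** A ** R)\<bar>
    = \<bar>\<Sum>k\<in>UNIV. column k S \<bullet> (A *v column k S) - column k R \<bullet> (A *v column k R)\<bar>"
    by (simp add: trace_transpose_mult sum_subtractf)
  also have "\<dots> \<le> (\<Sum>k\<in>(UNIV::'k set). norm A * norm (S - R) * (norm S + norm R))"
  proof (intro order_trans[OF sum_abs] sum_mono)
    fix k
    have c: "column k S - column k R = column k (S - R)"
      by (simp add: column_def vec_eq_iff)
    show "\<bar>column k S \<bullet> (A *v column k S) - column k R \<bullet> (A *v column k R)\<bar>
        \<le> norm A * norm (S - R) * (norm S + norm R)"
      by (intro order_trans[OF abs_quadratic_form_diff_le] mult_mono add_mono norm_column_le_norm
          mult_nonneg_nonneg add_nonneg_nonneg) (auto simp: c norm_column_le_norm)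
  qed
  finally show ?thesis by simp
qed

section \<open>Uniform Taylor expansion and the second derivative test\<close>

lemma has_derivative_gradient:
  assumes "v differentiable (at x)"
  shows "(v has_derivative (\<lambda>y. gradient v x \<bullet> y)) (at x)"
proof -
  have d: "(v has_derivative frechet_derivative v (at x)) (at x)"
    using assms by (simp add: frechet_derivative_works)
  then interpret linear "frechet_derivative v (at x)" by (rule has_derivative_linear)
  have "frechet_derivative v (at x) y = gradient v x \<bullet> y" for y
  proof -
    have "frechet_derivative v (at x) y = frechet_derivative v (at x) (\<Sum>i\<in>UNIV. (y$i) *\<^sub>R axis i 1)"
      using basis_expansion[of y] by (simp add: scalar_mult_eq_scaleR)
    also have "\<dots> = gradient v x \<bullet> y"
      by (simp add: sum scale gradient_def inner_vec_def mult.commute)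
    finally show ?thesis .
  qed
  then have "frechet_derivative v (at x) = (\<lambda>y. gradient v x \<bullet> y)" by (rule ext)
  then show ?thesis using d by simp
qed

lemma has_derivative_hessian:
  assumes "twice_cont_diff v"
  shows "(gradient v has_derivative (\<lambda>y. hessian v x *v y)) (at x)"
  using assms unfolding twice_cont_diff_def hessian_def jacobian_works[symmetric] by blast

text \<open>Along the segment from x to x + y the Lagrange remainder differs from the quadratic term
  only by the variation of the hessian, which is small uniformly in x by uniform continuity near
  K.\<close>

lemma taylor_twice_cont_diff:
  fixes v :: "real^'n \<Rightarrow> real"
  assumes v: "twice_cont_diff v" and K: "compact K" and e: "e > 0"
  obtains d where "d > 0"
    "\<And>x y. x \<in> K \<Longrightarrow> norm y < d \<Longrightarrow>
      \<bar>v (x + y) - (v x + gradient v x \<bullet> y + 1/2 * (y \<bullet> (hessian v x *v y)))\<bar> \<le> e * (norm y)\<^sup>2"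
proof -
  obtain R where R: "\<And>x. x \<in> K \<Longrightarrow> norm x \<le> R"
    using compact_imp_bounded[OF K] by (auto simp: bounded_iff)
  \<comment> \<open>The extra 1 in the radius leaves room for segments of length below 1 that start
    in K; hence \<open>min d 1\<close> below.\<close>
  have "uniformly_continuous_on (cball 0 (R + 1)) (hessian v)"
    using v by (intro compact_uniformly_continuous) (auto simp: twice_cont_diff_def intro: continuous_on_subset)
  then obtain d where d: "d > 0" and
    hd: "\<And>x y. x \<in> cball 0 (R+1) \<Longrightarrow> y \<in> cball 0 (R+1) \<Longrightarrow> dist y x < d \<Longrightarrow>
       dist (hessian v y) (hessian v x) < e"
    using e unfolding uniformly_continuous_on_def by metis
  show ?thesis
  proof
    show "min d 1 > 0" using d by simp
    fix x y :: "real^'n" assume x: "x \<in> K" and y: "norm y < min d 1"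
    define f where "f = (\<lambda>t. v (x + t *\<^sub>R y))"
    define f' where "f' = (\<lambda>t. gradient v (x + t *\<^sub>R y) \<bullet> y)"
    define f'' where "f'' = (\<lambda>t. y \<bullet> (hessian v (x + t *\<^sub>R y) *v y))"
    have D1: "(f has_real_derivative f' t) (at t)" for t
    proof -
      have "(v has_derivative (\<lambda>z. gradient v (x + t *\<^sub>R y) \<bullet> z)) (at (x + t *\<^sub>R y))"
        using v by (intro has_derivative_gradient) (simp add: twice_cont_diff_def)
      then have "((\<lambda>t. v (x + t *\<^sub>R y)) has_derivative (\<lambda>s. gradient v (x + t *\<^sub>R y) \<bullet> (s *\<^sub>R y))) (at t)"
        by (rule has_derivative_compose[rotated]) (auto intro!: derivative_eq_intros)
      then show ?thesis unfolding f_def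
        by (rule has_derivative_imp_has_field_derivative) (simp add: f'_def)
    qed
    have D2: "(f' has_real_derivative f'' t) (at t)" for t
    proof -
      have "((\<lambda>t. gradient v (x + t *\<^sub>R y)) has_derivative (\<lambda>s. hessian v (x + t *\<^sub>R y) *v (s *\<^sub>R y))) (at t)"
        by (rule has_derivative_compose[OF _ has_derivative_hessian[OF v]]) (auto intro!: derivative_eq_intros)
      then have "((\<lambda>t. gradient v (x + t *\<^sub>R y) \<bullet> y) has_derivative
          (\<lambda>s. (hessian v (x + t *\<^sub>R y) *v (s *\<^sub>R y)) \<bullet> y)) (at t)"
        by (auto intro!: derivative_eq_intros)
      then show ?thesis unfolding f'_def
        by (rule has_derivative_imp_has_field_derivative)
           (simp add: f''_def matrix_vector_mult_scaleR inner_commute)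
    qed
    define F where "F = (\<lambda>m::nat. if m = 0 then f else if m = 1 then f' else f'')"
    have F: "F 0 = f" "F (Suc 0) = f'" "F (Suc (Suc 0)) = f''" by (simp_all add: F_def)
    have "\<forall>m t. m < 2 \<and> 0 \<le> t \<and> t \<le> 1 \<longrightarrow> (F m has_real_derivative F (Suc m) t) (at t)"
      using D1 D2 by (simp add: F_def less_Suc_eq numeral_2_eq_2)
    from Taylor_up[OF _ F(1) this, of 0]
    have "\<exists>t>0. t < 1 \<and> f 1 = (\<Sum>m<2. F m 0 / fact m * (1 - 0) ^ m) + F 2 t / fact 2 * (1 - 0)\<^sup>2"
      by simp
    then obtain t where t: "0 < t" "t < 1" "f 1 = f 0 + f' 0 + 1/2 * f'' t"
      by (auto simp: F lessThan_Suc numeral_2_eq_2)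
    have "norm (t *\<^sub>R y) \<le> norm y" using t by (simp add: mult_left_le_one_le)
    moreover have "norm (x + t *\<^sub>R y) \<le> norm x + norm (t *\<^sub>R y)" by (rule norm_triangle_ineq)
    ultimately have "x + t *\<^sub>R y \<in> cball 0 (R + 1)" "x \<in> cball 0 (R + 1)" "dist (x + t *\<^sub>R y) x < d"
      using R[OF x] y by (simp_all only: mem_cball_0) (auto simp: dist_norm)
    then have "dist (hessian v (x + t *\<^sub>R y)) (hessian v x) < e" by (intro hd)
    then have *: "norm (hessian v (x + t *\<^sub>R y) - hessian v x) \<le> e" by (simp add: dist_norm)
    have "\<bar>f'' t - f'' 0\<bar> = \<bar>y \<bullet> ((hessian v (x + t *\<^sub>R y) - hessian v x) *v y)\<bar>"
      by (simp add: f''_def matrix_vector_mult_diff_rdistrib inner_diff_right)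
    also have "\<dots> \<le> norm y * (norm (hessian v (x + t *\<^sub>R y) - hessian v x) * norm y)"
      by (intro order_trans[OF Cauchy_Schwarz_ineq2] mult_left_mono norm_matrix_vector_mult_le) auto
    also have "\<dots> \<le> norm y * (e * norm y)"
      by (intro mult_left_mono mult_right_mono *) auto
    also have "\<dots> = e * (norm y)\<^sup>2" by (simp add: power2_eq_square)
    finally have "\<bar>f'' t - f'' 0\<bar> \<le> e * (norm y)\<^sup>2" .
    then have "\<bar>1/2 * (f'' t - f'' 0)\<bar> \<le> e * (norm y)\<^sup>2"
      using e by (auto simp: abs_mult intro: order_trans)
    then show "\<bar>v (x + y) - (v x + gradient v x \<bullet> y + 1/2 * (y \<bullet> (hessian v x *v y)))\<bar> \<le> e * (norm y)\<^sup>2"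
      using t(3) by (simp add: f_def f'_def f''_def algebra_simps)
  qed
qed

text \<open>At an interior minimum the gradient vanishes, and Taylor along a short multiple t y,
  divided by the square of t, shows that the hessian form is nonnegative up to an arbitrary error;
  the trace is a sum of such forms.\<close>

lemma generator_nonneg_at_minimum:
  assumes v: "twice_cont_diff v" and D: "open D" "x \<in> D" and min: "\<And>y. y \<in> D \<Longrightarrow> v x \<le> v y"
  shows "generator b \<sigma> v x \<ge> 0"
proof -
  have "(\<lambda>y. gradient v x \<bullet> y) = (\<lambda>y. 0)"
    using v min by (intro differential_zero_maxmin[OF D(2,1) has_derivative_gradient])
      (auto simp: twice_cont_diff_def)
  then have g: "gradient v x \<bullet> y = 0" for y by meson
  have h: "y \<bullet> (hessian v x *v y) \<ge> 0" for y
  proof (rule field_le_epsilon)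
    fix e :: real assume "e > 0"
    \<comment> \<open>Chosen so that the Taylor error, after division by the square of t, is at most
      e; the summand 1 avoids division by 0 when y = 0.\<close>
    define e' where "e' = e / (2 * ((norm y)\<^sup>2 + 1))"
    have yp: "(norm y)\<^sup>2 + 1 > 0" by (simp add: add_nonneg_pos)
    then have "e' > 0" using \<open>e > 0\<close> by (simp add: e'_def)
    obtain d where d: "d > 0" "\<And>z. norm z < d \<Longrightarrow>
      \<bar>v (x + z) - (v x + gradient v x \<bullet> z + 1/2 * (z \<bullet> (hessian v x *v z)))\<bar> \<le> e' * (norm z)\<^sup>2"
      using taylor_twice_cont_diff[OF v compact_sing[of x] \<open>e' > 0\<close>] by (metis singletonI)
    obtain r where r: "r > 0" "ball x r \<subseteq> D" using D openE by blast
    define t where "t = min d r / (2 * (norm y + 1))"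
    have t: "t > 0" using d r by (simp add: t_def add_nonneg_pos)
    have "norm (t *\<^sub>R y) < min d r"
    proof -
      have "norm (t *\<^sub>R y) \<le> t * (norm y + 1)" using t by (simp add: mult_left_mono)
      also have "\<dots> = min d r / 2"
      proof -
        have "norm y + 1 \<noteq> 0" using norm_ge_zero[of y] by linarith
        then show ?thesis by (simp only: t_def) (simp add: divide_simps)
      qed
      also have "\<dots> < min d r" using d r by auto
      finally show ?thesis .
    qed
    then have z: "norm (t *\<^sub>R y) < d" "x + t *\<^sub>R y \<in> D" using r by (auto simp: dist_norm subset_iff)
    have "0 \<le> v (x + t *\<^sub>R y) - v x" using min[OF z(2)] by simp
    also have "\<dots> \<le> 1/2 * (t\<^sup>2 * (y \<bullet> (hessian v x *v y))) + e' * (t\<^sup>2 * (norm y)\<^sup>2)"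
      using d(2)[OF z(1)] t by (simp add: g matrix_vector_mult_scaleR power2_eq_square abs_le_iff algebra_simps)
    finally have "0 \<le> t\<^sup>2 * (y \<bullet> (hessian v x *v y) + 2 * e' * (norm y)\<^sup>2)"
      by (simp add: algebra_simps)
    then have "0 \<le> y \<bullet> (hessian v x *v y) + 2 * e' * (norm y)\<^sup>2"
      using t by (simp add: zero_le_mult_iff)
    moreover have "2 * e' * (norm y)\<^sup>2 \<le> 2 * e' * ((norm y)\<^sup>2 + 1)" using \<open>e' > 0\<close> by simp
    moreover have "2 * e' * ((norm y)\<^sup>2 + 1) = e" using yp by (simp add: e'_def field_simps)
    ultimately show "0 \<le> y \<bullet> (hessian v x *v y) + e" by linarith
  qed
  show ?thesis unfolding generator_def trace_transpose_mult g
    by (auto intro!: sum_nonneg h)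
qed

section \<open>Wiener increments and the augmented filtration\<close>

locale wiener_space = prob_space M
  for M :: "'a measure" +
  fixes W :: "real \<Rightarrow> 'a \<Rightarrow> real^'k"
  assumes wiener: "wiener_process M W"
begin

abbreviation F :: "real \<Rightarrow> 'a measure" where "F \<equiv> augmented_filtration M W"

abbreviation N :: "'a measure" where "N \<equiv> completion M"

sublocale N: prob_space N
  by (rule prob_space_completion)

lemma W_measurable: "0 \<le> t \<Longrightarrow> W t \<in> borel_measurable M"
  using wiener by (simp add: wiener_process_def)

lemma past_events_subset: "past_events M W t \<subseteq> sets M"
  by (auto simp: past_events_def intro!: measurable_sets[OF W_measurable])

lemma generators_subset: "past_events M W t \<union> null_sets N \<subseteq> Pow (space M)"
proof -
  have "past_events M W t \<subseteq> Pow (space M)"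
    using past_events_subset sets.space_closed by (rule order_trans)
  moreover have "null_sets N \<subseteq> Pow (space M)"
    using sets.space_closed[of N] by (auto simp: null_sets_def)
  ultimately show ?thesis by (rule Un_least)
qed

lemma space_F [simp]: "space (F t) = space M"
  unfolding augmented_filtration_def using generators_subset by (rule space_measure_of)

lemma sets_F: "sets (F t) = sigma_sets (space M) (past_events M W t \<union> null_sets N)"
  unfolding augmented_filtration_def using generators_subset by (rule sets_measure_of)

lemma sets_F_subset: "sets (F t) \<subseteq> sets N"
proof -
  have "past_events M W t \<union> null_sets N \<subseteq> sets N"
    using past_events_subset[of t] by (auto simp: null_sets_def)
  from sets.sigma_sets_subset[OF this] show ?thesis by (simp add: sets_F)
qed

lemma sets_F_mono: "s \<le> t \<Longrightarrow> sets (F s) \<subseteq> sets (F t)"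
  unfolding sets_F by (intro sigma_sets_mono') (auto simp: past_events_def intro: order_trans)

lemma measurable_F_N: "f \<in> measurable (F t) B \<Longrightarrow> f \<in> measurable N B"
  using sets_F_subset[of t] by (auto simp: measurable_def)

lemma measurable_F_mono: "f \<in> measurable (F s) B \<Longrightarrow> s \<le> t \<Longrightarrow> f \<in> measurable (F t) B"
  using sets_F_mono[of s t] by (auto simp: measurable_def)

lemma measurable_F_W:
  assumes "0 \<le> s" "s \<le> t"
  shows "W s \<in> borel_measurable (F t)"
proof (rule measurableI)
  fix A :: "(real^'k) set" assume "A \<in> sets borel"
  then have "W s -` A \<inter> space M \<in> past_events M W t"
    using assms by (auto simp: past_events_def)
  then show "W s -` A \<inter> space (F t) \<in> sets (F t)"
    by (auto simp: sets_F)
qed simp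

text \<open>Independence of the increments is only assumed for the natural filtration.\<close>

lemma F_approx:
  assumes "A \<in> sets (F t)"
  shows "\<exists>B\<in>sigma_sets (space M) (past_events M W t). AE w in N. w \<in> A \<longleftrightarrow> w \<in> B"
  using assms unfolding sets_F
proof (induction rule: sigma_sets.induct)
  case (Basic a)
  then show ?case
  proof
    assume "a \<in> null_sets N"
    then have "AE w in N. w \<in> a \<longleftrightarrow> w \<in> {}"
      by (auto dest: AE_not_in)
    then show ?thesis by (blast intro: sigma_sets.Empty)
  qed (auto intro!: bexI[of _ a])
next
  case Empty
  then show ?case by (intro bexI[of _ "{}"] sigma_sets.Empty) auto
next
  case (Compl a)
  then obtain B where B: "B \<in> sigma_sets (space M) (past_events M W t)" "AE w in N. w \<in> a \<longleftrightarrow> w \<in> B"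
    by blast
  then show ?case
    by (intro bexI[of _ "space M - B"]) (auto intro: sigma_sets.Compl elim: eventually_mono)
next
  case (Union a)
  then have "\<forall>i. \<exists>B. B \<in> sigma_sets (space M) (past_events M W t) \<and> (AE w in N. w \<in> a i \<longleftrightarrow> w \<in> B)"
    by blast
  then obtain B where B: "\<And>i::nat. B i \<in> sigma_sets (space M) (past_events M W t)"
    "\<And>i. AE w in N. w \<in> a i \<longleftrightarrow> w \<in> B i"
    by metis
  have "AE w in N. \<forall>i. w \<in> a i \<longleftrightarrow> w \<in> B i"
    using B(2) by (simp add: AE_all_countable)
  then show ?case
    by (intro bexI[of _ "\<Union>i. B i"]) (auto intro: sigma_sets.Union B(1) elim!: eventually_mono)
qed

section \<open>Independence from the past and moments of increments\<close>

lemma increment_measurable: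
  assumes "0 \<le> s" "s \<le> t"
  shows "(\<lambda>w. W t w - W s w) \<in> borel_measurable M"
  using W_measurable[of s] W_measurable[of t] assms by simp

text \<open>Up to a null set A is an event of the natural filtration, where independence is assumed,
  and null sets change none of the three measures.\<close>

lemma increment_indep:
  assumes st: "0 \<le> s" "s < t" and A: "A \<in> sets (F s)" and C: "C \<in> sets borel"
  shows "measure N (A \<inter> {w\<in>space M. W t w - W s w \<in> C}) =
    measure N A * measure N {w\<in>space M. W t w - W s w \<in> C}"
proof -
  define C' where "C' = {w\<in>space M. W t w - W s w \<in> C}"
  have C'v: "C' = (\<lambda>w. W t w - W s w) -` C \<inter> space M" by (auto simp: C'_def)
  have C'M: "C' \<in> sets M"
    unfolding C'v using st C by (intro measurable_sets[OF increment_measurable]) auto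
  obtain B where B: "B \<in> sigma_sets (space M) (past_events M W s)" "AE w in N. w \<in> A \<longleftrightarrow> w \<in> B"
    using F_approx[OF A] by blast
  have BM: "B \<in> sets M"
    using B(1) sets.sigma_sets_subset[OF past_events_subset[of s]] by blast
  have AN: "A \<in> sets N" using A sets_F_subset by blast
  have ind: "indep_set (sets (vimage_algebra (space M) (\<lambda>w. W t w - W s w) borel))
          (sigma_sets (space M) (past_events M W s))"
    using wiener st by (simp add: wiener_process_def)
  have "C' \<in> sets (vimage_algebra (space M) (\<lambda>w. W t w - W s w) borel)"
    unfolding C'v by (rule in_vimage_algebra[OF C])
  from indep_setD[OF ind this B(1)] have eq: "measure M (B \<inter> C') = measure M B * measure M C'"
    by (simp add: Int_commute mult.commute)
  have "measure N (A \<inter> C') = measure N (B \<inter> C')"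
    using B(2) AN BM C'M by (intro measure_eq_AE) (auto elim!: eventually_mono)
  moreover have "measure N A = measure N B"
    using B(2) AN BM by (intro measure_eq_AE) auto
  ultimately show ?thesis using eq BM C'M by (simp add: C'_def)
qed

text \<open>Plays the role of conditioning on \<open>F s\<close>: past and increment have a product
  law, so Fubini integrates over the increment while the past is held fixed.\<close>

lemma freezing:
  fixes f :: "'a \<times> (real^'k) \<Rightarrow> real"
  assumes st: "0 \<le> s" "s < t" and f: "f \<in> borel_measurable (F s \<Otimes>\<^sub>M borel)"
    and bnd: "\<And>w u. w \<in> space M \<Longrightarrow> \<bar>f (w, u)\<bar> \<le> B"
  shows "(\<integral>w. f (w, W t w - W s w) \<partial>N) = (\<integral>w. (\<integral>w'. f (w, W t w' - W s w') \<partial>N) \<partial>N)"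
    and "(\<lambda>w. \<integral>w'. f (w, W t w' - W s w') \<partial>N) \<in> borel_measurable (F s)"
proof -
  let ?U = "\<lambda>w. W t w - W s w"
  have U: "?U \<in> borel_measurable N"
    using st by (intro measurable_completion increment_measurable) auto
  \<comment> \<open>The identity, read as a random element with values in the space equipped with
    \<open>F s\<close>, carries the whole past; its law is the restriction of N to
    \<open>F s\<close>.\<close>
  have id: "(\<lambda>w. w) \<in> measurable N (F s)"
    using measurable_F_N[of "\<lambda>w. w" s "F s"] by simp
  interpret D1: prob_space "distr N (F s) (\<lambda>w. w)" using id by (rule N.prob_space_distr)
  interpret D2: prob_space "distr N borel ?U" using U by (rule N.prob_space_distr)
  interpret P: pair_prob_space "distr N (F s) (\<lambda>w. w)" "distr N borel ?U" ..
  have eq: "distr N (F s) (\<lambda>w. w) \<Otimes>\<^sub>M distr N borel ?U = distr N (F s \<Otimes>\<^sub>M borel) (\<lambda>x. (x, ?U x))"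
  proof (rule pair_measure_eqI)
    fix A C assume "A \<in> sets (distr N (F s) (\<lambda>w. w))" "C \<in> sets (distr N borel ?U)"
    then have A: "A \<in> sets (F s)" and C: "C \<in> sets borel" by auto
    have AM: "A \<subseteq> space M" using sets.sets_into_space[OF A] by simp
    have 1: "emeasure (distr N (F s) (\<lambda>w. w)) A = ennreal (measure N A)"
      using AM by (subst emeasure_distr[OF id A]) (simp add: N.emeasure_eq_measure Int_absorb2 del: emeasure_completion)
    have "?U -` C \<inter> space N = {w\<in>space M. ?U w \<in> C}" by auto
    then have 2: "emeasure (distr N borel ?U) C = ennreal (measure N {w\<in>space M. ?U w \<in> C})"
      by (subst emeasure_distr[OF U C]) (simp only: N.emeasure_eq_measure)
    have pre: "(\<lambda>x. (x, ?U x)) -` (A \<times> C) \<inter> space N = A \<inter> {w\<in>space M. ?U w \<in> C}"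
      using AM by auto
    have mp: "(\<lambda>x. (x, ?U x)) \<in> measurable N (F s \<Otimes>\<^sub>M borel)" using id U by (rule measurable_Pair)
    have "emeasure (distr N (F s \<Otimes>\<^sub>M borel) (\<lambda>x. (x, ?U x))) (A \<times> C)
        = ennreal (measure N A * measure N {w\<in>space M. ?U w \<in> C})"
      unfolding emeasure_distr[OF mp pair_measureI[OF A C]] pre N.emeasure_eq_measure
        increment_indep[OF st A C] ..
    then show "emeasure (distr N (F s) (\<lambda>w. w)) A * emeasure (distr N borel ?U) C =
        emeasure (distr N (F s \<Otimes>\<^sub>M borel) (\<lambda>x. (x, ?U x))) (A \<times> C)"
      unfolding 1 2 by (simp add: ennreal_mult)
  qed (simp_all add: D1.sigma_finite_measure_axioms D2.sigma_finite_measure_axioms cong: sets_pair_measure_cong)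
  have f': "f \<in> borel_measurable (distr N (F s) (\<lambda>w. w) \<Otimes>\<^sub>M distr N borel ?U)"
    using f by (simp cong: measurable_cong_sets)
  have int: "integrable (distr N (F s) (\<lambda>w. w) \<Otimes>\<^sub>M distr N borel ?U) f"
    using f' bnd by (intro P.integrable_const_bound[of _ B] AE_I2) (auto simp: space_pair_measure)
  have inner: "(\<integral>u. f (w, u) \<partial>distr N borel ?U) = (\<integral>w'. f (w, ?U w') \<partial>N)" if "w \<in> space M" for w
    using f that by (intro integral_distr U) (auto intro!: measurable_Pair2)
  have m: "(\<lambda>w. \<integral>u. f (w, u) \<partial>distr N borel ?U) \<in> borel_measurable (F s)"
    using f by (intro D2.borel_measurable_lebesgue_integral) (simp cong: measurable_cong_sets)
  show "(\<lambda>w. \<integral>w'. f (w, ?U w') \<partial>N) \<in> borel_measurable (F s)"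
    using m by (rule measurable_cong[THEN iffD1, rotated]) (simp add: inner)
  have "(\<integral>w. f (w, ?U w) \<partial>N) = (\<integral>x. f x \<partial>distr N (F s \<Otimes>\<^sub>M borel) (\<lambda>x. (x, ?U x)))"
    using id U f by (intro integral_distr[symmetric]) auto
  also have "\<dots> = (\<integral>w. (\<integral>u. f (w, u) \<partial>distr N borel ?U) \<partial>distr N (F s) (\<lambda>w. w))"
    unfolding eq[symmetric] using int by (rule P.integral_fst'[symmetric])
  also have "\<dots> = (\<integral>w. (\<integral>u. f (w, u) \<partial>distr N borel ?U) \<partial>N)"
    using id m by (intro integral_distr) auto
  also have "\<dots> = (\<integral>w. (\<integral>w'. f (w, ?U w') \<partial>N) \<partial>N)"
    by (intro Bochner_Integration.integral_cong) (auto simp: inner)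
  finally show "(\<integral>w. f (w, ?U w) \<partial>N) = (\<integral>w. (\<integral>w'. f (w, ?U w') \<partial>N) \<partial>N)" .
qed

text \<open>First moments 0 and second moments \<open>t - s\<close> reproduce the generator; fourth
  moments of order \<open>(t - s)\<^sup>2\<close> make quartic errors negligible when summed over a
  fine grid.\<close>

lemma increment_moments:
  assumes st: "0 \<le> s" "s < t"
  shows "integrable N (\<lambda>w. (W t w - W s w) $ i)" "(\<integral>w. (W t w - W s w) $ i \<partial>N) = 0"
    and "integrable N (\<lambda>w. (W t w - W s w) $ i * (W t w - W s w) $ j)"
    and "(\<integral>w. (W t w - W s w) $ i * (W t w - W s w) $ j \<partial>N) = (if i = j then t - s else 0)"
    and "integrable N (\<lambda>w. ((W t w - W s w) $ i) ^ 4)" "(\<integral>w. ((W t w - W s w) $ i) ^ 4 \<partial>N) = 3 * (t - s)\<^sup>2"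
proof -
  define U where "U = (\<lambda>i w. (W t w - W s w) $ i)"
  have Um: "U i \<in> borel_measurable M" for i
    using measurable_compose[OF increment_measurable[of s t] borel_measurable_continuous_onI[of "\<lambda>x. x $ i"]] st
    unfolding U_def by (simp add: continuous_on_component)
  have dist: "distributed M lborel (U i) (normal_density 0 (sqrt (t - s)))" for i
    using wiener st by (simp add: wiener_process_def U_def)
  have pos: "sqrt (t - s) > 0" using st by simp
  have I: "integrable M (\<lambda>w. U i w ^ n)" for i n
    using distributed_integrable[OF dist[of i], of "\<lambda>x. x ^ n"] integrable_normal_moment[OF pos, of 0 n]
    by simp
  have E: "(\<integral>w. U i w ^ n \<partial>M) = (\<integral>x. normal_density 0 (sqrt (t - s)) x * x ^ n \<partial>lborel)" for i n
    using distributed_integral[OF dist[of i], of "\<lambda>x. x ^ n"] by simp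
  have E1: "(\<integral>w. U i w \<partial>M) = 0" for i
    using E[of i 1] integral_normal_moment_odd[OF pos, of 0 0] by simp
  have E2: "(\<integral>w. (U i w)\<^sup>2 \<partial>M) = t - s" for i
    using E[of i 2] integral_normal_moment_even[OF pos, of 0 1] st by simp
  have E4: "(\<integral>w. (U i w)^4 \<partial>M) = 3 * (t - s)\<^sup>2" for i
    using E[of i 4] integral_normal_moment_even[OF pos, of 0 2] st
    by (simp add: fact_numeral power_divide)
  have I1: "integrable M (U i)" for i using I[of i 1] by simp
  have ind: "indep_vars (\<lambda>_. borel) U UNIV"
    using wiener st by (simp add: wiener_process_def U_def)
  have IE: "integrable M (\<lambda>w. U i w * U j w) \<and> (\<integral>w. U i w * U j w \<partial>M) = (if i = j then t - s else 0)" for i j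
  proof (cases "i = j")
    case True then show ?thesis using I[of i 2] E2[of i] by (simp add: power2_eq_square)
  next
    case False
    have ind': "indep_vars (\<lambda>_. borel) U {i, j}" by (rule indep_vars_subset[OF ind]) simp
    show ?thesis
      using indep_vars_integrable[OF _ ind'] indep_vars_lebesgue_integral[OF _ ind'] False I1 E1 by simp
  qed
  have c: "integrable N g" "integral\<^sup>L N g = integral\<^sup>L M g" if "integrable M g" for g :: "'a \<Rightarrow> real"
    using that by (auto simp: integrable_completion integral_completion)
  show "integrable N (\<lambda>w. (W t w - W s w) $ i)" "(\<integral>w. (W t w - W s w) $ i \<partial>N) = 0"
    using c[OF I1[of i]] E1[of i] by (simp_all add: U_def)
  show "integrable N (\<lambda>w. (W t w - W s w) $ i * (W t w - W s w) $ j)"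
    "(\<integral>w. (W t w - W s w) $ i * (W t w - W s w) $ j \<partial>N) = (if i = j then t - s else 0)"
    using c[of "\<lambda>w. U i w * U j w"] IE[of i j] by (simp_all add: U_def)
  show "integrable N (\<lambda>w. ((W t w - W s w) $ i) ^ 4)" "(\<integral>w. ((W t w - W s w) $ i) ^ 4 \<partial>N) = 3 * (t - s)\<^sup>2"
    using c[OF I[of i 4]] E4[of i] by (simp_all add: U_def)
qed

end

section \<open>The supersolution\<close>

text \<open>The integral of exp(\<alpha> s) over s from 0 to r.\<close>

definition growth :: "real \<Rightarrow> real \<Rightarrow> real" where
  "growth \<alpha> r = (if \<alpha> = 0 then r else (exp (\<alpha> * r) - 1) / \<alpha>)"

text \<open>The function g of the overview, rearranged so that a sign condition on \<alpha> v +
  \<beta> can be read off directly; \<open>envelope_eq_exp\<close> gives the form in which the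
  coefficient of v is visibly positive.\<close>

definition envelope :: "('x \<Rightarrow> real) \<Rightarrow> real \<Rightarrow> real \<Rightarrow> real \<Rightarrow> 'x \<Rightarrow> real" where
  "envelope v \<alpha> \<beta> r x = v x + (\<alpha> * v x + \<beta>) * growth \<alpha> r"

lemma growth_0 [simp]: "growth \<alpha> 0 = 0"
  by (simp add: growth_def)

lemma exp_eq_growth: "exp (\<alpha> * r) = 1 + \<alpha> * growth \<alpha> r"
  by (simp add: growth_def)

lemma growth_nonneg: "0 \<le> r \<Longrightarrow> 0 \<le> growth \<alpha> r"
  by (cases "0 \<le> \<alpha>") (auto simp: growth_def zero_le_divide_iff mult_nonpos_nonneg)

lemma growth_add: "growth \<alpha> (r + h) = growth \<alpha> r + exp (\<alpha> * r) * growth \<alpha> h"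
  by (auto simp: growth_def field_simps exp_add)

text \<open>Second-order Maclaurin expansion of the exponential. A quadratic error is small enough
  to be summed over all grid steps.\<close>

lemma growth_approx:
  assumes "0 \<le> h" "h \<le> T"
  shows "\<bar>growth \<alpha> h - h\<bar> \<le> \<bar>\<alpha>\<bar> * exp (\<bar>\<alpha>\<bar> * T) * h\<^sup>2"
proof (cases "\<alpha> = 0")
  case False
  obtain t where t: "\<bar>t\<bar> \<le> \<bar>\<alpha> * h\<bar>" "exp (\<alpha> * h) = 1 + \<alpha> * h + exp t / 2 * (\<alpha> * h)\<^sup>2"
    using Maclaurin_exp_le[of "\<alpha> * h" 2] by (auto simp: numeral_2_eq_2)
  have "t \<le> \<bar>\<alpha>\<bar> * T"
    using t(1) assms mult_left_mono[of h T "\<bar>\<alpha>\<bar>"] by (simp add: abs_mult)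
  then have "exp t / 2 \<le> exp (\<bar>\<alpha>\<bar> * T)"
    using exp_gt_zero[of t] by (smt (verit) exp_le_cancel_iff field_sum_of_halves)
  have "growth \<alpha> h - h = \<alpha> * (exp t / 2) * h\<^sup>2"
    using False by (simp add: growth_def t(2) field_simps power2_eq_square)
  also have "\<bar>\<dots>\<bar> = \<bar>\<alpha>\<bar> * (exp t / 2) * h\<^sup>2"
    by (simp add: abs_mult)
  also have "\<dots> \<le> \<bar>\<alpha>\<bar> * exp (\<bar>\<alpha>\<bar> * T) * h\<^sup>2"
    by (intro mult_mono \<open>exp t / 2 \<le> _\<close>) auto
  finally show ?thesis .
qed (simp add: growth_def)

lemma growth_le:
  assumes "0 \<le> r" "r \<le> T"
  shows "growth \<alpha> r \<le> T + \<bar>\<alpha>\<bar> * exp (\<bar>\<alpha>\<bar> * T) * T\<^sup>2"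
proof -
  have "\<bar>\<alpha>\<bar> * exp (\<bar>\<alpha>\<bar> * T) * r\<^sup>2 \<le> \<bar>\<alpha>\<bar> * exp (\<bar>\<alpha>\<bar> * T) * T\<^sup>2"
    using assms by (intro mult_left_mono power_mono) auto
  then show ?thesis using growth_approx[OF assms, of \<alpha>] assms by linarith
qed

lemma envelope_0 [simp]: "envelope v \<alpha> \<beta> 0 x = v x"
  by (simp add: envelope_def)

lemma envelope_eq_exp: "envelope v \<alpha> \<beta> r x = exp (\<alpha> * r) * v x + \<beta> * growth \<alpha> r"
  by (simp add: envelope_def exp_eq_growth algebra_simps)

lemma envelope_eq_bound:
  "envelope v \<alpha> \<beta> T x =
    (if \<alpha> = 0 then v x + \<beta> * T else exp (\<alpha> * T) * v x + \<beta> / \<alpha> * (exp (\<alpha> * T) - 1))"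
  by (simp add: envelope_eq_exp growth_def)

text \<open>The gain from h more units of remaining time is, to first order, h exp(\<alpha> r)
  (\<alpha> v + \<beta>). This is what pays for the drift of one step, which the generator
  inequality bounds by the same quantity.\<close>

lemma envelope_add:
  "envelope v \<alpha> \<beta> (r + h) x = envelope v \<alpha> \<beta> r x + exp (\<alpha> * r) * growth \<alpha> h * (\<alpha> * v x + \<beta>)"
  unfolding envelope_def growth_add by (simp add: algebra_simps)

lemma continuous_twice_cont_diff:
  assumes "twice_cont_diff v"
  shows "continuous_on S v" "continuous_on S (gradient v)" "continuous_on S (hessian v)"
proof -
  show "continuous_on S v" "continuous_on S (gradient v)"
    using assms unfolding twice_cont_diff_def
    by (auto intro!: differentiable_imp_continuous_on simp: differentiable_on_def differentiable_at_withinI)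
  show "continuous_on S (hessian v)"
    using assms unfolding twice_cont_diff_def by (metis continuous_on_subset subset_UNIV)
qed

text \<open>For fixed \<open>r\<close> the envelope is increasing in \<open>v x\<close>, so it suffices to look at a minimum of
  \<open>v\<close>: there \<open>\<alpha> v + \<beta> \<ge> 0\<close>, by the boundary condition or by the second derivative test.\<close>

lemma envelope_nonneg:
  assumes v: "twice_cont_diff v" and D: "open D" "bounded D"
    and gen: "\<And>x. x \<in> D \<Longrightarrow> generator b \<sigma> v x \<le> \<alpha> * v x + \<beta>"
    and bd: "\<And>x. x \<in> frontier D \<Longrightarrow> 0 \<le> \<alpha> * v x + \<beta>"
    and nn: "\<And>x. x \<in> closure D \<Longrightarrow> 0 \<le> v x"
    and x: "x \<in> closure D" and r: "0 \<le> r"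
  shows "0 \<le> envelope v \<alpha> \<beta> r x"
proof -
  have "compact (closure D)" "closure D \<noteq> {}"
    using D x by (auto simp: compact_closure)
  then obtain m where m: "m \<in> closure D" "\<And>y. y \<in> closure D \<Longrightarrow> v m \<le> v y"
    using continuous_attains_inf[OF _ _ continuous_twice_cont_diff(1)[OF v], of "closure D"] by blast
  have "0 \<le> \<alpha> * v m + \<beta>"
  proof (cases "m \<in> D")
    case True
    have "0 \<le> generator b \<sigma> v m"
      using m closure_subset[of D] by (intro generator_nonneg_at_minimum[OF v D(1) True]) auto
    then show ?thesis using gen[OF True] by linarith
  next
    case False
    then show ?thesis using m D by (intro bd) (simp add: frontier_def interior_open)
  qed
  then have "0 \<le> envelope v \<alpha> \<beta> r m"
    using nn[OF m(1)] growth_nonneg[OF r] by (simp add: envelope_def)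
  also have "\<dots> \<le> envelope v \<alpha> \<beta> r x"
    using m(2)[OF x] by (simp add: envelope_eq_exp)
  finally show ?thesis .
qed

section \<open>Closed regions with a margin inside the domain\<close>

definition inner_region :: "real \<Rightarrow> 'x::metric_space set \<Rightarrow> 'x set" where
  "inner_region \<delta> D = {x. \<forall>y. y \<notin> D \<longrightarrow> \<delta> \<le> dist x y}"

lemma closed_inner_region: "closed (inner_region \<delta> D)"
proof -
  have "inner_region \<delta> D = (\<Inter>y\<in>-D. - ball y \<delta>)"
    by (auto simp: inner_region_def dist_commute not_less)
  then show ?thesis by auto
qed

lemma inner_regionD: "x \<in> inner_region \<delta> D \<Longrightarrow> dist x y < \<delta> \<Longrightarrow> y \<in> D"
  unfolding inner_region_def by force

lemma inner_region_subset: "0 < \<delta> \<Longrightarrow> inner_region \<delta> D \<subseteq> D"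
  using inner_regionD[of _ \<delta> D] by fastforce

text \<open>The path is kept at margin 2 \<delta>, so that a chain following it within \<delta>
  remains at margin \<delta>, where the Taylor bound is available.\<close>

lemma inner_region_near:
  assumes "x \<in> inner_region (2 * \<delta>) D" "dist y x \<le> \<delta>"
  shows "y \<in> inner_region \<delta> D"
  unfolding inner_region_def
proof safe
  fix z assume "z \<notin> D"
  then have "2 * \<delta> \<le> dist x z" using assms by (auto simp: inner_region_def)
  also have "\<dots> \<le> dist y x + dist y z" by (rule dist_triangle2[of x z y, unfolded dist_commute[of x y] dist_commute[of z y]])
  finally show "\<delta> \<le> dist y z" using assms(2) by linarith
qed

lemma inner_region_exhausts:
  fixes D :: "'x::heine_borel set"
  assumes "open D" "compact P" "P \<subseteq> D"
  shows "\<exists>\<delta>>0. P \<subseteq> inner_region \<delta> D"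
proof -
  have "\<exists>d>0. \<forall>x\<in>P. \<forall>y\<in>- D. d \<le> dist x y"
    using assms by (intro separate_compact_closed) auto
  then show ?thesis by (force simp: inner_region_def)
qed

lemma inner_region_antimono: "\<delta> \<le> \<delta>' \<Longrightarrow> inner_region \<delta>' D \<subseteq> inner_region \<delta> D"
  unfolding inner_region_def by force

lemma compact_continuous_bound:
  fixes f :: "'x::topological_space \<Rightarrow> 'y::real_normed_vector"
  assumes "compact K" "continuous_on K f"
  obtains C where "C \<ge> 0" "\<And>x. x \<in> K \<Longrightarrow> norm (f x) \<le> C"
proof -
  have "bounded (f ` K)" using assms by (intro compact_imp_bounded compact_continuous_image)
  then obtain C where "\<And>x. x \<in> K \<Longrightarrow> norm (f x) \<le> C" by (auto simp: bounded_iff)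
  then show ?thesis by (intro that[of "max C 0"]) (auto intro: le_max_iff_disj[THEN iffD2])
qed

text \<open>The envelope is cut off outside \<open>D\<close>, where neither its sign nor the generator is controlled.
  The cut-off function is nonnegative but not continuous; that is harmless because only an upper
  Taylor bound is needed, with large increments absorbed by the fourth-order term.\<close>

lemma envelope_taylor_upper:
  fixes v :: "real^'n \<Rightarrow> real"
  assumes v: "twice_cont_diff v" and D: "open D" "bounded D" and T: "0 \<le> T"
    and nn: "\<And>r x. 0 \<le> r \<Longrightarrow> x \<in> D \<Longrightarrow> 0 \<le> envelope v \<alpha> \<beta> r x"
    and \<delta>: "\<delta> > 0" and e: "e > 0"
  obtains C where "C \<ge> 0"
    "\<And>x y r. x \<in> inner_region \<delta> D \<Longrightarrow> 0 \<le> r \<Longrightarrow> r \<le> T \<Longrightarrow>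
      indicator D (x + y) * envelope v \<alpha> \<beta> r (x + y) \<le>
        envelope v \<alpha> \<beta> r x + exp (\<alpha> * r) * (gradient v x \<bullet> y + 1/2 * (y \<bullet> (hessian v x *v y))
          + e * (norm y)\<^sup>2 + C * (norm y)^4)"
proof -
  let ?K = "closure D"
  have K: "compact ?K" using D by (simp add: compact_closure)
  note cont = continuous_twice_cont_diff[OF v]
  obtain d0 where d0: "d0 > 0"
    "\<And>x y. x \<in> ?K \<Longrightarrow> norm y < d0 \<Longrightarrow>
      \<bar>v (x + y) - (v x + gradient v x \<bullet> y + 1/2 * (y \<bullet> (hessian v x *v y)))\<bar> \<le> e * (norm y)\<^sup>2"
    using taylor_twice_cont_diff[OF v K e] by blast
  obtain Cv where Cv: "Cv \<ge> 0" "\<And>x. x \<in> ?K \<Longrightarrow> \<bar>v x\<bar> \<le> Cv"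
    using compact_continuous_bound[OF K cont(1)] by (metis real_norm_def)
  obtain Cg where Cg: "Cg \<ge> 0" "\<And>x. x \<in> ?K \<Longrightarrow> norm (gradient v x) \<le> Cg"
    using compact_continuous_bound[OF K cont(2)] by blast
  obtain Ch where Ch: "Ch \<ge> 0" "\<And>x. x \<in> ?K \<Longrightarrow> norm (hessian v x) \<le> Ch"
    using compact_continuous_bound[OF K cont(3)] by blast
  \<comment> \<open>Increments shorter than d both admit the Taylor expansion and keep x + y inside
    D.\<close>
  define d where "d = min d0 \<delta>"
  have d: "d > 0" using d0 \<delta> by (simp add: d_def)
  define G where "G = T + \<bar>\<alpha>\<bar> * exp (\<bar>\<alpha>\<bar> * T) * T\<^sup>2"
  have G: "0 \<le> G" using T by (simp add: G_def)
  define B where "B = Cv + (\<bar>\<alpha>\<bar> * Cv + \<bar>\<beta>\<bar>) * G"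
  have B: "B \<ge> 0" using G Cv by (simp add: B_def)
  define a0 where "a0 = exp (- (\<bar>\<alpha>\<bar> * T))"
  have a0: "a0 > 0" by (simp add: a0_def)
  \<comment> \<open>For \<open>norm y \<ge> d\<close> every power of \<open>norm y / d\<close> is at
    least 1, so lower-order quantities can be raised to degree four. The first summand dominates the
    bound B of the left-hand side, with a0 a lower bound of exp(\<alpha> r); the other two
    compensate a negative gradient or hessian term.\<close>
  define C where "C = B / (a0 * d^4) + Cg / d^3 + Ch / d\<^sup>2"
  have C: "C \<ge> 0" using B a0 d Cg Ch by (simp add: C_def)
  show ?thesis
  proof (rule that[OF C])
    fix x y r assume x: "x \<in> inner_region \<delta> D" and r: "0 \<le> r" "r \<le> T"
    have xD: "x \<in> D" using x inner_region_subset[OF \<delta>] by blast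
    then have xK: "x \<in> ?K" using closure_subset by blast
    let ?Q = "gradient v x \<bullet> y + 1/2 * (y \<bullet> (hessian v x *v y))"
    have apos: "exp (\<alpha> * r) > 0" by simp
    show "indicator D (x + y) * envelope v \<alpha> \<beta> r (x + y) \<le>
        envelope v \<alpha> \<beta> r x + exp (\<alpha> * r) * (?Q + e * (norm y)\<^sup>2 + C * (norm y)^4)"
    proof (cases "norm y < d")
      case True
      then have "x + y \<in> D" by (intro inner_regionD[OF x]) (auto simp: dist_norm d_def)
      moreover have "v (x + y) \<le> v x + (?Q + e * (norm y)\<^sup>2)"
        using d0(2)[OF xK, of y] True by (simp add: d_def abs_le_iff)
      moreover have "0 \<le> C * (norm y)^4" using C by simp
      ultimately have "exp (\<alpha> * r) * v (x + y) \<le> exp (\<alpha> * r) * (v x + (?Q + e * (norm y)\<^sup>2 + C * (norm y)^4))"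
        by (intro mult_left_mono) auto
      then show ?thesis using \<open>x + y \<in> D\<close> by (simp add: envelope_eq_exp algebra_simps)
    next
      case False
      then have y: "d \<le> norm y" by simp
      have 1: "indicator D (x + y) * envelope v \<alpha> \<beta> r (x + y) \<le> B"
      proof (cases "x + y \<in> D")
        case True
        then have vb: "\<bar>v (x + y)\<bar> \<le> Cv" using Cv(2) closure_subset by blast
        have "(\<alpha> * v (x + y) + \<beta>) * growth \<alpha> r \<le> (\<bar>\<alpha>\<bar> * Cv + \<bar>\<beta>\<bar>) * G"
        proof (rule mult_mono)
          have "\<alpha> * v (x + y) \<le> \<bar>\<alpha>\<bar> * \<bar>v (x + y)\<bar>" by (metis abs_ge_self abs_mult)
          also have "\<dots> \<le> \<bar>\<alpha>\<bar> * Cv" using vb by (intro mult_left_mono) auto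
          finally show "\<alpha> * v (x + y) + \<beta> \<le> \<bar>\<alpha>\<bar> * Cv + \<bar>\<beta>\<bar>" by linarith
          show "growth \<alpha> r \<le> G" unfolding G_def by (rule growth_le[OF r])
          show "0 \<le> growth \<alpha> r" by (rule growth_nonneg[OF r(1)])
        qed (use Cv in auto)
        then show ?thesis using True vb by (simp add: envelope_def B_def)
      qed (use B in simp)
      have n1: "1 \<le> norm y / d" using y d by simp
      have n4: "1 \<le> (norm y / d)^4" using n1 by (rule one_le_power)
      have n3: "1 \<le> (norm y / d)^3" using n1 by (rule one_le_power)
      have n2: "1 \<le> (norm y / d)\<^sup>2" using n1 by (rule one_le_power)
      have a_ge: "exp (\<alpha> * r) \<ge> a0"
      proof -
        have "- (\<alpha> * r) \<le> \<bar>\<alpha>\<bar> * r" using r by (metis abs_ge_minus_self abs_mult abs_of_nonneg)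
        also have "\<dots> \<le> \<bar>\<alpha>\<bar> * T" using r by (intro mult_left_mono) auto
        finally show ?thesis by (simp add: a0_def)
      qed
      have "B * 1 \<le> B * ((exp (\<alpha> * r) / a0) * (norm y / d)^4)"
        using n4 a_ge a0 B by (intro mult_left_mono mult_ge1_I) auto
      then have b1: "B \<le> exp (\<alpha> * r) * (B / (a0 * d^4) * (norm y)^4)"
        by (simp add: power_divide algebra_simps)
      have "\<bar>gradient v x \<bullet> y\<bar> \<le> Cg * norm y"
        using Cg(2)[OF xK] by (intro order_trans[OF Cauchy_Schwarz_ineq2] mult_right_mono) auto
      also have "\<dots> = Cg * norm y * 1" by simp
      also have "\<dots> \<le> Cg * norm y * (norm y / d)^3"
        using n3 Cg by (intro mult_left_mono) auto
      also have "\<dots> = Cg / d^3 * (norm y)^4"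
        by (simp add: power_divide power4_eq_xxxx power3_eq_cube)
      finally have b2: "\<bar>gradient v x \<bullet> y\<bar> \<le> Cg / d^3 * (norm y)^4" .
      have "\<bar>y \<bullet> (hessian v x *v y)\<bar> \<le> norm y * (Ch * norm y)"
        using Ch(2)[OF xK] by (intro order_trans[OF Cauchy_Schwarz_ineq2] mult_left_mono
            order_trans[OF norm_matrix_vector_mult_le] mult_right_mono) auto
      also have "\<dots> = Ch * (norm y)\<^sup>2 * 1" by (simp add: power2_eq_square)
      also have "\<dots> \<le> Ch * (norm y)\<^sup>2 * (norm y / d)\<^sup>2"
        using n2 Ch by (intro mult_left_mono) auto
      also have "\<dots> = Ch / d\<^sup>2 * (norm y)^4"
        by (simp add: power_divide power4_eq_xxxx power2_eq_square)
      finally have b3: "\<bar>y \<bullet> (hessian v x *v y)\<bar> \<le> Ch / d\<^sup>2 * (norm y)^4" .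
      have "B / (a0 * d^4) * (norm y)^4 \<le> ?Q + e * (norm y)\<^sup>2 + C * (norm y)^4"
      proof -
        have "0 \<le> e * (norm y)\<^sup>2" using e by simp
        moreover have "C * (norm y)^4 = B / (a0 * d^4) * (norm y)^4 + Cg / d^3 * (norm y)^4 + Ch / d\<^sup>2 * (norm y)^4"
          by (simp add: C_def algebra_simps)
        moreover have "0 \<le> Ch / d\<^sup>2 * (norm y)^4" using Ch by simp
        ultimately show ?thesis using b2 b3 by (simp add: abs_le_iff)
      qed
      from mult_left_mono[OF this, of "exp (\<alpha> * r)"] b1
      have "B \<le> exp (\<alpha> * r) * (?Q + e * (norm y)\<^sup>2 + C * (norm y)^4)" by simp
      \<comment> \<open>The quartic term alone dominates the left-hand side; the value of the
        envelope at x may be added on the right because it is nonnegative.\<close>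
      then show ?thesis using 1 nn[OF r(1) xD] by linarith
    qed
  qed
qed

section \<open>Gaussian expectation of the Taylor bound\<close>

lemma norm_add_power2_le:
  fixes x y :: "'v::real_normed_vector"
  shows "(norm (x + y))\<^sup>2 \<le> 2 * (norm x)\<^sup>2 + 2 * (norm y)\<^sup>2"
proof -
  have "(norm (x + y))\<^sup>2 \<le> (norm x + norm y)\<^sup>2" by (intro power_mono norm_triangle_ineq) auto
  also have "\<dots> \<le> 2 * (norm x)\<^sup>2 + 2 * (norm y)\<^sup>2"
    using zero_le_power2[of "norm x - norm y"] by (simp add: power2_sum power2_diff)
  finally show ?thesis .
qed

lemma norm_add_power4_le:
  fixes x y :: "'v::real_normed_vector"
  shows "(norm (x + y))^4 \<le> 8 * (norm x)^4 + 8 * (norm y)^4"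
proof -
  have 4: "a^4 = (a\<^sup>2)\<^sup>2" for a :: real by simp
  have "(norm (x + y))^4 \<le> (2 * (norm x)\<^sup>2 + 2 * (norm y)\<^sup>2)\<^sup>2"
    unfolding 4 by (intro power_mono norm_add_power2_le) auto
  also have "\<dots> \<le> 8 * (norm x)^4 + 8 * (norm y)^4"
    using zero_le_power2[of "(norm x)\<^sup>2 - (norm y)\<^sup>2"] unfolding 4
    by (simp add: power2_sum power2_diff power_mult_distrib)
  finally show ?thesis .
qed

lemma norm_vec_power2: "(norm (u::real^'k))\<^sup>2 = (\<Sum>k\<in>UNIV. (u $ k)\<^sup>2)"
  by (simp add: norm_vec_def L2_set_def sum_nonneg)

lemma norm_vec_power4_le: "(norm (u::real^'k))^4 \<le> CARD('k) * (\<Sum>k\<in>UNIV. (u $ k)^4)"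
proof -
  have "(norm u)^4 = ((norm u)\<^sup>2)\<^sup>2" by simp
  also have "\<dots> \<le> (\<Sum>k\<in>UNIV. ((u $ k)\<^sup>2)\<^sup>2) * CARD('k)"
    unfolding norm_vec_power2 by (rule sum_squared_le_sum_of_squares)
  finally show ?thesis by (simp add: mult.commute)
qed

text \<open>In expectation the terms linear in U vanish, the mixed second moments vanish, and the
  diagonal ones turn the quadratic form into \<open>h / 2\<close> times the trace. Only moments of U
  enter, so f merely has to lie below the polynomial.\<close>

lemma (in prob_space) expectation_quartic_bound:
  fixes U :: "'a \<Rightarrow> real^'k" and S :: "real^'k^'n" and A :: "real^'n^'n" and g d :: "real^'n" and h :: real
  assumes U1: "\<And>i. integrable M (\<lambda>w. U w $ i)" "\<And>i. (\<integral>w. U w $ i \<partial>M) = 0"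
    and U2: "\<And>i j. integrable M (\<lambda>w. U w $ i * U w $ j)"
      "\<And>i j. (\<integral>w. U w $ i * U w $ j \<partial>M) = (if i = j then h else 0)"
    and U4: "\<And>i. integrable M (\<lambda>w. (U w $ i)^4)" "\<And>i. (\<integral>w. (U w $ i)^4 \<partial>M) = 3 * h\<^sup>2"
    and e: "0 \<le> e" and C: "0 \<le> C" and a: "0 \<le> a"
    and f: "integrable M f"
    and le: "\<And>w. f w \<le> c + a * (g \<bullet> (d + S *v U w)
        + 1/2 * ((d + S *v U w) \<bullet> (A *v (d + S *v U w)))
        + e * (norm (d + S *v U w))\<^sup>2 + C * (norm (d + S *v U w))^4)"
  shows "(\<integral>w. f w \<partial>M) \<le> c + a * (g \<bullet> d + 1/2 * (d \<bullet> (A *v d))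
      + h / 2 * trace (transpose S ** A ** S)
      + e * (2 * (norm d)\<^sup>2 + 2 * (norm S)\<^sup>2 * (CARD('k) * h))
      + C * (8 * (norm d)^4 + 24 * (norm S)^4 * (real CARD('k))\<^sup>2 * h\<^sup>2))"
proof -
  let ?c = "\<lambda>k. column k S"
  let ?k = "real CARD('k)"
  \<comment> \<open>The norms are replaced by coordinate polynomials with known integrals. The
    factors 2 and 8 come from separating d and \<open>S *v U w\<close>, one CARD('k) from
    Cauchy-Schwarz in the fourth power; the sum over coordinates gives the second CARD('k), and 24
    is 8 times the Gaussian factor 3.\<close>
  define P where "P = (\<lambda>w. c + a * (g \<bullet> d + 1/2 * (d \<bullet> (A *v d))
     + (\<Sum>k\<in>UNIV. (g \<bullet> ?c k + 1/2 * (d \<bullet> (A *v ?c k) + ?c k \<bullet> (A *v d))) * U w $ k)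
     + (\<Sum>k\<in>UNIV. \<Sum>l\<in>UNIV. (1/2 * (?c k \<bullet> (A *v ?c l))) * (U w $ k * U w $ l))
     + e * (2 * (norm d)\<^sup>2 + 2 * (norm S)\<^sup>2 * (\<Sum>k\<in>UNIV. U w $ k * U w $ k))
     + C * (8 * (norm d)^4 + 8 * (norm S)^4 * (?k * (\<Sum>k\<in>UNIV. (U w $ k)^4)))))"
  have fP: "f w \<le> P w" for w
  proof -
    have SU: "S *v U w = (\<Sum>k\<in>UNIV. U w $ k *\<^sub>R ?c k)"
      by (simp add: matrix_mult_sum scalar_mult_eq_scaleR)
    have AS: "A *v (S *v U w) = (\<Sum>k\<in>UNIV. U w $ k *\<^sub>R (A *v ?c k))"
      unfolding SU by (simp add: linear_sum[OF matrix_vector_mul_linear] matrix_vector_mult_scaleR)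
    have q: "g \<bullet> (d + S *v U w) + 1/2 * ((d + S *v U w) \<bullet> (A *v (d + S *v U w)))
      = g \<bullet> d + 1/2 * (d \<bullet> (A *v d))
       + (g \<bullet> (S *v U w) + 1/2 * (d \<bullet> (A *v (S *v U w)) + (S *v U w) \<bullet> (A *v d)))
       + 1/2 * ((S *v U w) \<bullet> (A *v (S *v U w)))"
      by (simp add: matrix_vector_right_distrib inner_add_left inner_add_right algebra_simps)
    have q1: "g \<bullet> (S *v U w) + 1/2 * (d \<bullet> (A *v (S *v U w)) + (S *v U w) \<bullet> (A *v d))
      = (\<Sum>k\<in>UNIV. (g \<bullet> ?c k + 1/2 * (d \<bullet> (A *v ?c k) + ?c k \<bullet> (A *v d))) * U w $ k)"
      unfolding AS unfolding SU
      by (simp add: inner_sum_left inner_sum_right sum.distrib sum_distrib_left sum_divide_distrib algebra_simps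
          add_divide_distrib)
    have q2: "1/2 * ((S *v U w) \<bullet> (A *v (S *v U w)))
      = (\<Sum>k\<in>UNIV. \<Sum>l\<in>UNIV. (1/2 * (?c k \<bullet> (A *v ?c l))) * (U w $ k * U w $ l))"
      unfolding AS unfolding SU
      by (simp add: inner_sum_left inner_sum_right sum_distrib_left sum_divide_distrib algebra_simps)
        (subst sum.swap, simp add: mult_ac)
    have SUn: "norm (S *v U w) \<le> norm S * norm (U w)" by (rule norm_matrix_vector_mult_le)
    have "(norm (S *v U w))\<^sup>2 \<le> (norm S)\<^sup>2 * (norm (U w))\<^sup>2"
      using power_mono[OF SUn, of 2] by (simp add: power_mult_distrib)
    then have n2: "(norm (d + S *v U w))\<^sup>2 \<le>
        2 * (norm d)\<^sup>2 + 2 * (norm S)\<^sup>2 * (\<Sum>k\<in>UNIV. U w $ k * U w $ k)"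
      using norm_add_power2_le[of d "S *v U w"] by (simp add: norm_vec_power2[of "U w"] power2_eq_square[of "U w $ _"])
    have "(norm (S *v U w))^4 \<le> (norm S)^4 * (norm (U w))^4"
      using power_mono[OF SUn, of 4] by (simp add: power_mult_distrib)
    also have "\<dots> \<le> (norm S)^4 * (?k * (\<Sum>k\<in>UNIV. (U w $ k)^4))"
      by (intro mult_left_mono norm_vec_power4_le) auto
    finally have n4: "(norm (d + S *v U w))^4 \<le>
        8 * (norm d)^4 + 8 * (norm S)^4 * (?k * (\<Sum>k\<in>UNIV. (U w $ k)^4))"
      using norm_add_power4_le[of d "S *v U w"] by linarith
    show ?thesis
      unfolding P_def
      by (rule order_trans[OF le], unfold q q1 q2)
         (intro add_left_mono mult_left_mono a add_mono order_refl e C n2 n4)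
  qed
  have B: "has_bochner_integral M (\<lambda>w. U w $ i) 0"
    "has_bochner_integral M (\<lambda>w. U w $ i * U w $ j) (if i = j then h else 0)"
    "has_bochner_integral M (\<lambda>w. (U w $ i)^4) (3 * h\<^sup>2)" for i j
    unfolding has_bochner_integral_iff using U1 U2 U4 by blast+
  have const: "has_bochner_integral M (\<lambda>w. r) r" for r :: real
    by (simp add: has_bochner_integral_iff prob_space)
  have "has_bochner_integral M P (c + a * (g \<bullet> d + 1/2 * (d \<bullet> (A *v d))
     + (\<Sum>k\<in>UNIV. (g \<bullet> ?c k + 1/2 * (d \<bullet> (A *v ?c k) + ?c k \<bullet> (A *v d))) * 0)
     + (\<Sum>k\<in>UNIV. \<Sum>l\<in>UNIV. (1/2 * (?c k \<bullet> (A *v ?c l))) * (if k = l then h else 0))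
     + e * (2 * (norm d)\<^sup>2 + 2 * (norm S)\<^sup>2 * (\<Sum>k\<in>(UNIV::'k set). (if k = k then h else 0)))
     + C * (8 * (norm d)^4 + 8 * (norm S)^4 * (?k * (\<Sum>k\<in>(UNIV::'k set). 3 * h\<^sup>2)))))"
    unfolding P_def
    by (intro has_bochner_integral_add has_bochner_integral_mult_right has_bochner_integral_sum const B)
  then have "integrable M P" and eq: "(\<integral>w. P w \<partial>M) = c + a * (g \<bullet> d + 1/2 * (d \<bullet> (A *v d))
      + h / 2 * trace (transpose S ** A ** S)
      + e * (2 * (norm d)\<^sup>2 + 2 * (norm S)\<^sup>2 * (CARD('k) * h))
      + C * (8 * (norm d)^4 + 24 * (norm S)^4 * (real CARD('k))\<^sup>2 * h\<^sup>2))"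
    by (auto simp: has_bochner_integral_iff trace_transpose_mult sum_distrib_left if_distrib
        power2_eq_square mult_ac cong: if_cong)
  then show ?thesis
    using integral_mono[OF f \<open>integrable M P\<close> fP] by simp
qed

text \<open>Trades a linear error for a small constant plus a multiple of its square. Only the
  square of the integrand error is under control, so linear occurrences have to be removed in this
  way.\<close>

lemma le_add_square_divide:
  fixes x y :: real assumes "0 < y" "0 \<le> x"
  shows "x \<le> y + x\<^sup>2 / y"
proof (cases "x \<le> y")
  case False
  then have "x * y \<le> x * x" using assms by (intro mult_left_mono) auto
  then have "x \<le> x\<^sup>2 / y" using assms by (simp add: field_simps power2_eq_square)
  then show ?thesis using assms by linarith
qed (use assms in \<open>simp add: add_increasing2\<close>)

text \<open>\<open>S\<close> is the value of an approximating simple integrand, which need not be close to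
  \<open>\<sigma> y\<close> at any given time but only on average; hence the term \<open>C * (norm (S - \<sigma> y))\<^sup>2\<close>.
  It must not depend on the bound \<open>\<kappa>\<close> of the simple integrand, unlike the constant of the
  term that vanishes with the mesh.\<close>

lemma drift_estimate:
  fixes v :: "real^'n \<Rightarrow> real" and b :: "real^'n \<Rightarrow> real^'n" and \<sigma> :: "real^'n \<Rightarrow> real^'k^'n"
  assumes v: "twice_cont_diff v" and D: "open D" "bounded D" and T: "0 \<le> T"
    and cb: "continuous_on UNIV b" and cs: "continuous_on UNIV \<sigma>"
    and gen: "\<And>x. x \<in> D \<Longrightarrow> generator b \<sigma> v x \<le> \<alpha> * v x + \<beta>"
    and nn: "\<And>r x. 0 \<le> r \<Longrightarrow> x \<in> D \<Longrightarrow> 0 \<le> envelope v \<alpha> \<beta> r x"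
    and \<delta>: "\<delta> > 0" and e: "e > 0"
  obtains \<eta> C t c where "\<eta> > 0" "C \<ge> 0" "t > 0" "c \<ge> 0"
    "\<And>x y r. x \<in> inner_region \<delta> D \<Longrightarrow> 0 \<le> r \<Longrightarrow> r \<le> T \<Longrightarrow>
      indicator D (x + y) * envelope v \<alpha> \<beta> r (x + y) \<le>
        envelope v \<alpha> \<beta> r x + exp (\<alpha> * r) * (gradient v x \<bullet> y + 1/2 * (y \<bullet> (hessian v x *v y))
          + t * (norm y)\<^sup>2 + c * (norm y)^4)"
    "\<And>\<kappa>. \<exists>C'\<ge>0. \<forall>x y S r h. x \<in> inner_region \<delta> D \<longrightarrow> y \<in> inner_region \<delta> D \<longrightarrow> dist x y \<le> \<eta> \<longrightarrow>
       norm S \<le> \<kappa> \<longrightarrow> 0 \<le> r \<longrightarrow> 0 < h \<longrightarrow> r + h \<le> T \<longrightarrow>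
       envelope v \<alpha> \<beta> r x + exp (\<alpha> * r) * (gradient v x \<bullet> (h *\<^sub>R b y)
          + 1/2 * ((h *\<^sub>R b y) \<bullet> (hessian v x *v (h *\<^sub>R b y)))
          + h / 2 * trace (transpose S ** hessian v x ** S)
          + t * (2 * (norm (h *\<^sub>R b y))\<^sup>2 + 2 * (norm S)\<^sup>2 * (real CARD('k) * h))
          + c * (8 * (norm (h *\<^sub>R b y))^4 + 24 * (norm S)^4 * (real CARD('k))\<^sup>2 * h\<^sup>2))
       \<le> envelope v \<alpha> \<beta> (r + h) x + h * (e + C * (norm (S - \<sigma> y))\<^sup>2 + C' * h)"
proof -
  let ?K = "closure D"
  let ?k = "real CARD('k)"
  have K: "compact ?K" using D by (simp add: compact_closure)
  note cont = continuous_twice_cont_diff[OF v]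
  have cb': "continuous_on ?K b" and cs': "continuous_on ?K \<sigma>"
    using cb cs by (auto intro: continuous_on_subset)
  obtain C1 where C1: "C1 \<ge> 1" and bnds: "\<And>x. x \<in> ?K \<Longrightarrow> \<bar>v x\<bar> \<le> C1"
    "\<And>x. x \<in> ?K \<Longrightarrow> norm (gradient v x) \<le> C1" "\<And>x. x \<in> ?K \<Longrightarrow> norm (hessian v x) \<le> C1"
    "\<And>x. x \<in> ?K \<Longrightarrow> norm (b x) \<le> C1" "\<And>x. x \<in> ?K \<Longrightarrow> norm (\<sigma> x) \<le> C1"
  proof -
    obtain Cv where Cv: "Cv \<ge> 0" "\<And>x. x \<in> ?K \<Longrightarrow> \<bar>v x\<bar> \<le> Cv"
      using compact_continuous_bound[OF K cont(1)] by (metis real_norm_def)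
    obtain Cg where Cg: "Cg \<ge> 0" "\<And>x. x \<in> ?K \<Longrightarrow> norm (gradient v x) \<le> Cg"
      using compact_continuous_bound[OF K cont(2)] by blast
    obtain Ch where Ch: "Ch \<ge> 0" "\<And>x. x \<in> ?K \<Longrightarrow> norm (hessian v x) \<le> Ch"
      using compact_continuous_bound[OF K cont(3)] by blast
    obtain Cb where Cb: "Cb \<ge> 0" "\<And>x. x \<in> ?K \<Longrightarrow> norm (b x) \<le> Cb"
      using compact_continuous_bound[OF K cb'] by blast
    obtain Cs where Cs: "Cs \<ge> 0" "\<And>x. x \<in> ?K \<Longrightarrow> norm (\<sigma> x) \<le> Cs"
      using compact_continuous_bound[OF K cs'] by blast
    show ?thesis
      using Cv Cg Ch Cb Cs by (intro that[of "1 + Cv + Cg + Ch + Cb + Cs"]) (force intro: order_trans)+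
  qed
  define a where "a = exp (\<bar>\<alpha>\<bar> * T)"
  have a: "a > 0" by (simp add: a_def)
  \<comment> \<open>The total coefficient of u: from the drift against the gradient, from the trace
    term linear in the integrand error, and from the variation of \<sigma>.\<close>
  define Q where "Q = C1 + ?k * C1 * (2 * C1 + 1) + 2 * ?k * C1\<^sup>2"
  have Q: "Q > 0" using C1 by (simp add: Q_def add_pos_nonneg)
  \<comment> \<open>The oscillation of b and \<sigma> allowed over distance \<eta>; it costs half of
    e. The cap 1 lets the product of u and the integrand error be absorbed linearly.\<close>
  define u where "u = min 1 (e / (2 * a * Q))"
  have u: "u > 0" "u \<le> 1" using e a Q by (auto simp: u_def)
  have "u \<le> e / (2 * a * Q)" by (simp add: u_def)
  then have uQ: "a * (u * Q) \<le> e / 2"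
    using a Q by (simp add: field_simps)
  \<comment> \<open>The quadratic Taylor error, integrated against noise of size about \<sigma>,
    costs the other half of e.\<close>
  define t where "t = e / (2 * a * (4 * ?k * C1\<^sup>2))"
  have kC: "4 * ?k * C1\<^sup>2 > 0" using C1 by simp
  have t: "t > 0" using e a kC by (simp add: t_def)
  have tQ: "a * (t * (4 * ?k * C1\<^sup>2)) = e / 2" using a C1 by (simp add: t_def)
  have "uniformly_continuous_on ?K b" "uniformly_continuous_on ?K \<sigma>"
    using cb' cs' K by (auto intro: compact_uniformly_continuous)
  then obtain \<eta>1 \<eta>2 where \<eta>12: "\<eta>1 > 0" "\<eta>2 > 0"
    "\<And>x y. x \<in> ?K \<Longrightarrow> y \<in> ?K \<Longrightarrow> dist y x < \<eta>1 \<Longrightarrow> dist (b y) (b x) < u"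
    "\<And>x y. x \<in> ?K \<Longrightarrow> y \<in> ?K \<Longrightarrow> dist y x < \<eta>2 \<Longrightarrow> dist (\<sigma> y) (\<sigma> x) < u"
    using u(1) unfolding uniformly_continuous_on_def by metis
  define \<eta> where "\<eta> = min \<eta>1 \<eta>2 / 2"
  have \<eta>: "\<eta> > 0" "\<eta> < \<eta>1" "\<eta> < \<eta>2" using \<eta>12 by (auto simp: \<eta>_def)
  obtain c where c: "c \<ge> 0"
    "\<And>x y r. x \<in> inner_region \<delta> D \<Longrightarrow> 0 \<le> r \<Longrightarrow> r \<le> T \<Longrightarrow>
      indicator D (x + y) * envelope v \<alpha> \<beta> r (x + y) \<le>
        envelope v \<alpha> \<beta> r x + exp (\<alpha> * r) * (gradient v x \<bullet> y + 1/2 * (y \<bullet> (hessian v x *v y))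
          + t * (norm y)\<^sup>2 + c * (norm y)^4)"
    using envelope_taylor_upper[OF v D T nn \<delta> t] by blast
  define C where "C = a * (?k * C1 * ((2 * C1 + 1) / u + 1) + 4 * ?k * t)"
  have C: "C \<ge> 0" using a C1 u t by (simp add: C_def)
  define A1 where "A1 = \<bar>\<alpha>\<bar> * C1 + \<bar>\<beta>\<bar>"
  define G where "G = \<bar>\<alpha>\<bar> * exp (\<bar>\<alpha>\<bar> * T)"
  have AG: "A1 \<ge> 0" "G \<ge> 0" using C1 by (auto simp: A1_def G_def)
  show ?thesis
  proof (rule that[OF \<eta>(1) C t c(1)])
    show "\<And>x y r. x \<in> inner_region \<delta> D \<Longrightarrow> 0 \<le> r \<Longrightarrow> r \<le> T \<Longrightarrow>
      indicator D (x + y) * envelope v \<alpha> \<beta> r (x + y) \<le>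
        envelope v \<alpha> \<beta> r x + exp (\<alpha> * r) * (gradient v x \<bullet> y + 1/2 * (y \<bullet> (hessian v x *v y))
          + t * (norm y)\<^sup>2 + c * (norm y)^4)"
      by (rule c(2))
  next
    fix \<kappa> :: real
    \<comment> \<open>Everything of second order in h: the drift in the quadratic form, the drift in
      the Taylor error, the quartic term, and the replacement of h by
      \<open>growth \<alpha> h\<close>. The bound \<kappa> enters only through the quartic
      term.\<close>
    define C' where "C' = a * (C1^3 / 2 + 2 * t * C1\<^sup>2 + c * (8 * (T\<^sup>2 * C1^4) + 24 * \<kappa>^4 * ?k\<^sup>2) + A1 * G)"
    have C': "C' \<ge> 0" using a C1 t c AG by (simp add: C'_def)
    show "\<exists>C'\<ge>0. \<forall>x y S r h. x \<in> inner_region \<delta> D \<longrightarrow> y \<in> inner_region \<delta> D \<longrightarrow> dist x y \<le> \<eta> \<longrightarrow>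
       norm S \<le> \<kappa> \<longrightarrow> 0 \<le> r \<longrightarrow> 0 < h \<longrightarrow> r + h \<le> T \<longrightarrow>
       envelope v \<alpha> \<beta> r x + exp (\<alpha> * r) * (gradient v x \<bullet> (h *\<^sub>R b y)
          + 1/2 * ((h *\<^sub>R b y) \<bullet> (hessian v x *v (h *\<^sub>R b y)))
          + h / 2 * trace (transpose S ** hessian v x ** S)
          + t * (2 * (norm (h *\<^sub>R b y))\<^sup>2 + 2 * (norm S)\<^sup>2 * (?k * h))
          + c * (8 * (norm (h *\<^sub>R b y))^4 + 24 * (norm S)^4 * ?k\<^sup>2 * h\<^sup>2))
       \<le> envelope v \<alpha> \<beta> (r + h) x + h * (e + C * (norm (S - \<sigma> y))\<^sup>2 + C' * h)"
    proof (intro exI[of _ C'] conjI C' allI impI)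
      fix x y :: "real^'n" and S :: "real^'k^'n" and r h :: real
      assume x: "x \<in> inner_region \<delta> D" and y: "y \<in> inner_region \<delta> D" and xy: "dist x y \<le> \<eta>"
        and S: "norm S \<le> \<kappa>" and r: "0 \<le> r" and h: "0 < h" and rh: "r + h \<le> T"
      have xD: "x \<in> D" using x inner_region_subset[OF \<delta>] by blast
      have xK: "x \<in> ?K" "y \<in> ?K" using x y inner_region_subset[OF \<delta>] closure_subset by blast+
      note bx = bnds[OF xK(1)] and by' = bnds[OF xK(2)]
      have du: "norm (b y - b x) \<le> u" "norm (\<sigma> y - \<sigma> x) \<le> u"
        using \<eta>12(3)[OF xK] \<eta>12(4)[OF xK] xy \<eta> by (auto simp: dist_norm norm_minus_commute)
      let ?A = "hessian v x" and ?g = "gradient v x"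
      let ?tr = "\<lambda>S. trace (transpose S ** ?A ** S)"
      define q where "q = norm (S - \<sigma> y)"
      have q: "q \<ge> 0" by (simp add: q_def)
      have Sx: "norm (S - \<sigma> x) \<le> q + u"
        using norm_triangle_ineq[of "S - \<sigma> y" "\<sigma> y - \<sigma> x"] du(2) by (simp add: q_def)
      \<comment> \<open>In the first-order terms S is bounded through its distance q from \<sigma> y
        instead of \<kappa>; this keeps C free of \<kappa>.\<close>
      have Sn: "norm S \<le> C1 + q"
        using norm_triangle_ineq[of "S - \<sigma> y" "\<sigma> y"] by'(5) by (simp add: q_def)
      have qu: "q \<le> u + q\<^sup>2 / u" using le_add_square_divide[OF u(1) q] .
      have i1: "?g \<bullet> b y \<le> ?g \<bullet> b x + C1 * u"
      proof -
        have "?g \<bullet> (b y - b x) \<le> norm ?g * norm (b y - b x)" by (rule norm_cauchy_schwarz)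
        also have "\<dots> \<le> C1 * u" using bx(2) du(1) C1 by (intro mult_mono) auto
        finally show ?thesis by (simp add: inner_diff_right)
      qed
      have i2: "?tr S / 2 \<le> ?tr (\<sigma> x) / 2 + ?k * C1 * ((2 * C1 + 1) * (u + q\<^sup>2 / u) + q\<^sup>2 + 2 * C1 * u)"
      proof -
        have "?tr S - ?tr (\<sigma> x) \<le> ?k * (norm ?A * norm (S - \<sigma> x) * (norm S + norm (\<sigma> x)))"
          using abs_trace_transpose_mult_diff_le[of S ?A "\<sigma> x"] by (simp add: abs_le_iff)
        also have "\<dots> \<le> ?k * (C1 * (q + u) * ((C1 + q) + C1))"
          using bx(3,5) Sx Sn C1 q u by (intro mult_left_mono mult_mono add_mono) auto
        also have "\<dots> = ?k * C1 * (2 * C1 * q + q\<^sup>2 + 2 * C1 * u + u * q)"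
          by (simp add: algebra_simps power2_eq_square)
        also have "\<dots> \<le> ?k * C1 * (2 * C1 * q + q\<^sup>2 + 2 * C1 * u + 1 * q)"
          using u q C1 by (intro mult_left_mono add_left_mono mult_right_mono) auto
        also have "\<dots> = ?k * C1 * ((2 * C1 + 1) * q + q\<^sup>2 + 2 * C1 * u)"
          by (simp add: algebra_simps)
        also have "\<dots> \<le> ?k * C1 * ((2 * C1 + 1) * (u + q\<^sup>2 / u) + q\<^sup>2 + 2 * C1 * u)"
          using qu C1 by (intro mult_left_mono add_right_mono) auto
        finally have "?tr S - ?tr (\<sigma> x) \<le> ?k * C1 * ((2 * C1 + 1) * (u + q\<^sup>2 / u) + q\<^sup>2 + 2 * C1 * u)" .
        moreover have "0 \<le> ?k * C1 * ((2 * C1 + 1) * (u + q\<^sup>2 / u) + q\<^sup>2 + 2 * C1 * u)"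
          using C1 u by simp
        moreover have "p / 2 \<le> p' / 2 + z" if "p - p' \<le> z" "0 \<le> z" for p p' z :: real
          using that by linarith
        ultimately show ?thesis by blast
      qed
      have i3: "?g \<bullet> b x + ?tr (\<sigma> x) / 2 \<le> \<alpha> * v x + \<beta>"
        using gen[OF xD] by (simp add: generator_def)
      have i4: "1/2 * ((h *\<^sub>R b y) \<bullet> (?A *v (h *\<^sub>R b y))) \<le> h * (h * (C1^3 / 2))"
      proof -
        have "b y \<bullet> (?A *v b y) \<le> norm (b y) * (norm ?A * norm (b y))"
          by (intro order_trans[OF norm_cauchy_schwarz] mult_left_mono norm_matrix_vector_mult_le) auto
        also have "\<dots> \<le> C1 * (C1 * C1)"
          using by'(4) bx(3) C1 by (intro mult_mono) auto
        finally have "h\<^sup>2 / 2 * (b y \<bullet> (?A *v b y)) \<le> h\<^sup>2 / 2 * (C1 * (C1 * C1))"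
          by (intro mult_left_mono) auto
        then show ?thesis by (simp add: matrix_vector_mult_scaleR power2_eq_square power3_eq_cube algebra_simps)
      qed
      have nh: "norm (h *\<^sub>R b y) \<le> h * C1" using h by'(4) by simp
      have i5: "t * (2 * (norm (h *\<^sub>R b y))\<^sup>2 + 2 * (norm S)\<^sup>2 * (?k * h))
        \<le> h * (h * (2 * t * C1\<^sup>2) + t * (4 * ?k * C1\<^sup>2) + 4 * ?k * t * q\<^sup>2)"
      proof -
        have "(norm (h *\<^sub>R b y))\<^sup>2 \<le> h\<^sup>2 * C1\<^sup>2" using power_mono[OF nh, of 2] by (simp add: power_mult_distrib)
        moreover have "(norm S)\<^sup>2 \<le> 2 * C1\<^sup>2 + 2 * q\<^sup>2"
          using power_mono[OF Sn, of 2] zero_le_power2[of "C1 - q"] by (simp add: power2_sum power2_diff)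
        ultimately have "t * (2 * (norm (h *\<^sub>R b y))\<^sup>2 + 2 * (norm S)\<^sup>2 * (?k * h))
          \<le> t * (2 * (h\<^sup>2 * C1\<^sup>2) + 2 * (2 * C1\<^sup>2 + 2 * q\<^sup>2) * (?k * h))"
          using t h by (intro mult_left_mono add_mono mult_right_mono) auto
        then show ?thesis by (simp add: algebra_simps power2_eq_square)
      qed
      have i6: "c * (8 * (norm (h *\<^sub>R b y))^4 + 24 * (norm S)^4 * ?k\<^sup>2 * h\<^sup>2)
        \<le> h * (h * (c * (8 * (T\<^sup>2 * C1^4) + 24 * \<kappa>^4 * ?k\<^sup>2)))"
      proof -
        have "(norm (h *\<^sub>R b y))^4 \<le> h^4 * C1^4" using power_mono[OF nh, of 4] by (simp add: power_mult_distrib)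
        also have "\<dots> = h\<^sup>2 * (h\<^sup>2 * C1^4)" by (simp add: power4_eq_xxxx power2_eq_square)
        also have "\<dots> \<le> h\<^sup>2 * (T\<^sup>2 * C1^4)"
          using h r rh C1 by (intro mult_left_mono mult_right_mono power_mono) auto
        finally have 1: "(norm (h *\<^sub>R b y))^4 \<le> h\<^sup>2 * (T\<^sup>2 * C1^4)" .
        have 2: "24 * (norm S)^4 * ?k\<^sup>2 * h\<^sup>2 \<le> 24 * \<kappa>^4 * ?k\<^sup>2 * h\<^sup>2"
          using S by (intro mult_right_mono mult_left_mono power_mono) auto
        have "c * (8 * (norm (h *\<^sub>R b y))^4 + 24 * (norm S)^4 * ?k\<^sup>2 * h\<^sup>2)
          \<le> c * (8 * (h\<^sup>2 * (T\<^sup>2 * C1^4)) + 24 * \<kappa>^4 * ?k\<^sup>2 * h\<^sup>2)"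
          using c 1 2 by (intro mult_left_mono add_mono) auto
        then show ?thesis by (simp add: algebra_simps power2_eq_square)
      qed
      have i7: "h * (\<alpha> * v x + \<beta>) - growth \<alpha> h * (\<alpha> * v x + \<beta>) \<le> h * (h * (A1 * G))"
      proof -
        have "\<bar>\<alpha> * v x\<bar> \<le> \<bar>\<alpha>\<bar> * C1" using bx(1) by (simp add: abs_mult mult_left_mono)
        then have "\<bar>\<alpha> * v x + \<beta>\<bar> \<le> A1" unfolding A1_def by linarith
        moreover have "\<bar>growth \<alpha> h - h\<bar> \<le> G * h\<^sup>2"
          using growth_approx[of h T \<alpha>] h r rh by (simp add: G_def)
        ultimately have "\<bar>growth \<alpha> h - h\<bar> * \<bar>\<alpha> * v x + \<beta>\<bar> \<le> (G * h\<^sup>2) * A1"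
          using AG by (intro mult_mono) auto
        moreover have "h * (\<alpha> * v x + \<beta>) - growth \<alpha> h * (\<alpha> * v x + \<beta>) \<le> \<bar>growth \<alpha> h - h\<bar> * \<bar>\<alpha> * v x + \<beta>\<bar>"
          unfolding abs_mult[symmetric] by (simp add: algebra_simps abs_le_iff)
        ultimately show ?thesis by (simp add: algebra_simps power2_eq_square)
      qed
      define E where "E = u * Q + t * (4 * ?k * C1\<^sup>2)
          + (?k * C1 * ((2 * C1 + 1) / u + 1) + 4 * ?k * t) * q\<^sup>2
          + h * (C1^3 / 2 + 2 * t * C1\<^sup>2 + c * (8 * (T\<^sup>2 * C1^4) + 24 * \<kappa>^4 * ?k\<^sup>2) + A1 * G)"
      have E: "E \<ge> 0" using u Q t C1 c AG h by (simp add: E_def)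
      have main: "?g \<bullet> (h *\<^sub>R b y) + 1/2 * ((h *\<^sub>R b y) \<bullet> (?A *v (h *\<^sub>R b y))) + h / 2 * ?tr S
          + t * (2 * (norm (h *\<^sub>R b y))\<^sup>2 + 2 * (norm S)\<^sup>2 * (?k * h))
          + c * (8 * (norm (h *\<^sub>R b y))^4 + 24 * (norm S)^4 * ?k\<^sup>2 * h\<^sup>2)
          \<le> growth \<alpha> h * (\<alpha> * v x + \<beta>) + h * E"
      proof -
        have "?g \<bullet> b y + ?tr S / 2 \<le> \<alpha> * v x + \<beta> + C1 * u
            + ?k * C1 * ((2 * C1 + 1) * (u + q\<^sup>2 / u) + q\<^sup>2 + 2 * C1 * u)"
          using i1 i2 i3 by linarith
        also have "\<dots> = \<alpha> * v x + \<beta> + u * Q + ?k * C1 * ((2 * C1 + 1) / u + 1) * q\<^sup>2"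
          by (simp add: Q_def algebra_simps power2_eq_square add_divide_distrib)
        finally have "h * (?g \<bullet> b y + ?tr S / 2) \<le>
          h * (\<alpha> * v x + \<beta> + u * Q + ?k * C1 * ((2 * C1 + 1) / u + 1) * q\<^sup>2)"
          using h by (intro mult_left_mono) auto
        then have "?g \<bullet> (h *\<^sub>R b y) + h / 2 * ?tr S \<le> h * (\<alpha> * v x + \<beta>) + h * (u * Q)
            + h * (?k * C1 * ((2 * C1 + 1) / u + 1) * q\<^sup>2)"
          by (simp add: algebra_simps)
        moreover have "h * E = h * (u * Q) + h * (t * (4 * ?k * C1\<^sup>2))
          + h * (?k * C1 * ((2 * C1 + 1) / u + 1) * q\<^sup>2) + h * (4 * ?k * t * q\<^sup>2)
          + h * (h * (C1^3 / 2)) + h * (h * (2 * t * C1\<^sup>2))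
          + h * (h * (c * (8 * (T\<^sup>2 * C1^4) + 24 * \<kappa>^4 * ?k\<^sup>2))) + h * (h * (A1 * G))"
          unfolding E_def by (simp only: distrib_left distrib_right add.assoc)
        moreover have "h * (h * (2 * t * C1\<^sup>2) + t * (4 * ?k * C1\<^sup>2) + 4 * ?k * t * q\<^sup>2)
          = h * (h * (2 * t * C1\<^sup>2)) + h * (t * (4 * ?k * C1\<^sup>2)) + h * (4 * ?k * t * q\<^sup>2)"
          by (simp only: distrib_left)
        ultimately show ?thesis using i4 i5 i6 i7 by linarith
      qed
      have a_ge: "exp (\<alpha> * r) \<le> a"
      proof -
        have "\<alpha> * r \<le> \<bar>\<alpha>\<bar> * r" using r by (intro mult_right_mono) auto
        also have "\<dots> \<le> \<bar>\<alpha>\<bar> * T" using r h rh by (intro mult_left_mono) auto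
        finally show ?thesis by (simp add: a_def)
      qed
      have "exp (\<alpha> * r) * (h * E) \<le> a * (h * E)" using a_ge E h by (intro mult_right_mono) auto
      also have "\<dots> = h * (a * (u * Q) + a * (t * (4 * ?k * C1\<^sup>2)) + C * q\<^sup>2 + C' * h)"
        by (simp add: E_def C_def C'_def algebra_simps)
      also have "\<dots> \<le> h * (e + C * q\<^sup>2 + C' * h)"
        using uQ tQ h by (intro mult_left_mono) auto
      finally have fin: "exp (\<alpha> * r) * (h * E) \<le> h * (e + C * q\<^sup>2 + C' * h)" .
      have "envelope v \<alpha> \<beta> (r + h) x = envelope v \<alpha> \<beta> r x + exp (\<alpha> * r) * (growth \<alpha> h * (\<alpha> * v x + \<beta>))"
        by (simp add: envelope_add mult.assoc)
      moreover have "exp (\<alpha> * r) * (?g \<bullet> (h *\<^sub>R b y) + 1/2 * ((h *\<^sub>R b y) \<bullet> (?A *v (h *\<^sub>R b y))) + h / 2 * ?tr S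
          + t * (2 * (norm (h *\<^sub>R b y))\<^sup>2 + 2 * (norm S)\<^sup>2 * (?k * h))
          + c * (8 * (norm (h *\<^sub>R b y))^4 + 24 * (norm S)^4 * ?k\<^sup>2 * h\<^sup>2))
        \<le> exp (\<alpha> * r) * (growth \<alpha> h * (\<alpha> * v x + \<beta>)) + exp (\<alpha> * r) * (h * E)"
        using mult_left_mono[OF main, of "exp (\<alpha> * r)"] by (simp only: distrib_left exp_ge_zero)
      ultimately show "envelope v \<alpha> \<beta> r x + exp (\<alpha> * r) * (?g \<bullet> (h *\<^sub>R b y)
          + 1/2 * ((h *\<^sub>R b y) \<bullet> (?A *v (h *\<^sub>R b y))) + h / 2 * ?tr S
          + t * (2 * (norm (h *\<^sub>R b y))\<^sup>2 + 2 * (norm S)\<^sup>2 * (?k * h))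
          + c * (8 * (norm (h *\<^sub>R b y))^4 + 24 * (norm S)^4 * ?k\<^sup>2 * h\<^sup>2))
       \<le> envelope v \<alpha> \<beta> (r + h) x + h * (e + C * (norm (S - \<sigma> y))\<^sup>2 + C' * h)"
        using fin by (simp only: q_def)
    qed
  qed
qed

section \<open>Expected change of the cut-off envelope in one step\<close>

lemma cutoff_envelope_measurable:
  fixes v :: "real^'n \<Rightarrow> real"
  assumes "twice_cont_diff v" "open D"
  shows "(\<lambda>z. indicator D z * envelope v \<alpha> \<beta> r z) \<in> borel_measurable borel"
proof -
  have [measurable]: "v \<in> borel_measurable borel"
    using continuous_twice_cont_diff(1)[OF assms(1)] by (rule borel_measurable_continuous_onI)
  have [measurable]: "D \<in> sets borel" using assms(2) by simp
  show ?thesis unfolding envelope_def by measurable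
qed

lemma cutoff_envelope_bounded:
  fixes v :: "real^'n \<Rightarrow> real"
  assumes "twice_cont_diff v" "bounded D"
  obtains B where "B \<ge> 0" "\<And>z. \<bar>indicator D z * envelope v \<alpha> \<beta> r z\<bar> \<le> B"
proof -
  have "continuous_on (closure D) (envelope v \<alpha> \<beta> r)"
    unfolding envelope_def by (intro continuous_intros continuous_twice_cont_diff(1)[OF assms(1)])
  then obtain B where B: "B \<ge> 0" "\<And>x. x \<in> closure D \<Longrightarrow> norm (envelope v \<alpha> \<beta> r x) \<le> B"
    using assms(2) compact_continuous_bound[of "closure D" "envelope v \<alpha> \<beta> r"] by (auto simp: compact_closure)
  show ?thesis
    by (rule that[OF B(1)]) (use B closure_subset[of D] in \<open>auto simp: indicator_def\<close>)
qed

lemma borel_measurable_matrix_vector_mult: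
  fixes f :: "'b \<Rightarrow> real^'k^'n" and g :: "'b \<Rightarrow> real^'k"
  assumes "f \<in> borel_measurable M" "g \<in> borel_measurable M"
  shows "(\<lambda>x. f x *v g x) \<in> borel_measurable M"
proof (rule borel_measurable_continuous_Pair[OF assms])
  show "continuous_on UNIV (\<lambda>x. fst x *v (snd x :: real^'k) :: real^'n)"
    by (auto simp: matrix_vector_mult_def intro!: continuous_intros)
qed

context wiener_space
begin

text \<open>Here x is the position of the chain, y that of the path, and S the current value of the
  simple integrand. The quantifier order matters: \<eta> and C are fixed before the bound \<kappa>
  of the integrand, C' after it.\<close>

lemma expected_step:
  fixes v :: "real^'n \<Rightarrow> real" and b :: "real^'n \<Rightarrow> real^'n" and \<sigma> :: "real^'n \<Rightarrow> real^'k^'n"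
  assumes v: "twice_cont_diff v" and D: "open D" "bounded D" and T: "0 \<le> T"
    and cb: "continuous_on UNIV b" and cs: "continuous_on UNIV \<sigma>"
    and gen: "\<And>x. x \<in> D \<Longrightarrow> generator b \<sigma> v x \<le> \<alpha> * v x + \<beta>"
    and nn: "\<And>r x. 0 \<le> r \<Longrightarrow> x \<in> D \<Longrightarrow> 0 \<le> envelope v \<alpha> \<beta> r x"
    and \<delta>: "\<delta> > 0" and e: "e > 0"
  obtains \<eta> C where "\<eta> > 0" "C \<ge> 0"
    "\<And>\<kappa>. \<exists>C'\<ge>0. \<forall>x y S r s s'. x \<in> inner_region \<delta> D \<longrightarrow> y \<in> inner_region \<delta> D \<longrightarrow> dist x y \<le> \<eta> \<longrightarrow>
       norm S \<le> \<kappa> \<longrightarrow> 0 \<le> r \<longrightarrow> 0 \<le> s \<longrightarrow> s < s' \<longrightarrow> r + (s' - s) \<le> T \<longrightarrow>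
       (\<integral>w. indicator D (x + ((s' - s) *\<^sub>R b y + S *v (W s' w - W s w)))
          * envelope v \<alpha> \<beta> r (x + ((s' - s) *\<^sub>R b y + S *v (W s' w - W s w))) \<partial>N)
       \<le> envelope v \<alpha> \<beta> (r + (s' - s)) x + (s' - s) * (e + C * (norm (S - \<sigma> y))\<^sup>2 + C' * (s' - s))"
proof (rule drift_estimate[OF v D T cb cs gen nn \<delta> e])
  fix \<eta> C t c
  assume 1: "\<eta> > 0" "C \<ge> 0" "t > 0" "c \<ge> 0"
    "\<And>x y r. x \<in> inner_region \<delta> D \<Longrightarrow> 0 \<le> r \<Longrightarrow> r \<le> T \<Longrightarrow>
      indicator D (x + y) * envelope v \<alpha> \<beta> r (x + y) \<le>
        envelope v \<alpha> \<beta> r x + exp (\<alpha> * r) * (gradient v x \<bullet> y + 1/2 * (y \<bullet> (hessian v x *v y))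
          + t * (norm y)\<^sup>2 + c * (norm y)^4)"
    and 2: "\<And>\<kappa>. \<exists>C'\<ge>0. \<forall>x y S r h. x \<in> inner_region \<delta> D \<longrightarrow> y \<in> inner_region \<delta> D \<longrightarrow> dist x y \<le> \<eta> \<longrightarrow>
       norm S \<le> \<kappa> \<longrightarrow> 0 \<le> r \<longrightarrow> 0 < h \<longrightarrow> r + h \<le> T \<longrightarrow>
       envelope v \<alpha> \<beta> r x + exp (\<alpha> * r) * (gradient v x \<bullet> (h *\<^sub>R b y)
          + 1/2 * ((h *\<^sub>R b y) \<bullet> (hessian v x *v (h *\<^sub>R b y)))
          + h / 2 * trace (transpose S ** hessian v x ** S)
          + t * (2 * (norm (h *\<^sub>R b y))\<^sup>2 + 2 * (norm S)\<^sup>2 * (real CARD('k) * h))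
          + c * (8 * (norm (h *\<^sub>R b y))^4 + 24 * (norm S)^4 * (real CARD('k))\<^sup>2 * h\<^sup>2))
       \<le> envelope v \<alpha> \<beta> (r + h) x + h * (e + C * (norm (S - \<sigma> y))\<^sup>2 + C' * h)"
  show ?thesis
  proof (rule that[OF 1(1,2)])
    fix \<kappa>
    obtain C' where C': "C' \<ge> 0" and 3: "\<And>x y S r h. x \<in> inner_region \<delta> D \<Longrightarrow> y \<in> inner_region \<delta> D \<Longrightarrow> dist x y \<le> \<eta> \<Longrightarrow>
       norm S \<le> \<kappa> \<Longrightarrow> 0 \<le> r \<Longrightarrow> 0 < h \<Longrightarrow> r + h \<le> T \<Longrightarrow>
       envelope v \<alpha> \<beta> r x + exp (\<alpha> * r) * (gradient v x \<bullet> (h *\<^sub>R b y)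
          + 1/2 * ((h *\<^sub>R b y) \<bullet> (hessian v x *v (h *\<^sub>R b y)))
          + h / 2 * trace (transpose S ** hessian v x ** S)
          + t * (2 * (norm (h *\<^sub>R b y))\<^sup>2 + 2 * (norm S)\<^sup>2 * (real CARD('k) * h))
          + c * (8 * (norm (h *\<^sub>R b y))^4 + 24 * (norm S)^4 * (real CARD('k))\<^sup>2 * h\<^sup>2))
       \<le> envelope v \<alpha> \<beta> (r + h) x + h * (e + C * (norm (S - \<sigma> y))\<^sup>2 + C' * h)"
      using 2[of \<kappa>] by blast
    show "\<exists>C'\<ge>0. \<forall>x y S r s s'. x \<in> inner_region \<delta> D \<longrightarrow> y \<in> inner_region \<delta> D \<longrightarrow> dist x y \<le> \<eta> \<longrightarrow>
       norm S \<le> \<kappa> \<longrightarrow> 0 \<le> r \<longrightarrow> 0 \<le> s \<longrightarrow> s < s' \<longrightarrow> r + (s' - s) \<le> T \<longrightarrow>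
       (\<integral>w. indicator D (x + ((s' - s) *\<^sub>R b y + S *v (W s' w - W s w)))
          * envelope v \<alpha> \<beta> r (x + ((s' - s) *\<^sub>R b y + S *v (W s' w - W s w))) \<partial>N)
       \<le> envelope v \<alpha> \<beta> (r + (s' - s)) x + (s' - s) * (e + C * (norm (S - \<sigma> y))\<^sup>2 + C' * (s' - s))"
    proof (intro exI[of _ C'] conjI C' allI impI)
      fix x y :: "real^'n" and S :: "real^'k^'n" and r s s' :: real
      assume x: "x \<in> inner_region \<delta> D" and y: "y \<in> inner_region \<delta> D" and xy: "dist x y \<le> \<eta>"
        and S: "norm S \<le> \<kappa>" and r: "0 \<le> r" and s: "0 \<le> s" "s < s'" and rs: "r + (s' - s) \<le> T"
      let ?h = "s' - s"
      let ?U = "\<lambda>w. W s' w - W s w"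
      let ?f = "\<lambda>w. indicator D (x + (?h *\<^sub>R b y + S *v ?U w)) * envelope v \<alpha> \<beta> r (x + (?h *\<^sub>R b y + S *v ?U w))"
      obtain B where B: "\<And>z. \<bar>indicator D z * envelope v \<alpha> \<beta> r z\<bar> \<le> B"
        using cutoff_envelope_bounded[OF v D(2)] by metis
      have U: "?U \<in> borel_measurable N"
        using s by (intro measurable_completion increment_measurable) auto
      have "(\<lambda>w. x + (?h *\<^sub>R b y + S *v ?U w)) \<in> borel_measurable N"
        by (intro borel_measurable_add borel_measurable_const borel_measurable_matrix_vector_mult U)
      from measurable_compose[OF this cutoff_envelope_measurable[OF v D(1)]]
      have int: "integrable N ?f"
        using B by (intro N.integrable_const_bound[of _ B] AE_I2) auto
      note mom = increment_moments[OF s]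
      have "(\<integral>w. ?f w \<partial>N) \<le> envelope v \<alpha> \<beta> r x + exp (\<alpha> * r) * (gradient v x \<bullet> (?h *\<^sub>R b y)
          + 1/2 * ((?h *\<^sub>R b y) \<bullet> (hessian v x *v (?h *\<^sub>R b y)))
          + ?h / 2 * trace (transpose S ** hessian v x ** S)
          + t * (2 * (norm (?h *\<^sub>R b y))\<^sup>2 + 2 * (norm S)\<^sup>2 * (CARD('k) * ?h))
          + c * (8 * (norm (?h *\<^sub>R b y))^4 + 24 * (norm S)^4 * (real CARD('k))\<^sup>2 * ?h\<^sup>2))"
        using 1(3,4) r s rs by (intro N.expectation_quartic_bound[where U = ?U] mom int 1(5)[OF x]) auto
      also have "\<dots> \<le> envelope v \<alpha> \<beta> (r + ?h) x + ?h * (e + C * (norm (S - \<sigma> y))\<^sup>2 + C' * ?h)"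
        using s by (intro 3[OF x y xy S r _ rs]) simp
      finally show "(\<integral>w. ?f w \<partial>N) \<le> envelope v \<alpha> \<beta> (r + ?h) x + ?h * (e + C * (norm (S - \<sigma> y))\<^sup>2 + C' * ?h)" .
    qed
  qed
qed

end

section \<open>The stopped Euler chain\<close>

lemma increasing_upto_mono:
  fixes s :: "nat \<Rightarrow> real"
  assumes "\<And>i. i < n \<Longrightarrow> s i < s (Suc i)" "i \<le> j" "j \<le> n"
  shows "s i \<le> s j"
  using assms(3,2)
proof (induction j)
  case (Suc j)
  then show ?case using assms(1)[of j] by (cases "i = Suc j") auto
qed simp

context wiener_space
begin

text \<open>Y is the sampled path, Z the Euler chain, and \<open>G i\<close> the event that the
  chain has not been stopped by step i. The expected envelope on \<open>G i\<close> is a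
  supermartingale up to errors: stopping discards nonnegative mass, each step costs its length times
  \<open>e + C' * m\<close>, and the integrand errors are charged against the deterministic budget
  \<theta>.\<close>

lemma stopped_chain_estimate:
  fixes v :: "real^'n \<Rightarrow> real" and b :: "real^'n \<Rightarrow> real^'n" and \<sigma> :: "real^'n \<Rightarrow> real^'k^'n"
    and s :: "nat \<Rightarrow> real" and Y Z :: "nat \<Rightarrow> 'a \<Rightarrow> real^'n" and D :: "(real^'n) set" and \<delta> \<eta> \<theta> :: real and \<xi> :: "nat \<Rightarrow> 'a \<Rightarrow> real^'k^'n"
  defines "q \<equiv> \<lambda>i w. \<Sum>l<i. (s (Suc l) - s l) * (norm (\<xi> l w - \<sigma> (Y l w)))\<^sup>2"
  defines "G \<equiv> \<lambda>i. {w\<in>space M. \<forall>l\<le>i. Y l w \<in> inner_region (2 * \<delta>) D \<and> dist (Z l w) (Y l w) \<le> \<eta> \<and> q l w \<le> \<theta>}"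
  assumes v: "twice_cont_diff v" and D: "open D" "bounded D"
    and cb: "continuous_on UNIV b" and cs: "continuous_on UNIV \<sigma>"
    and nn: "\<And>r x. 0 \<le> r \<Longrightarrow> x \<in> D \<Longrightarrow> 0 \<le> envelope v \<alpha> \<beta> r x"
    and pos: "\<delta> > 0" "\<eta> \<le> \<delta>" "C \<ge> 0" "C' \<ge> 0" "e \<ge> 0" "\<theta> \<ge> 0"
    and step: "\<And>x y S r t t'. x \<in> inner_region \<delta> D \<Longrightarrow> y \<in> inner_region \<delta> D \<Longrightarrow> dist x y \<le> \<eta> \<Longrightarrow>
       norm S \<le> \<kappa> \<Longrightarrow> 0 \<le> r \<Longrightarrow> 0 \<le> t \<Longrightarrow> t < t' \<Longrightarrow> r + (t' - t) \<le> T \<Longrightarrow>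
       (\<integral>w. indicator D (x + ((t' - t) *\<^sub>R b y + S *v (W t' w - W t w)))
          * envelope v \<alpha> \<beta> r (x + ((t' - t) *\<^sub>R b y + S *v (W t' w - W t w))) \<partial>N)
       \<le> envelope v \<alpha> \<beta> (r + (t' - t)) x + (t' - t) * (e + C * (norm (S - \<sigma> y))\<^sup>2 + C' * (t' - t))"
    and s: "s 0 = 0" "s n = T" "\<And>i. i < n \<Longrightarrow> s i < s (Suc i)" "\<And>i. i < n \<Longrightarrow> s (Suc i) - s i \<le> m"
    and m: "0 \<le> m"
    and Y: "\<And>i. i \<le> n \<Longrightarrow> Y i \<in> borel_measurable (F (s i))"
    and \<xi>: "\<And>i. i < n \<Longrightarrow> \<xi> i \<in> borel_measurable (F (s i))"
      "\<And>i w. i < n \<Longrightarrow> w \<in> space M \<Longrightarrow> norm (\<xi> i w) \<le> \<kappa>"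
    and Z: "\<And>w. Z 0 w = x0"
      "\<And>i w. Z (Suc i) w = Z i w + ((s (Suc i) - s i) *\<^sub>R b (Y i w) + \<xi> i w *v (W (s (Suc i)) w - W (s i) w))"
    and x0: "x0 \<in> D"
  shows "G n \<in> sets (F T)" "Z n \<in> borel_measurable (F T)"
    and "(\<integral>w. indicator (G n) w * (indicator D (Z n w) * v (Z n w)) \<partial>N)
      \<le> envelope v \<alpha> \<beta> T x0 + (e + C' * m) * T + C * \<theta>"
proof -
  have s_mono: "s i \<le> s j" if "i \<le> j" "j \<le> n" for i j
    using that s(3) by (intro increasing_upto_mono[where n = n]) auto
  have s0: "0 \<le> s i" and sT: "s i \<le> T" if "i \<le> n" for i
    using s_mono[of 0 i] s_mono[of i n] that s(1,2) by auto
  have bm: "b \<in> borel_measurable borel" and sm: "\<sigma> \<in> borel_measurable borel"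
    using cb cs by (auto intro: borel_measurable_continuous_onI)
  have Y': "Y i \<in> borel_measurable (F (s j))" if "i \<le> j" "j \<le> n" for i j
    using that by (intro measurable_F_mono[OF Y s_mono]) auto
  have \<xi>': "\<xi> i \<in> borel_measurable (F (s j))" if "i \<le> j" "j \<le> n" "i < n" for i j
    using that by (intro measurable_F_mono[OF \<xi>(1) s_mono]) auto
  have Zm: "Z i \<in> borel_measurable (F (s i))" if "i \<le> n" for i
    using that
  proof (induction i)
    case 0
    have "Z 0 = (\<lambda>_. x0)" using Z(1) by auto
    then show ?case by simp
  next
    case (Suc i)
    have Zi: "Z i \<in> borel_measurable (F (s (Suc i)))"
      using Suc by (intro measurable_F_mono[OF Suc.IH s_mono]) auto
    have "(\<lambda>w. b (Y i w)) \<in> borel_measurable (F (s (Suc i)))"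
      using Suc.prems by (intro measurable_compose[OF Y' bm]) auto
    moreover have "(\<lambda>w. \<xi> i w *v (W (s (Suc i)) w - W (s i) w)) \<in> borel_measurable (F (s (Suc i)))"
      using Suc.prems by (intro borel_measurable_matrix_vector_mult borel_measurable_diff \<xi>' measurable_F_W s0 s_mono) auto
    ultimately have "(\<lambda>w. Z i w + ((s (Suc i) - s i) *\<^sub>R b (Y i w) + \<xi> i w *v (W (s (Suc i)) w - W (s i) w)))
        \<in> borel_measurable (F (s (Suc i)))"
      using Zi by simp
    moreover have "Z (Suc i) = (\<lambda>w. Z i w + ((s (Suc i) - s i) *\<^sub>R b (Y i w) + \<xi> i w *v (W (s (Suc i)) w - W (s i) w)))"
      using Z(2) by auto
    ultimately show ?case by simp
  qed
  \<comment> \<open>The sum q i uses \<xi> and Y only at indices below i, so it is known one grid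
    time early; hence the bound \<open>Suc j\<close>.\<close>
  have qm: "q i \<in> borel_measurable (F (s j))" if "i \<le> Suc j" "i \<le> n" "j \<le> n" for i j
    unfolding q_def
  proof (rule borel_measurable_sum)
    fix l assume "l \<in> {..<i}"
    then have l: "l \<le> j" "l < n" using that by auto
    have [measurable]: "\<xi> l \<in> borel_measurable (F (s j))" using l that by (intro \<xi>') auto
    have [measurable]: "(\<lambda>w. \<sigma> (Y l w)) \<in> borel_measurable (F (s j))"
      using l that by (intro measurable_compose[OF Y' sm]) auto
    show "(\<lambda>w. (s (Suc l) - s l) * (norm (\<xi> l w - \<sigma> (Y l w)))\<^sup>2) \<in> borel_measurable (F (s j))"
      by measurable
  qed
  have Gm: "G i \<in> sets (F (s i))" if i: "i \<le> n" for i
  proof -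
    have *: "{w \<in> space (F (s i)). Y l w \<in> inner_region (2 * \<delta>) D \<and> dist (Z l w) (Y l w) \<le> \<eta> \<and> q l w \<le> \<theta>} \<in> sets (F (s i))"
      if l: "l \<le> i" for l
    proof -
      have [measurable]: "Y l \<in> borel_measurable (F (s i))" using l i by (rule Y')
      have [measurable]: "Z l \<in> borel_measurable (F (s i))" using l i by (intro measurable_F_mono[OF Zm s_mono]) auto
      have [measurable]: "q l \<in> borel_measurable (F (s i))" using l i by (intro qm) auto
      have [measurable]: "inner_region (2 * \<delta>) D \<in> sets borel" by (intro borel_closed closed_inner_region)
      show ?thesis by measurable
    qed
    have "{w \<in> space (F (s i)). \<forall>l\<in>{..i}. Y l w \<in> inner_region (2 * \<delta>) D \<and> dist (Z l w) (Y l w) \<le> \<eta> \<and> q l w \<le> \<theta>} \<in> sets (F (s i))"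
    proof (rule sets.sets_Collect_finite_All)
      fix l assume "l \<in> {..i}"
      then show "{w \<in> space (F (s i)). Y l w \<in> inner_region (2 * \<delta>) D \<and> dist (Z l w) (Y l w) \<le> \<eta> \<and> q l w \<le> \<theta>} \<in> sets (F (s i))"
        by (intro *) simp
    qed simp
    then show ?thesis by (simp only: G_def space_F Ball_def atMost_iff)
  qed
  \<comment> \<open>The decision to take step i, made at time s i: the coming integrand error is
    checked before it is incurred. This event lies between \<open>G (Suc i)\<close> and
    \<open>G i\<close> and belongs to the past of the increment.\<close>
  define H where "H = (\<lambda>i. {w\<in>G i. q (Suc i) w \<le> \<theta>})"
  have Hm: "H i \<in> sets (F (s i))" if "i < n" for i
  proof -
    have "q (Suc i) \<in> borel_measurable (F (s i))" using that by (intro qm) auto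
    then have "{w \<in> space (F (s i)). q (Suc i) w \<le> \<theta>} \<in> sets (F (s i))" by measurable
    moreover have "H i = G i \<inter> {w \<in> space (F (s i)). q (Suc i) w \<le> \<theta>}"
      by (auto simp: H_def G_def)
    ultimately show ?thesis using Gm[of i] that by simp
  qed
  have GH: "G (Suc i) \<subseteq> H i" "H i \<subseteq> G i" "H i \<subseteq> space M" for i
    by (auto simp: G_def H_def)
  have HH: "w \<in> H l" if "w \<in> H i" "l \<le> i" for w i l
    using that GH(1)[of l] by (cases "l = i") (auto simp: H_def G_def)
  have GN: "G i \<in> sets N" if "i \<le> n" for i using Gm[OF that] sets_F_subset by blast
  have HN: "H i \<in> sets N" if "i < n" for i using Hm[OF that] sets_F_subset by blast
  define \<psi> where "\<psi> = (\<lambda>r z. indicator D z * envelope v \<alpha> \<beta> r z)"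
  have \<psi>m: "\<psi> r \<in> borel_measurable borel" for r
    unfolding \<psi>_def using v D(1) by (rule cutoff_envelope_measurable)
  have \<psi>b: "\<exists>B\<ge>0. \<forall>z. \<bar>\<psi> r z\<bar> \<le> B" for r
    unfolding \<psi>_def using cutoff_envelope_bounded[OF v D(2)] by metis
  have \<psi>0: "0 \<le> \<psi> r z" if "0 \<le> r" for r z
    using nn[OF that, of z] by (simp add: \<psi>_def indicator_def)
  have int: "integrable N (\<lambda>w. indicator A w * \<psi> r (Z i w))" if "A \<in> sets N" "i \<le> n" for A r i
  proof -
    obtain B where "B \<ge> 0" "\<And>z. \<bar>\<psi> r z\<bar> \<le> B" using \<psi>b by blast
    moreover have "(\<lambda>w. \<psi> r (Z i w)) \<in> borel_measurable N"
      by (rule measurable_compose[OF measurable_F_N[OF Zm[OF that(2)]] \<psi>m])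
    ultimately show ?thesis using that
      by (intro N.integrable_const_bound[of _ B] AE_I2) (auto simp: indicator_def)
  qed
  \<comment> \<open>The integrand error is charged only for steps actually taken. As each is checked
    in advance, the total stays below \<theta> for every outcome, also for those that stop
    early.\<close>
  define \<rho> where "\<rho> = (\<lambda>i w. indicator (H i) w * ((s (Suc i) - s i) * (norm (\<xi> i w - \<sigma> (Y i w)))\<^sup>2))"
  define h where "h = (\<lambda>i. s (Suc i) - s i)"
  have h: "0 < h i" "h i \<le> m" if "i < n" for i using s(3,4)[OF that] by (auto simp: h_def)
  have \<rho>sum: "(\<Sum>l<i. \<rho> l w) \<le> \<theta>" if "i \<le> n" for i w
    using that
  proof (induction i)
    case (Suc i)
    show ?case
    proof (cases "w \<in> H i")
      case True
      then have "(\<Sum>l<Suc i. \<rho> l w) = q (Suc i) w"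
        unfolding q_def \<rho>_def by (intro sum.cong) (auto simp: indicator_def HH[OF True])
      then show ?thesis using True by (simp add: H_def)
    next
      case False
      then show ?thesis using Suc by (simp add: \<rho>_def)
    qed
  qed (use pos in simp)
  have \<rho>0: "0 \<le> \<rho> i w" if "i < n" for i w
    using h(1)[OF that] by (auto simp: \<rho>_def h_def intro!: mult_nonneg_nonneg)
  have \<rho>int: "integrable N (\<rho> i)" if "i < n" for i
  proof (intro N.integrable_const_bound[of _ \<theta>] AE_I2)
    fix w
    have "\<rho> i w \<le> (\<Sum>l<Suc i. \<rho> l w)"
      using \<rho>0 that by (intro member_le_sum) auto
    also have "\<dots> \<le> \<theta>" using that by (intro \<rho>sum) auto
    finally show "norm (\<rho> i w) \<le> \<theta>" using \<rho>0[OF that, of w] by simp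
  next
    have [measurable]: "H i \<in> sets N" "\<xi> i \<in> borel_measurable N" "(\<lambda>w. \<sigma> (Y i w)) \<in> borel_measurable N"
      using that HN measurable_F_N[OF \<xi>(1)] measurable_compose[OF measurable_F_N[OF Y] sm] by auto
    show "\<rho> i \<in> borel_measurable N" unfolding \<rho>_def by measurable
  qed
  have one: "(\<integral>w. indicator (G (Suc i)) w * \<psi> (T - s (Suc i)) (Z (Suc i) w) \<partial>N)
    \<le> (\<integral>w. indicator (G i) w * \<psi> (T - s i) (Z i w) \<partial>N) + (h i * (e + C' * m) + C * (\<integral>w. \<rho> i w \<partial>N))"
    if i: "i < n" for i
  proof -
    let ?r = "T - s (Suc i)"
    have r: "0 \<le> ?r" using sT[of "Suc i"] i by simp
    obtain B where B: "B \<ge> 0" "\<And>z. \<bar>\<psi> ?r z\<bar> \<le> B" using \<psi>b by blast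
    define f where "f = (\<lambda>(w, u). indicator (H i) w *
      \<psi> ?r (Z i w + (h i *\<^sub>R b (Y i w) + \<xi> i w *v u)))"
    have ss: "0 \<le> s i" "s i < s (Suc i)" using s0[of i] s(3)[OF i] i by auto
    have fst_m: "(\<lambda>p. g (fst p)) \<in> borel_measurable (F (s i) \<Otimes>\<^sub>M (borel :: (real^'k) measure))"
      if "g \<in> borel_measurable (F (s i))" for g :: "'a \<Rightarrow> 'c::topological_space"
      by (rule measurable_compose[OF measurable_fst that])
    have "(\<lambda>p. Z i (fst p) + (h i *\<^sub>R b (Y i (fst p)) + \<xi> i (fst p) *v snd p))
      \<in> borel_measurable (F (s i) \<Otimes>\<^sub>M borel)"
      using i by (intro borel_measurable_add borel_measurable_scaleR borel_measurable_const
          borel_measurable_matrix_vector_mult measurable_snd fst_m Zm \<xi>(1) measurable_compose[OF Y bm]) auto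
    from measurable_compose[OF this \<psi>m[of ?r]]
    have fm: "f \<in> borel_measurable (F (s i) \<Otimes>\<^sub>M borel)"
      unfolding f_def split_beta using fst_m[of "indicator (H i)"] Hm[OF i]
      by (intro borel_measurable_times) auto
    have fb: "\<bar>f (w, u)\<bar> \<le> B" for w u using B by (auto simp: f_def indicator_def)
    \<comment> \<open>\<open>G (Suc i)\<close> depends on the new increment, so freezing does not
      apply to it; enlarging it to \<open>H i\<close> only increases the integral of a nonnegative
      function.\<close>
    have "(\<integral>w. indicator (G (Suc i)) w * \<psi> ?r (Z (Suc i) w) \<partial>N)
      \<le> (\<integral>w. indicator (H i) w * \<psi> ?r (Z (Suc i) w) \<partial>N)"
      using i GH(1)[of i] \<psi>0[OF r] by (intro integral_mono int GN HN) (auto simp: indicator_def)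
    also have "\<dots> = (\<integral>w. f (w, W (s (Suc i)) w - W (s i) w) \<partial>N)"
      by (intro Bochner_Integration.integral_cong) (auto simp: f_def Z(2) h_def)
    also have "\<dots> = (\<integral>w. (\<integral>w'. f (w, W (s (Suc i)) w' - W (s i) w') \<partial>N) \<partial>N)"
      by (rule freezing(1)[OF ss fm fb])
    also have "\<dots> \<le> (\<integral>w. indicator (G i) w * \<psi> (T - s i) (Z i w) + (h i * (e + C' * m) + C * \<rho> i w) \<partial>N)"
    proof (rule integral_mono)
      have "(\<lambda>w. \<integral>w'. f (w, W (s (Suc i)) w' - W (s i) w') \<partial>N) \<in> borel_measurable N"
        by (rule measurable_F_N[OF freezing(2)[OF ss fm fb]])
      moreover have "\<bar>\<integral>w'. f (w, W (s (Suc i)) w' - W (s i) w') \<partial>N\<bar> \<le> B" for w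
      proof -
        have "\<bar>\<integral>w'. f (w, W (s (Suc i)) w' - W (s i) w') \<partial>N\<bar> \<le> (\<integral>w'. \<bar>f (w, W (s (Suc i)) w' - W (s i) w')\<bar> \<partial>N)"
          by (rule integral_abs_bound)
        also have "\<dots> \<le> (\<integral>w'. B \<partial>N)" using B(1) fb by (intro integral_mono') auto
        finally show ?thesis by (simp add: prob_space)
      qed
      ultimately show "integrable N (\<lambda>w. \<integral>w'. f (w, W (s (Suc i)) w' - W (s i) w') \<partial>N)"
        by (intro N.integrable_const_bound[of _ B] AE_I2) auto
      show "integrable N (\<lambda>w. indicator (G i) w * \<psi> (T - s i) (Z i w) + (h i * (e + C' * m) + C * \<rho> i w))"
        using i by (intro Bochner_Integration.integrable_add int GN integrable_mult_right \<rho>int) auto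
      fix w
      show "(\<integral>w'. f (w, W (s (Suc i)) w' - W (s i) w') \<partial>N)
        \<le> indicator (G i) w * \<psi> (T - s i) (Z i w) + (h i * (e + C' * m) + C * \<rho> i w)"
      proof (cases "w \<in> H i")
        case True
        then have "w \<in> G i" "w \<in> space M" using GH(2,3)[of i] by auto
        then have y: "Y i w \<in> inner_region (2 * \<delta>) D" and zy: "dist (Z i w) (Y i w) \<le> \<eta>"
          by (auto simp: G_def)
        have zK: "Z i w \<in> inner_region \<delta> D" using zy pos by (intro inner_region_near[OF y]) auto
        have yK: "Y i w \<in> inner_region \<delta> D" using y pos inner_region_antimono[of \<delta> "2 * \<delta>"] by auto
        have zD: "Z i w \<in> D" using zK inner_region_subset[OF pos(1)] by blast
        have "(\<integral>w'. f (w, W (s (Suc i)) w' - W (s i) w') \<partial>N)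
          \<le> envelope v \<alpha> \<beta> (?r + h i) (Z i w)
            + h i * (e + C * (norm (\<xi> i w - \<sigma> (Y i w)))\<^sup>2 + C' * h i)"
          using step[OF zK yK zy \<xi>(2)[OF i \<open>w \<in> space M\<close>] r ss] sT[of i] s0[of i] i True
          by (simp add: f_def \<psi>_def h_def)
        also have "\<dots> \<le> envelope v \<alpha> \<beta> (?r + h i) (Z i w)
            + h i * (e + C * (norm (\<xi> i w - \<sigma> (Y i w)))\<^sup>2 + C' * m)"
          using h[OF i] pos by (intro add_left_mono mult_left_mono) auto
        also have "\<dots> = \<psi> (T - s i) (Z i w) + (h i * (e + C' * m) + C * \<rho> i w)"
          using zD True by (simp add: \<psi>_def \<rho>_def h_def algebra_simps)
        finally show ?thesis using \<open>w \<in> G i\<close> by simp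
      next
        case False
        then have "f (w, u) = 0" for u by (simp add: f_def)
        moreover have "0 \<le> \<psi> (T - s i) (Z i w)" using sT[of i] i by (intro \<psi>0) auto
        moreover have "0 \<le> h i * (e + C' * m) + C * \<rho> i w"
          using h(1)[OF i] pos m \<rho>0[OF i, of w] by simp
        ultimately show ?thesis by simp
      qed
    qed
    also have "\<dots> = (\<integral>w. indicator (G i) w * \<psi> (T - s i) (Z i w) \<partial>N) + (h i * (e + C' * m) + C * (\<integral>w. \<rho> i w \<partial>N))"
      using i int[OF GN] \<rho>int[OF i] by (simp add: prob_space)
    finally show ?thesis .
  qed
  have tot: "(\<integral>w. indicator (G i) w * \<psi> (T - s i) (Z i w) \<partial>N)
    \<le> envelope v \<alpha> \<beta> T x0 + (s i * (e + C' * m) + C * (\<Sum>l<i. \<integral>w. \<rho> l w \<partial>N))" if "i \<le> n" for i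
    using that
  proof (induction i)
    case 0
    have T0: "0 \<le> T" using sT[of 0] s(1) by simp
    have "(\<integral>w. indicator (G 0) w * \<psi> (T - s 0) (Z 0 w) \<partial>N) \<le> (\<integral>w. \<psi> T x0 \<partial>N)"
      using int[OF GN, of 0 0 T] \<psi>0[OF T0] s(1) Z(1)
      by (intro integral_mono) (auto simp: indicator_def)
    then show ?case using x0 s(1) by (simp add: \<psi>_def prob_space)
  next
    case (Suc i)
    have "s i * (e + C' * m) + h i * (e + C' * m) = s (Suc i) * (e + C' * m)"
      by (simp add: h_def algebra_simps)
    then show ?case using Suc.IH one[of i] Suc.prems by (simp add: algebra_simps)
  qed
  have "(\<Sum>l<n. \<integral>w. \<rho> l w \<partial>N) = (\<integral>w. (\<Sum>l<n. \<rho> l w) \<partial>N)"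
    using \<rho>int by (intro Bochner_Integration.integral_sum[symmetric]) auto
  also have "\<dots> \<le> (\<integral>w. \<theta> \<partial>N)"
    using \<rho>sum[of n] \<rho>int by (intro integral_mono) auto
  finally have "(\<Sum>l<n. \<integral>w. \<rho> l w \<partial>N) \<le> \<theta>" by (simp add: prob_space)
  then have "C * (\<Sum>l<n. \<integral>w. \<rho> l w \<partial>N) \<le> C * \<theta>" using pos by (intro mult_left_mono) auto
  then show "(\<integral>w. indicator (G n) w * (indicator D (Z n w) * v (Z n w)) \<partial>N)
      \<le> envelope v \<alpha> \<beta> T x0 + (e + C' * m) * T + C * \<theta>"
    using tot[of n] s(2) by (simp add: \<psi>_def mult.commute)
  show "G n \<in> sets (F T)" "Z n \<in> borel_measurable (F T)"
    using Gm[of n] Zm[of n] s(2) by auto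
qed

end

section \<open>Pathwise approximation\<close>

text \<open>A uniform grid controls the mesh; inserting the points of P, later the jump times of the
  simple integrand, makes the integrand constant on each cell.\<close>

lemma grid_exists:
  fixes P :: "real set"
  assumes P: "finite P" and T: "0 < T" and m: "0 < m"
  obtains n :: nat and s :: "nat \<Rightarrow> real" where "s 0 = 0" "s n = T"
    "\<And>i. i < n \<Longrightarrow> s i < s (Suc i)" "\<And>i. i < n \<Longrightarrow> s (Suc i) - s i \<le> m"
    "\<And>i. i < n \<Longrightarrow> P \<inter> {s i <..< s (Suc i)} = {}"
proof -
  obtain K :: nat where K: "T / m < real K" using reals_Archimedean2 by blast
  then have K0: "0 < real K" using T m by (meson divide_pos_pos less_trans)
  define d where "d = T / real K"
  have d: "0 < d" "d \<le> m" using T K K0 m by (auto simp: d_def field_simps)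
  define S where "S = ((\<lambda>k. real k * d) ` {..K} \<union> P) \<inter> {0..T}"
  have S: "finite S" "S \<subseteq> {0..T}" using P by (auto simp: S_def)
  have S0: "0 \<in> S" using T by (auto simp: S_def intro!: image_eqI[of _ _ 0])
  have ST: "T \<in> S" using T K0 by (auto simp: S_def d_def intro!: image_eqI[of _ _ K])
  define l where "l = sorted_list_of_set S"
  have l: "set l = S" "sorted_wrt (<) l" using S by (auto simp: l_def)
  have ne: "l \<noteq> []" using S0 l by auto
  have lt: "l ! i < l ! j" if "i < j" "j < length l" for i j
    using sorted_wrt_nth_less[OF l(2) that] .
  have between: "x \<notin> {l ! i <..< l ! Suc i}" if x: "x \<in> S" and i: "Suc i < length l" for x i
  proof
    assume a: "x \<in> {l ! i <..< l ! Suc i}"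
    obtain k where k: "k < length l" "x = l ! k" using x l(1) by (metis in_set_conv_nth)
    have "k \<noteq> i" "k \<noteq> Suc i" using a k by auto
    then consider "k < i" | "Suc i < k" by linarith
    then show False using lt[of k i] lt[of "Suc i" k] a k i by cases auto
  qed
  show ?thesis
  proof (rule that[of "\<lambda>i. l ! i" "length l - 1"])
    obtain k where k: "k < length l" "0 = l ! k" using S0 l(1) by (metis in_set_conv_nth)
    have "l ! 0 \<in> S" using ne l(1) by (metis length_greater_0_conv nth_mem)
    then show "l ! 0 = 0" using S(2) k lt[of 0 k] by (cases "k = 0") (auto simp: subset_iff)
    obtain k where k: "k < length l" "T = l ! k" using ST l(1) by (metis in_set_conv_nth)
    have "l ! (length l - 1) \<in> S" using ne l(1) by (metis diff_less length_greater_0_conv nth_mem zero_less_one)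
    then show "l ! (length l - 1) = T"
      using S(2) k lt[of k "length l - 1"] less_linear[of k "length l - 1"] by (fastforce simp: subset_iff)
    fix i assume "i < length l - 1"
    then have i: "Suc i < length l" by simp
    show "l ! i < l ! Suc i" using i by (intro lt) auto
    have mem: "l ! i \<in> {0..T}" "l ! Suc i \<in> {0..T}" using i l(1) S(2) nth_mem by (metis Suc_lessD subsetD)+
    show "P \<inter> {l ! i <..< l ! Suc i} = {}"
    proof (rule ccontr)
      assume "P \<inter> {l ! i <..< l ! Suc i} \<noteq> {}"
      then obtain x where x: "x \<in> P" "x \<in> {l ! i <..< l ! Suc i}" by blast
      then have "x \<in> S" using mem by (auto simp: S_def)
      then show False using between[OF _ i] x(2) by blast
    qed
    show "l ! Suc i - l ! i \<le> m"
    proof (rule ccontr)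
      assume "\<not> l ! Suc i - l ! i \<le> m"
      then have gap: "l ! i + d < l ! Suc i" using d by simp
      \<comment> \<open>The first multiple of d strictly beyond \<open>l ! i\<close>; it is at most
        d away and would fall strictly between two neighbours of the sorted list.\<close>
      define k where "k = Suc (nat \<lfloor>l ! i / d\<rfloor>)"
      have q0: "0 \<le> l ! i / d" using mem(1) d(1) by simp
      have kk: "real k = of_int \<lfloor>l ! i / d\<rfloor> + 1" using q0 by (simp add: k_def)
      have "l ! i / d < real k" "real k \<le> l ! i / d + 1" unfolding kk by linarith+
      then have x: "l ! i < real k * d" "real k * d \<le> l ! i + d" using d(1) by (auto simp: field_simps)
      then have "real k * d \<le> T" using gap mem by auto
      then have "real k * d \<le> real K * d" using K0 by (simp add: d_def)
      then have "k \<le> K" using d(1) by simp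
      then have "real k * d \<in> S" using x mem \<open>real k * d \<le> T\<close> by (auto simp: S_def)
      then show False using between[OF _ i, of "real k * d"] x gap by auto
    qed
  qed
qed

text \<open>A Fatou argument for events, by continuity from below along the tail intersections. The
  index from which w lies in C k may depend on w, so pathwise convergence without a uniform rate
  suffices.\<close>

lemma (in prob_space) prob_le_of_AE_eventually:
  assumes A: "A \<in> events" and C: "\<And>k::nat. C k \<in> events"
    and ev: "AE w in M. w \<in> A \<longrightarrow> (\<forall>\<^sub>F k in sequentially. w \<in> C k)"
    and le: "\<And>k. prob (C k) \<le> c k" and lim: "c \<longlonglongrightarrow> L"
  shows "prob A \<le> L"
proof -
  define B where "B = (\<lambda>k. \<Inter>l\<in>{k..}. C l)"
  have B: "B k \<in> events" for k unfolding B_def using C by auto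
  have inc: "incseq B" by (auto simp: B_def incseq_def)
  have "prob A \<le> prob (\<Union>k. B k)"
    using ev B by (intro finite_measure_mono_AE) (auto simp: B_def eventually_sequentially elim!: eventually_mono)
  moreover have "prob (\<Union>k. B k) \<le> L"
  proof (rule LIMSEQ_le_const2)
    show "(\<lambda>k. prob (B k)) \<longlonglongrightarrow> prob (\<Union>k. B k)"
      using B inc by (intro finite_Lim_measure_incseq) auto
    have "prob (B k) \<le> L" for k
    proof (rule LIMSEQ_le_const[OF lim])
      have "prob (B k) \<le> c l" if "k \<le> l" for l
        using that C by (intro order_trans[OF finite_measure_mono le]) (auto simp: B_def)
      then show "\<exists>N. \<forall>n\<ge>N. prob (B k) \<le> c n" by blast
    qed
    then show "\<exists>N. \<forall>n\<ge>N. prob (B n) \<le> L" by blast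
  qed
  ultimately show ?thesis by linarith
qed

text \<open>The chain uses the drift along the path itself, so the separation is the Riemann sum
  error of the drift plus the noise error, each allowed half of \<eta>.\<close>

lemma euler_path_close:
  fixes x I J :: "real \<Rightarrow> real^'n" and b :: "real^'n \<Rightarrow> real^'n" and s :: "nat \<Rightarrow> real"
  assumes x: "continuous_on {0..T} x" and b: "continuous_on UNIV b"
    and eq: "\<And>t. 0 \<le> t \<Longrightarrow> t \<le> T \<Longrightarrow> x t = x0 + integral {0..t} (\<lambda>r. b (x r)) + I t"
    and J0: "J 0 = 0" and JI: "\<And>t. 0 \<le> t \<Longrightarrow> t \<le> T \<Longrightarrow> norm (J t - I t) \<le> \<eta> / 2"
    and s: "s 0 = 0" "s n = T" "\<And>i. i < n \<Longrightarrow> s i < s (Suc i)"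
    and u: "0 \<le> u" "T * u \<le> \<eta> / 2"
    and osc: "\<And>i r. i < n \<Longrightarrow> s i \<le> r \<Longrightarrow> r \<le> s (Suc i) \<Longrightarrow> norm (b (x r) - b (x (s i))) \<le> u"
    and Z: "Z 0 = x0" "\<And>i. i < n \<Longrightarrow> Z (Suc i) = Z i + ((s (Suc i) - s i) *\<^sub>R b (x (s i)) + (J (s (Suc i)) - J (s i)))"
    and l: "l \<le> n"
  shows "dist (Z l) (x (s l)) \<le> \<eta>"
proof -
  have s_mono: "s i \<le> s j" if "i \<le> j" "j \<le> n" for i j
    using that s(3) by (intro increasing_upto_mono[where n = n]) auto
  have bx: "continuous_on {0..T} (\<lambda>r. b (x r))"
    by (rule continuous_on_compose2[OF b x]) auto
  have int: "(\<lambda>r. b (x r)) integrable_on {p..q}" if "0 \<le> p" "q \<le> T" for p q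
    by (intro integrable_continuous_real continuous_on_subset[OF bx]) (use that in auto)
  \<comment> \<open>With the noise removed only the drift error remains; it grows at rate at most
    u.\<close>
  have "norm (Z l - J (s l) - x0 - integral {0..s l} (\<lambda>r. b (x r))) \<le> s l * u"
    using l
  proof (induction l)
    case (Suc i)
    have st: "0 \<le> s i" "s i < s (Suc i)" "s (Suc i) \<le> T"
      using s_mono[of 0 i] s_mono[of "Suc i" n] s Suc.prems by auto
    have comb: "integral {0..s (Suc i)} (\<lambda>r. b (x r)) = integral {0..s i} (\<lambda>r. b (x r)) + integral {s i..s (Suc i)} (\<lambda>r. b (x r))"
      using st int[of 0 "s (Suc i)"] by (intro Henstock_Kurzweil_Integration.integral_combine[symmetric]) auto
    have c: "integral {s i..s (Suc i)} (\<lambda>r. b (x (s i))) = (s (Suc i) - s i) *\<^sub>R b (x (s i))"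
      using st by simp
    have "norm (integral {s i..s (Suc i)} (\<lambda>r. b (x (s i)) - b (x r))) \<le> u * (s (Suc i) - s i)"
      using st Suc.prems osc[of i] u(1)
      by (intro integral_bound continuous_intros continuous_on_subset[OF bx])
         (auto simp: norm_minus_commute)
    moreover have "integral {s i..s (Suc i)} (\<lambda>r. b (x (s i)) - b (x r))
        = (s (Suc i) - s i) *\<^sub>R b (x (s i)) - integral {s i..s (Suc i)} (\<lambda>r. b (x r))"
      using st int[of "s i" "s (Suc i)"] c by (subst integral_diff) auto
    ultimately have "norm ((Z i - J (s i) - x0 - integral {0..s i} (\<lambda>r. b (x r)))
        + ((s (Suc i) - s i) *\<^sub>R b (x (s i)) - integral {s i..s (Suc i)} (\<lambda>r. b (x r)))) \<le> s i * u + u * (s (Suc i) - s i)"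
      using Suc by (intro order_trans[OF norm_triangle_ineq] add_mono) auto
    then show ?case using Suc.prems by (simp add: Z(2) comb algebra_simps)
  qed (simp add: Z(1) J0 s(1))
  also have "\<dots> \<le> T * u" using s_mono[of l n] l s(2) u(1) by (intro mult_right_mono) auto
  also have "\<dots> \<le> \<eta> / 2" by (rule u(2))
  finally have 1: "norm (Z l - J (s l) - x0 - integral {0..s l} (\<lambda>r. b (x r))) \<le> \<eta> / 2" .
  have sl: "0 \<le> s l" "s l \<le> T" using s_mono[of 0 l] s_mono[of l n] s l by auto
  have "Z l - x (s l) = (Z l - J (s l) - x0 - integral {0..s l} (\<lambda>r. b (x r))) + (J (s l) - I (s l))"
    using eq[OF sl] by simp
  also have "norm \<dots> \<le> \<eta> / 2 + \<eta> / 2"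
    by (intro order_trans[OF norm_triangle_ineq] add_mono 1 JI[OF sl])
  finally show ?thesis by (simp add: dist_norm)
qed

text \<open>V is close to f only on average in time, but it is constant on each left-open cell, so
  its value at the right end can be averaged over the cell. The splitting into
  \<open>V r - f r\<close> and \<open>f r - f (s i)\<close> doubles both squared errors, hence the
  budgets \<theta> / 4.\<close>

lemma riemann_quadratic_error:
  fixes V :: "real \<Rightarrow> 'v::euclidean_space" and f :: "real \<Rightarrow> 'v" and s :: "nat \<Rightarrow> real"
  assumes f: "continuous_on {0..T} f" and V: "V \<in> borel_measurable borel"
    and Vf: "(\<integral>\<^sup>+r\<in>{0..T}. ennreal ((norm (V r - f r))\<^sup>2) \<partial>lborel) \<le> ennreal (\<theta> / 4)"
    and s: "s 0 = 0" "s n = T" "\<And>i. i < n \<Longrightarrow> s i < s (Suc i)"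
    and u: "T * u\<^sup>2 \<le> \<theta> / 4" and \<theta>: "0 \<le> \<theta>"
    and osc: "\<And>i r. i < n \<Longrightarrow> s i \<le> r \<Longrightarrow> r \<le> s (Suc i) \<Longrightarrow> norm (f r - f (s i)) \<le> u"
    and Vc: "\<And>i r. i < n \<Longrightarrow> s i < r \<Longrightarrow> r \<le> s (Suc i) \<Longrightarrow> V r = V (s (Suc i))"
    and l: "l \<le> n"
  shows "(\<Sum>i<l. (s (Suc i) - s i) * (norm (V (s (Suc i)) - f (s i)))\<^sup>2) \<le> \<theta>"
proof -
  have s_mono: "s i \<le> s j" if "i \<le> j" "j \<le> n" for i j
    using that s(3) by (intro increasing_upto_mono[where n = n]) auto
  define g where "g = (\<lambda>r. ennreal (2 * (norm (V r - f r))\<^sup>2 + 2 * u\<^sup>2))"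
  have gm: "(\<lambda>r. g r * indicator A r) \<in> borel_measurable lborel" if "A \<subseteq> {0..T}" "A \<in> sets borel" for A
  proof -
    \<comment> \<open>Only the restriction of f to {0..T} is known to be continuous, hence the
      cut-off.\<close>
    have [measurable]: "(\<lambda>r. indicator {0..T} r *\<^sub>R f r) \<in> borel_measurable borel"
      by (rule borel_measurable_continuous_on_indicator[OF _ f]) simp
    note V[measurable] that(2)[measurable]
    have "(\<lambda>r. ennreal (2 * (norm (V r - indicator {0..T} r *\<^sub>R f r))\<^sup>2 + 2 * u\<^sup>2) * indicator A r) \<in> borel_measurable lborel"
      by measurable
    then show ?thesis
      by (rule measurable_cong[THEN iffD1, rotated]) (use that(1) in \<open>auto simp: g_def indicator_def\<close>)
  qed
  have "ennreal (\<Sum>i<l. (s (Suc i) - s i) * (norm (V (s (Suc i)) - f (s i)))\<^sup>2)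
    \<le> (\<integral>\<^sup>+r. g r * indicator {0<..s l} r \<partial>lborel)"
    using l
  proof (induction l)
    case (Suc i)
    have st: "0 \<le> s i" "s i < s (Suc i)" "s (Suc i) \<le> T"
      using s_mono[of 0 i] s_mono[of "Suc i" n] s Suc.prems by auto
    let ?c = "(norm (V (s (Suc i)) - f (s i)))\<^sup>2"
    have "ennreal ((s (Suc i) - s i) * ?c) = (\<integral>\<^sup>+r. ennreal ?c * indicator {s i<..s (Suc i)} r \<partial>lborel)"
      using st by (subst nn_integral_cmult_indicator) (auto simp: ennreal_mult'[symmetric] mult.commute)
    also have "\<dots> \<le> (\<integral>\<^sup>+r. g r * indicator {s i<..s (Suc i)} r \<partial>lborel)"
    proof (rule nn_integral_mono)
      fix r
      show "ennreal ?c * indicator {s i<..s (Suc i)} r \<le> g r * indicator {s i<..s (Suc i)} r"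
      proof (cases "r \<in> {s i<..s (Suc i)}")
        case True
        then have "V (s (Suc i)) - f (s i) = (V r - f r) + (f r - f (s i))"
          using Vc[of i r] Suc.prems by simp
        then have "?c \<le> 2 * (norm (V r - f r))\<^sup>2 + 2 * (norm (f r - f (s i)))\<^sup>2"
          by (metis norm_add_power2_le)
        also have "(norm (f r - f (s i)))\<^sup>2 \<le> u\<^sup>2"
          using osc[of i r] True Suc.prems by (intro power_mono) auto
        finally show ?thesis using True by (simp add: g_def ennreal_leI del: ennreal_plus)
      qed simp
    qed
    finally have "ennreal (\<Sum>i<Suc i. (s (Suc i) - s i) * (norm (V (s (Suc i)) - f (s i)))\<^sup>2)
      \<le> (\<integral>\<^sup>+r. g r * indicator {0<..s i} r \<partial>lborel) + (\<integral>\<^sup>+r. g r * indicator {s i<..s (Suc i)} r \<partial>lborel)"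
      using Suc st s_mono s by (subst sum.lessThan_Suc, subst ennreal_plus) (auto intro!: sum_nonneg add_mono mult_nonneg_nonneg)
    also have "\<dots> = (\<integral>\<^sup>+r. g r * indicator {0<..s i} r + g r * indicator {s i<..s (Suc i)} r \<partial>lborel)"
      using st by (intro nn_integral_add[symmetric] gm) auto
    also have "\<dots> = (\<integral>\<^sup>+r. g r * indicator {0<..s (Suc i)} r \<partial>lborel)"
      using st by (intro nn_integral_cong) (auto simp: indicator_def)
    finally show ?case .
  qed simp
  also have "\<dots> \<le> (\<integral>\<^sup>+r. 2 * (ennreal ((norm (V r - f r))\<^sup>2) * indicator {0..T} r) + ennreal (2 * u\<^sup>2) * indicator {0..T} r \<partial>lborel)"
    using s_mono[of l n] s(2) l
    by (intro nn_integral_mono) (auto simp: g_def indicator_def ennreal_plus ennreal_mult')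
  also have "\<dots> = 2 * (\<integral>\<^sup>+r\<in>{0..T}. ennreal ((norm (V r - f r))\<^sup>2) \<partial>lborel) + ennreal (2 * u\<^sup>2) * ennreal T"
  proof -
    have [measurable]: "(\<lambda>r. indicator {0..T} r *\<^sub>R f r) \<in> borel_measurable borel"
      by (rule borel_measurable_continuous_on_indicator[OF _ f]) simp
    note V[measurable]
    have "(\<lambda>r. ennreal ((norm (V r - indicator {0..T} r *\<^sub>R f r))\<^sup>2) * indicator {0..T} r) \<in> borel_measurable lborel"
      by measurable
    then have m: "(\<lambda>r. ennreal ((norm (V r - f r))\<^sup>2) * indicator {0..T} r) \<in> borel_measurable lborel"
      by (rule measurable_cong[THEN iffD1, rotated]) (auto simp: indicator_def)
    have T0: "0 \<le> T" using s_mono[of 0 n] s by simp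
    show ?thesis using m T0 by (subst nn_integral_add) (auto simp: nn_integral_cmult nn_integral_cmult_indicator)
  qed
  also have "\<dots> \<le> 2 * ennreal (\<theta> / 4) + ennreal (2 * (\<theta> / 4))"
  proof (intro add_mono mult_left_mono Vf)
    have "ennreal (2 * u\<^sup>2) * ennreal T = ennreal (2 * (T * u\<^sup>2))"
      using s_mono[of 0 n] s by (simp add: ennreal_mult'[symmetric] mult_ac)
    also have "\<dots> \<le> ennreal (2 * (\<theta> / 4))" using u by (intro ennreal_leI) simp
    finally show "ennreal (2 * u\<^sup>2) * ennreal T \<le> ennreal (2 * (\<theta> / 4))" .
  qed simp
  also have "2 * ennreal (\<theta> / 4) = ennreal (2 * (\<theta> / 4))"
    using \<theta> ennreal_mult[of 2 "\<theta> / 4"] by simp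
  also have "ennreal (2 * (\<theta> / 4)) + ennreal (2 * (\<theta> / 4)) = ennreal \<theta>"
    using \<theta> by (simp flip: ennreal_plus)
  finally show ?thesis using \<theta> by simp
qed

section \<open>Simple integrands between their jump times\<close>

lemma matrix_vector_mult_sum_left: "(\<Sum>i\<in>S. A i) *v x = (\<Sum>i\<in>S. A i *v x)"
  for A :: "'i \<Rightarrow> real^'k^'n"
  by (induction S rule: infinite_finite_induct) (simp_all add: matrix_vector_mult_add_rdistrib)

context wiener_space
begin

text \<open>P consists of the jump times. Pieces are left-open, so the value on a cell is read at
  its right end s'; it is nevertheless known at time s, because the piece containing s' has begun by
  then. This makes a cell of the integral a matrix from the past times an independent
  increment.\<close>

lemma simple_ito_piecewise:
  fixes V :: "real \<Rightarrow> 'a \<Rightarrow> real^'k^'n"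
  assumes "simple_ito N F W V J"
  obtains P \<kappa> where "finite P"
    "\<And>s s'. 0 \<le> s \<Longrightarrow> s < s' \<Longrightarrow> P \<inter> {s<..<s'} = {} \<Longrightarrow> V s' \<in> borel_measurable (F s)"
    "\<And>s s' r w. 0 \<le> s \<Longrightarrow> s < r \<Longrightarrow> r \<le> s' \<Longrightarrow> P \<inter> {s<..<s'} = {} \<Longrightarrow> V r w = V s' w"
    "\<And>s s' w. 0 \<le> s \<Longrightarrow> s < s' \<Longrightarrow> P \<inter> {s<..<s'} = {} \<Longrightarrow> J s' w - J s w = V s' w *v (W s' w - W s w)"
    "\<And>s w. w \<in> space M \<Longrightarrow> norm (V s w) \<le> \<kappa>"
    "\<And>w. J 0 w = 0"
proof -
  obtain m :: nat and t :: "nat \<Rightarrow> real" and \<xi> :: "nat \<Rightarrow> 'a \<Rightarrow> real^'k^'n" where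
    t: "0 \<le> t 0" "\<And>i. i < m \<Longrightarrow> t i < t (Suc i)" and
    \<xi>: "\<And>i. i < m \<Longrightarrow> \<xi> i \<in> borel_measurable (F (t i))" "\<And>i. i < m \<Longrightarrow> bounded (\<xi> i ` space M)" and
    V: "V = (\<lambda>s w. \<Sum>i<m. indicator {t i <.. t (Suc i)} s *\<^sub>R \<xi> i w)" and
    J: "J = (\<lambda>s w. \<Sum>i<m. \<xi> i w *v (W (min s (t (Suc i))) w - W (min s (t i)) w))"
    using assms unfolding simple_ito_def space_completion by blast
  have t0: "0 \<le> t i" if "i \<le> m" for i
    using that
  proof (induction i)
    case (Suc i) then show ?case using t(2)[of i] by auto
  qed (use t in simp)
  define P where "P = t ` {..m}"
  have Pi: "t i \<notin> {s<..<s'}" if "P \<inter> {s<..<s'} = {}" "i \<le> m" for s s' i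
    using that by (auto simp: P_def)
  have "\<forall>i. \<exists>B. i < m \<longrightarrow> (\<forall>w\<in>space M. norm (\<xi> i w) \<le> B)"
    using \<xi>(2) by (auto simp: bounded_iff)
  then obtain B where B: "\<And>i w. i < m \<Longrightarrow> w \<in> space M \<Longrightarrow> norm (\<xi> i w) \<le> B i"
    by metis
  show ?thesis
  proof (rule that[of P "\<Sum>i<m. B i"])
    show "finite P" by (simp add: P_def)
  next
    fix s s' :: real assume s: "0 \<le> s" "s < s'" "P \<inter> {s<..<s'} = {}"
    show "V s' \<in> borel_measurable (F s)"
      unfolding V
    proof (rule borel_measurable_sum)
      fix i assume "i \<in> {..<m}"
      then have i: "i < m" by simp
      show "(\<lambda>w. indicator {t i<..t (Suc i)} s' *\<^sub>R \<xi> i w) \<in> borel_measurable (F s)"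
      proof (cases "s' \<in> {t i<..t (Suc i)}")
        case True
        then have "t i \<le> s" using Pi[OF s(3), of i] i by auto
        then show ?thesis using measurable_F_mono[OF \<xi>(1)[OF i]] True by simp
      qed simp
    qed
  next
    fix s s' r w assume s: "0 \<le> s" "s < r" "r \<le> s'" "P \<inter> {s<..<s'} = {}"
    have "(r \<in> {t i<..t (Suc i)}) = (s' \<in> {t i<..t (Suc i)})" if "i < m" for i
      using Pi[OF s(4), of i] Pi[OF s(4), of "Suc i"] that s by auto
    then show "V r w = V s' w"
      unfolding V by (intro sum.cong) (auto simp: indicator_def)
  next
    fix s s' w assume s: "0 \<le> s" "s < s'" "P \<inter> {s<..<s'} = {}"
    have tm: "\<xi> i w *v (W (min s' (t (Suc i))) w - W (min s' (t i)) w) - \<xi> i w *v (W (min s (t (Suc i))) w - W (min s (t i)) w)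
       = (indicator {t i<..t (Suc i)} s' *\<^sub>R \<xi> i w) *v (W s' w - W s w)" if i: "i < m" for i
    proof -
      \<comment> \<open>The piece has not begun, is running throughout the cell, or was over before
        it; no jump lies inside the cell.\<close>
      consider "s' \<le> t i" | "t i < s'" "s' \<le> t (Suc i)" | "t (Suc i) < s'" using t(2)[OF i] by linarith
      then show ?thesis
      proof cases
        case 1
        then have "min s' (t (Suc i)) = s'" "min s' (t i) = s'" "min s (t (Suc i)) = s" "min s (t i) = s"
          using s t(2)[OF i] by auto
        then show ?thesis using 1 by (simp add: matrix_vector_mult_def zero_vec_def)
      next
        case 2
        then have "t i \<le> s" using Pi[OF s(3), of i] i by auto
        then have "min s' (t (Suc i)) = s'" "min s' (t i) = t i" "min s (t (Suc i)) = s" "min s (t i) = t i"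
          using 2 s by auto
        then show ?thesis using 2 by (simp add: matrix_vector_mult_diff_distrib)
      next
        case 3
        then have "t (Suc i) \<le> s" using Pi[OF s(3), of "Suc i"] i by auto
        then have "min s' (t (Suc i)) = t (Suc i)" "min s' (t i) = t i" "min s (t (Suc i)) = t (Suc i)" "min s (t i) = t i"
          using 3 s t(2)[OF i] by auto
        then show ?thesis using 3 by (simp add: matrix_vector_mult_def zero_vec_def)
      qed
    qed
    have lin: "(\<Sum>i<m. indicator {t i<..t (Suc i)} s' *\<^sub>R \<xi> i w) *v u
        = (\<Sum>i<m. (indicator {t i<..t (Suc i)} s' *\<^sub>R \<xi> i w) *v u)" for u
      by (rule matrix_vector_mult_sum_left)
    show "J s' w - J s w = V s' w *v (W s' w - W s w)"
      unfolding J V lin sum_subtractf[symmetric] by (intro sum.cong tm) auto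
  next
    fix s w assume w: "w \<in> space M"
    have "norm (V s w) \<le> (\<Sum>i<m. norm (indicator {t i<..t (Suc i)} s *\<^sub>R \<xi> i w))"
      unfolding V by (rule norm_sum)
    also have "\<dots> \<le> (\<Sum>i<m. B i)"
    proof (rule sum_mono)
      fix i assume "i \<in> {..<m}"
      then show "norm (indicator {t i<..t (Suc i)} s *\<^sub>R \<xi> i w) \<le> B i"
        using B[OF _ w, of i] by (auto simp: indicator_def intro: order_trans[OF norm_ge_zero])
    qed
    finally show "norm (V s w) \<le> (\<Sum>i<m. B i)" .
  next
    fix w
    have "min 0 (t i) = 0" if "i \<le> m" for i using t0[OF that] by simp
    then show "J 0 w = 0" unfolding J by (intro sum.neutral) (auto simp: matrix_vector_mult_def zero_vec_def)
  qed
qed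

lemma simple_ito_measurable:
  fixes V :: "real \<Rightarrow> 'a \<Rightarrow> real^'k^'n"
  assumes "simple_ito N F W V J"
  shows "(\<lambda>s. V s w) \<in> borel_measurable borel"
    and "(\<lambda>(s, w). V s w) \<in> borel_measurable (borel \<Otimes>\<^sub>M N)"
    and "0 \<le> s \<Longrightarrow> J s \<in> borel_measurable N"
    and "AE w in N. continuous_on {0..} (\<lambda>s. J s w)"
proof -
  obtain m :: nat and t :: "nat \<Rightarrow> real" and \<xi> :: "nat \<Rightarrow> 'a \<Rightarrow> real^'k^'n" where
    t: "0 \<le> t 0" "\<And>i. i < m \<Longrightarrow> t i < t (Suc i)" and
    \<xi>: "\<And>i. i < m \<Longrightarrow> \<xi> i \<in> borel_measurable (F (t i))" and
    V: "V = (\<lambda>s w. \<Sum>i<m. indicator {t i <.. t (Suc i)} s *\<^sub>R \<xi> i w)" and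
    J: "J = (\<lambda>s w. \<Sum>i<m. \<xi> i w *v (W (min s (t (Suc i))) w - W (min s (t i)) w))"
    using assms unfolding simple_ito_def space_completion by blast
  have t0: "0 \<le> t i" if "i \<le> m" for i
    using that
  proof (induction i)
    case (Suc i) then show ?case using t(2)[of i] by auto
  qed (use t in simp)
  have \<xi>N: "\<xi> i \<in> borel_measurable N" if "i < m" for i by (rule measurable_F_N[OF \<xi>[OF that]])
  show "(\<lambda>s. V s w) \<in> borel_measurable borel"
    unfolding V by measurable
  show "(\<lambda>(s, w). V s w) \<in> borel_measurable (borel \<Otimes>\<^sub>M N)"
    unfolding V split_beta
  proof (rule borel_measurable_sum)
    fix i assume "i \<in> {..<m}"
    then have [measurable]: "\<xi> i \<in> borel_measurable N" using \<xi>N by simp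
    show "(\<lambda>x. indicator {t i<..t (Suc i)} (fst x) *\<^sub>R \<xi> i (snd x)) \<in> borel_measurable (borel \<Otimes>\<^sub>M N)"
      by measurable
  qed
  show "J s \<in> borel_measurable N" if s: "0 \<le> s"
    unfolding J
  proof (intro borel_measurable_sum borel_measurable_matrix_vector_mult)
    fix i assume i: "i \<in> {..<m}"
    then show "\<xi> i \<in> borel_measurable N" using \<xi>N by simp
    show "(\<lambda>w. W (min s (t (Suc i))) w - W (min s (t i)) w) \<in> borel_measurable N"
      using i s t0[of i] t0[of "Suc i"] by (intro borel_measurable_diff measurable_completion W_measurable) auto
  qed
  have "AE w in N. continuous_on {0..} (\<lambda>t. W t w)"
    using wiener by (intro AE_completion) (simp add: wiener_process_def)
  then show "AE w in N. continuous_on {0..} (\<lambda>s. J s w)"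
  proof eventually_elim
    case (elim w)
    have "continuous_on {0..} (\<lambda>s. W (min s c) w)" if "0 \<le> c" for c
      by (rule continuous_on_compose2[OF elim]) (use that in \<open>auto intro!: continuous_intros\<close>)
    then show ?case
      unfolding J using t0
      by (intro continuous_on_sum bounded_linear.continuous_on[OF matrix_vector_mul_bounded_linear]
          continuous_on_diff) auto
  qed
qed

text \<open>Continuity reduces the supremum to countably many rational times; J is continuous only
  almost surely, so completeness of N is used. Measurability matters because \<open>measure\<close>
  is 0 off the sigma-algebra, where a small value would say nothing.\<close>

lemma sup_deviation_measurable:
  fixes V :: "real \<Rightarrow> 'a \<Rightarrow> real^'k^'n"
  assumes J: "simple_ito N F W V J" and T: "0 < T"
    and Im: "\<And>t. 0 \<le> t \<Longrightarrow> I t \<in> borel_measurable N"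
    and Ic: "\<And>w. w \<in> space M \<Longrightarrow> continuous_on {0..} (\<lambda>t. I t w)"
  shows "{w\<in>space M. (SUP s\<in>{0..T}. ennreal (norm (J s w - I s w))) > ennreal \<epsilon>} \<in> sets N"
proof (rule completion.in_sets_AE)
  define Q where "Q = {0<..<T} \<inter> \<rat>"
  have Q: "countable Q" "Q \<subseteq> {0..}" "Q \<subseteq> {0..T}"
    by (auto simp: Q_def countable_rat)
  have clQ: "closure Q = {0..T}"
    unfolding Q_def using T by (subst closure_open_Int_superset) (auto simp: Rats_closure_real)
  let ?A = "{w\<in>space N. (SUP s\<in>Q. ennreal (norm (J s w - I s w))) > ennreal \<epsilon>}"
  have "(\<lambda>w. SUP s\<in>Q. ennreal (norm (J s w - I s w))) \<in> borel_measurable N"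
  proof (rule borel_measurable_SUP[OF Q(1)])
    fix s assume "s \<in> Q"
    then have [measurable]: "I s \<in> borel_measurable N" "J s \<in> borel_measurable N"
      using Q Im simple_ito_measurable(3)[OF J] by auto
    show "(\<lambda>w. ennreal (norm (J s w - I s w))) \<in> borel_measurable N" by measurable
  qed
  then show "?A \<in> sets N" by measurable
  show "AE w in N. w \<in> ?A \<longleftrightarrow> w \<in> {w\<in>space M. (SUP s\<in>{0..T}. ennreal (norm (J s w - I s w))) > ennreal \<epsilon>}"
    using simple_ito_measurable(4)[OF J] AE_space
  proof eventually_elim
    case (elim w)
    then have w: "w \<in> space M" by simp
    have c: "continuous_on (closure Q) (\<lambda>s. norm (J s w - I s w))"
      unfolding clQ using elim(1) Ic[OF w]
      by (intro continuous_intros) (auto intro: continuous_on_subset)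
    have "(\<exists>s\<in>Q. ennreal \<epsilon> < ennreal (norm (J s w - I s w)))"
      if s: "s \<in> {0..T}" "ennreal \<epsilon> < ennreal (norm (J s w - I s w))" for s
    proof (rule ccontr)
      assume "\<not> (\<exists>s\<in>Q. ennreal \<epsilon> < ennreal (norm (J s w - I s w)))"
      then have "norm (J r w - I r w) \<le> max \<epsilon> 0" if "r \<in> Q" for r
        using that by (auto simp: not_less ennreal_le_iff2 le_max_iff_disj)
      from continuous_le_on_closure[OF c _ this] have "norm (J s w - I s w) \<le> max \<epsilon> 0"
        using s(1) clQ by auto
      then have "ennreal (norm (J s w - I s w)) \<le> ennreal (max \<epsilon> 0)" by (rule ennreal_leI)
      moreover have "ennreal (max \<epsilon> 0) = ennreal \<epsilon>" by (simp add: max_def ennreal_neg)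
      ultimately show False using s(2) by (simp add: leD)
    qed
    then show ?case using w Q(3) by (auto simp: less_SUP_iff)
  qed
qed auto

text \<open>Progressive measurability makes the integrand jointly measurable on {0..T}, so Tonelli
  applies to the time integral.\<close>

lemma quadratic_deviation_measurable:
  fixes V H :: "real \<Rightarrow> 'a \<Rightarrow> real^'k^'n"
  assumes V: "simple_ito N F W V J" and H: "progressive F H" and T: "0 \<le> T"
  shows "{w\<in>space M. (\<integral>\<^sup>+s\<in>{0..T}. ennreal ((norm (V s w - H s w))\<^sup>2) \<partial>lborel) > ennreal \<epsilon>} \<in> sets N"
proof -
  let ?B = "restrict_space borel {0..T} :: real measure"
  have idF: "(\<lambda>w. w) \<in> measurable N (F T)"
    using measurable_F_N[of "\<lambda>w. w" T "F T"] by simp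
  have pF: "(\<lambda>p. (fst p, snd p)) \<in> measurable (?B \<Otimes>\<^sub>M N) (?B \<Otimes>\<^sub>M F T)"
    by (intro measurable_Pair measurable_fst measurable_compose[OF measurable_snd idF])
  have "(\<lambda>(s, w). H s w) \<in> borel_measurable (?B \<Otimes>\<^sub>M F T)"
    using H T by (simp add: progressive_def)
  from measurable_compose[OF pF this]
  have Hm: "(\<lambda>p. H (fst p) (snd p)) \<in> borel_measurable (?B \<Otimes>\<^sub>M N)"
    by simp
  have idB: "(\<lambda>s. s) \<in> measurable ?B borel" by (rule measurable_restrict_space1) simp
  have "(\<lambda>p. (fst p, snd p)) \<in> measurable (?B \<Otimes>\<^sub>M N) (borel \<Otimes>\<^sub>M N)"
    by (intro measurable_Pair measurable_snd measurable_compose[OF measurable_fst idB])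
  from measurable_compose[OF this simple_ito_measurable(2)[OF V]]
  have Vm: "(\<lambda>p. V (fst p) (snd p)) \<in> borel_measurable (?B \<Otimes>\<^sub>M N)"
    by simp
  let ?L = "restrict_space lborel {0..T} :: real measure"
  interpret L: finite_measure ?L
    by (intro finite_measureI) (simp add: emeasure_restrict_space space_restrict_space emeasure_lborel_Icc[OF T])
  have sL: "sets ?L = sets ?B" by (intro sets_restrict_space_cong) simp
  have idL: "(\<lambda>s. s) \<in> measurable ?L ?B"
    using measurable_ident_sets[OF sL] by (simp add: id_def)
  have sw: "(\<lambda>p. (snd p, fst p)) \<in> measurable (N \<Otimes>\<^sub>M ?L) (?B \<Otimes>\<^sub>M N)"
    by (intro measurable_Pair measurable_fst measurable_compose[OF measurable_snd idL])
  have [measurable]: "(\<lambda>p. H (snd p) (fst p)) \<in> borel_measurable (N \<Otimes>\<^sub>M ?L)"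
    using measurable_compose[OF sw Hm] by simp
  have [measurable]: "(\<lambda>p. V (snd p) (fst p)) \<in> borel_measurable (N \<Otimes>\<^sub>M ?L)"
    using measurable_compose[OF sw Vm] by simp
  have "(\<lambda>p. ennreal ((norm (V (snd p) (fst p) - H (snd p) (fst p)))\<^sup>2)) \<in> borel_measurable (N \<Otimes>\<^sub>M ?L)"
    by measurable
  then have "(\<lambda>(w, s). ennreal ((norm (V s w - H s w))\<^sup>2)) \<in> borel_measurable (N \<Otimes>\<^sub>M ?L)"
    by (simp add: split_beta')
  then have "(\<lambda>w. \<integral>\<^sup>+s. ennreal ((norm (V s w - H s w))\<^sup>2) \<partial>?L) \<in> borel_measurable N"
    by (rule L.borel_measurable_nn_integral)
  then have [measurable]: "(\<lambda>w. \<integral>\<^sup>+s\<in>{0..T}. ennreal ((norm (V s w - H s w))\<^sup>2) \<partial>lborel) \<in> borel_measurable N"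
    by (simp add: nn_integral_restrict_space)
  have "{w\<in>space N. (\<integral>\<^sup>+s\<in>{0..T}. ennreal ((norm (V s w - H s w))\<^sup>2) \<partial>lborel) > ennreal \<epsilon>} \<in> sets N"
    by measurable
  then show ?thesis by simp
qed

end

section \<open>The bound for paths kept at a fixed margin\<close>

lemma closure_Rats_Int_greaterThanLessThan:
  fixes T :: real
  assumes "0 < T"
  shows "closure ({0<..<T} \<inter> \<rat>) = {0..T}"
  using assms by (subst closure_open_Int_superset) (auto simp: Rats_closure_real)

context wiener_space
begin

text \<open>On A the stopping time \<tau> exceeds T, so the integral equation and the integrand
  \<sigma>(X) are available on all of {0..T}. Rational times make A measurable.\<close>

lemma stopped_event_bound:
  fixes v :: "real^'n \<Rightarrow> real" and b :: "real^'n \<Rightarrow> real^'n" and \<sigma> :: "real^'n \<Rightarrow> real^'k^'n"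
    and X :: "real \<Rightarrow> 'a \<Rightarrow> real^'n" and \<zeta> :: "'a \<Rightarrow> ereal" and \<tau> :: "'a \<Rightarrow> real" and D D\<^sub>s :: "(real^'n) set"
    and T \<delta> :: real
  defines "A \<equiv> {w\<in>space M. T < \<tau> w \<and> X T w \<in> D\<^sub>s \<and> (\<forall>t\<in>{0..T} \<inter> \<rat>. X t w \<in> inner_region (2 * \<delta>) D)}"
  assumes v: "twice_cont_diff v" and D: "open D" "bounded D" and T: "0 < T"
    and cb: "continuous_on UNIV b" and cs: "continuous_on UNIV \<sigma>"
    and gen: "\<And>x. x \<in> D \<Longrightarrow> generator b \<sigma> v x \<le> \<alpha> * v x + \<beta>"
    and nn: "\<And>r x. 0 \<le> r \<Longrightarrow> x \<in> D \<Longrightarrow> 0 \<le> envelope v \<alpha> \<beta> r x"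
    and Ds: "closed D\<^sub>s" "D\<^sub>s \<subseteq> D" and v1: "\<And>x. x \<in> D\<^sub>s \<Longrightarrow> 1 \<le> v x"
    and \<delta>: "\<delta> > 0" and x0: "x0 \<in> D"
    and Xc: "\<And>w. w \<in> space M \<Longrightarrow> continuous_on {t. 0 \<le> t \<and> ereal t < \<zeta> w} (\<lambda>t. X t w)"
    and Xm: "\<And>t B. 0 \<le> t \<Longrightarrow> B \<in> sets borel \<Longrightarrow> {w\<in>space M. ereal t < \<zeta> w \<and> X t w \<in> B} \<in> sets (F t)"
    and \<tau>: "stopping_time F \<tau>" "\<And>w. w \<in> space M \<Longrightarrow> ereal (\<tau> w) < \<zeta> w"
    and ito: "has_ito_integral N F W (\<lambda>s w. if s \<le> \<tau> w then \<sigma> (X s w) else 0) I"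
    and sde: "AE w in N. \<forall>t\<ge>0. X (min t (\<tau> w)) w = x0 + integral {0..min t (\<tau> w)} (\<lambda>s. b (X s w)) + I t w"
  shows "A \<in> sets N" "measure N A \<le> envelope v \<alpha> \<beta> T x0"
proof -
  let ?H = "\<lambda>s w. if s \<le> \<tau> w then \<sigma> (X s w) else 0"
  have before: "ereal t < \<zeta> w" if "w \<in> space M" "T < \<tau> w" "t \<le> T" for w t
    using \<tau>(2)[OF that(1)] that by (metis ereal_less_eq(3) le_less_trans less_imp_le order.strict_trans1)
  show AN: "A \<in> sets N"
  proof -
    have XN: "{w\<in>space M. ereal t < \<zeta> w \<and> X t w \<in> B} \<in> sets N" if "0 \<le> t" "B \<in> sets borel" for t B
      using Xm[OF that] sets_F_subset by blast
    have 1: "{w\<in>space M. T < \<tau> w} \<in> sets N"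
      using stopping_timeD2[OF \<tau>(1), of T] sets_F_subset[of T] by (auto simp: pred_def)
    have 2: "{w\<in>space M. ereal T < \<zeta> w \<and> X T w \<in> D\<^sub>s} \<in> sets N" using T Ds by (intro XN) auto
    have "{w\<in>space N. \<forall>t\<in>{0..T} \<inter> \<rat>. ereal t < \<zeta> w \<and> X t w \<in> inner_region (2 * \<delta>) D} \<in> sets N"
    proof (rule sets.sets_Collect_countable_All')
      show "countable ({0..T} \<inter> \<rat>)" by (intro countable_Int2 countable_rat)
      fix t assume "t \<in> {0..T} \<inter> \<rat>"
      then show "{w\<in>space N. ereal t < \<zeta> w \<and> X t w \<in> inner_region (2 * \<delta>) D} \<in> sets N"
        using XN[of t "inner_region (2 * \<delta>) D"] closed_inner_region[of "2 * \<delta>" D] by (simp add: borel_closed)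
    qed
    then have "{w\<in>space M. T < \<tau> w} \<inter> {w\<in>space M. ereal T < \<zeta> w \<and> X T w \<in> D\<^sub>s} \<inter>
      {w\<in>space N. \<forall>t\<in>{0..T} \<inter> \<rat>. ereal t < \<zeta> w \<and> X t w \<in> inner_region (2 * \<delta>) D} \<in> sets N"
      using 1 2 by blast
    moreover have "A = {w\<in>space M. T < \<tau> w} \<inter> {w\<in>space M. ereal T < \<zeta> w \<and> X T w \<in> D\<^sub>s} \<inter>
      {w\<in>space N. \<forall>t\<in>{0..T} \<inter> \<rat>. ereal t < \<zeta> w \<and> X t w \<in> inner_region (2 * \<delta>) D}"
      using before by (auto simp: A_def)
    ultimately show ?thesis by simp
  qed
  \<comment> \<open>Dividing by 1 - e accounts for v at the chain's endpoint instead of at the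
    path's; 2 e accounts for the two exceptional events on which the simple approximation
    fails.\<close>
  have approx: "measure N A \<le> (envelope v \<alpha> \<beta> T x0 + e * T + e) / (1 - e) + 2 * e" if e: "0 < e" "e < 1" for e
  proof (rule expected_step[OF v D less_imp_le[OF T] cb cs gen nn \<delta> e(1)])
    fix \<eta>0 C
    assume \<eta>0: "\<eta>0 > 0" and C: "C \<ge> 0"
      and step: "\<And>\<kappa>. \<exists>C'\<ge>0. \<forall>x y S r s s'. x \<in> inner_region \<delta> D \<longrightarrow> y \<in> inner_region \<delta> D \<longrightarrow> dist x y \<le> \<eta>0 \<longrightarrow>
       norm S \<le> \<kappa> \<longrightarrow> 0 \<le> r \<longrightarrow> 0 \<le> s \<longrightarrow> s < s' \<longrightarrow> r + (s' - s) \<le> T \<longrightarrow>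
       (\<integral>w. indicator D (x + ((s' - s) *\<^sub>R b y + S *v (W s' w - W s w)))
          * envelope v \<alpha> \<beta> r (x + ((s' - s) *\<^sub>R b y + S *v (W s' w - W s w))) \<partial>N)
       \<le> envelope v \<alpha> \<beta> (r + (s' - s)) x + (s' - s) * (e + C * (norm (S - \<sigma> y))\<^sup>2 + C' * (s' - s))"
    have "uniformly_continuous_on (closure D) v"
      using D continuous_twice_cont_diff(1)[OF v] by (intro compact_uniformly_continuous) (auto simp: compact_closure)
    then obtain \<eta>1 where \<eta>1: "\<eta>1 > 0"
      "\<And>x y. x \<in> closure D \<Longrightarrow> y \<in> closure D \<Longrightarrow> dist y x < \<eta>1 \<Longrightarrow> dist (v y) (v x) < e"
      using e(1) unfolding uniformly_continuous_on_def by metis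
    \<comment> \<open>Respectively for the one-step estimate, for staying in the inner region, and
      for changing v by less than e between chain and path.\<close>
    define \<eta> where "\<eta> = min (min \<eta>0 \<delta>) (\<eta>1 / 2)"
    have \<eta>: "\<eta> > 0" "\<eta> \<le> \<eta>0" "\<eta> \<le> \<delta>" "\<eta> < \<eta>1" using \<eta>0 \<eta>1(1) \<delta> by (auto simp: \<eta>_def)
    define \<theta> where "\<theta> = e / (C + 1)"
    have \<theta>: "\<theta> > 0" "C * \<theta> \<le> e" using e C by (auto simp: \<theta>_def field_simps)
    obtain V' J' where V': "\<And>j. simple_ito N F W (V' j) (J' j)"
      and van: "\<And>t. 0 \<le> t \<Longrightarrow> vanishes_in_prob N (\<lambda>j w. \<integral>\<^sup>+s\<in>{0..t}. ennreal ((norm (V' j s w - ?H s w))\<^sup>2) \<partial>lborel)"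
        "\<And>t. 0 \<le> t \<Longrightarrow> vanishes_in_prob N (\<lambda>j w. SUP s\<in>{0..t}. ennreal (norm (J' j s w - I s w)))"
      using ito unfolding has_ito_integral_def by blast
    have ev1: "\<forall>\<^sub>F j in sequentially. measure N {w\<in>space N. (\<integral>\<^sup>+s\<in>{0..T}. ennreal ((norm (V' j s w - ?H s w))\<^sup>2) \<partial>lborel) > ennreal (\<theta> / 4)} < e"
      using van(1)[OF less_imp_le[OF T]] \<theta>(1) e(1) unfolding vanishes_in_prob_def by (intro order_tendstoD(2)) auto
    have ev2: "\<forall>\<^sub>F j in sequentially. measure N {w\<in>space N. (SUP s\<in>{0..T}. ennreal (norm (J' j s w - I s w))) > ennreal (\<eta> / 2)} < e"
      using van(2)[OF less_imp_le[OF T]] \<eta>(1) e(1) unfolding vanishes_in_prob_def by (intro order_tendstoD(2)) auto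
    \<comment> \<open>One approximant serves both purposes. It is fixed from here on, and with it
      \<kappa> and C'; only the mesh still varies.\<close>
    obtain j where
      j: "measure N {w\<in>space N. (\<integral>\<^sup>+s\<in>{0..T}. ennreal ((norm (V' j s w - ?H s w))\<^sup>2) \<partial>lborel) > ennreal (\<theta> / 4)} < e"
        "measure N {w\<in>space N. (SUP s\<in>{0..T}. ennreal (norm (J' j s w - I s w))) > ennreal (\<eta> / 2)} < e"
      using eventually_happens'[OF sequentially_bot eventually_conj[OF ev1 ev2]] by blast
    define V J where "V = V' j" and "J = J' j"
    have VJ: "simple_ito N F W V J" unfolding V_def J_def by (rule V')
    define S1 where "S1 = {w\<in>space M. (SUP s\<in>{0..T}. ennreal (norm (J s w - I s w))) > ennreal (\<eta> / 2)}"
    define S2 where "S2 = {w\<in>space M. (\<integral>\<^sup>+s\<in>{0..T}. ennreal ((norm (V s w - ?H s w))\<^sup>2) \<partial>lborel) > ennreal (\<theta> / 4)}"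
    have S: "measure N S1 < e" "measure N S2 < e" using j by (simp_all add: S1_def S2_def V_def J_def)
    have S1N: "S1 \<in> sets N" unfolding S1_def
      using ito by (intro sup_deviation_measurable[OF VJ T])
        (auto simp: has_ito_integral_def intro: measurable_F_N)
    have S2N: "S2 \<in> sets N" unfolding S2_def
      using ito T by (intro quadratic_deviation_measurable[OF VJ]) (auto simp: has_ito_integral_def)
    obtain P \<kappa> where P: "finite P"
      "\<And>s s'. 0 \<le> s \<Longrightarrow> s < s' \<Longrightarrow> P \<inter> {s<..<s'} = {} \<Longrightarrow> V s' \<in> borel_measurable (F s)"
      "\<And>s s' r w. 0 \<le> s \<Longrightarrow> s < r \<Longrightarrow> r \<le> s' \<Longrightarrow> P \<inter> {s<..<s'} = {} \<Longrightarrow> V r w = V s' w"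
      "\<And>s s' w. 0 \<le> s \<Longrightarrow> s < s' \<Longrightarrow> P \<inter> {s<..<s'} = {} \<Longrightarrow> J s' w - J s w = V s' w *v (W s' w - W s w)"
      "\<And>s w. w \<in> space M \<Longrightarrow> norm (V s w) \<le> \<kappa>"
      "\<And>w. J 0 w = 0"
      using simple_ito_piecewise[OF VJ] by blast
    obtain C' where C'_step: "C' \<ge> 0 \<and> (\<forall>x y S r s s'. x \<in> inner_region \<delta> D \<longrightarrow> y \<in> inner_region \<delta> D \<longrightarrow> dist x y \<le> \<eta>0 \<longrightarrow>
       norm S \<le> \<kappa> \<longrightarrow> 0 \<le> r \<longrightarrow> 0 \<le> s \<longrightarrow> s < s' \<longrightarrow> r + (s' - s) \<le> T \<longrightarrow>
       (\<integral>w. indicator D (x + ((s' - s) *\<^sub>R b y + S *v (W s' w - W s w)))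
          * envelope v \<alpha> \<beta> r (x + ((s' - s) *\<^sub>R b y + S *v (W s' w - W s w))) \<partial>N)
       \<le> envelope v \<alpha> \<beta> (r + (s' - s)) x + (s' - s) * (e + C * (norm (S - \<sigma> y))\<^sup>2 + C' * (s' - s)))"
      using step[of \<kappa>] by (rule exE)
    then have C': "C' \<ge> 0" by (rule conjunct1)
    have step': "x \<in> inner_region \<delta> D \<Longrightarrow> y \<in> inner_region \<delta> D \<Longrightarrow> dist x y \<le> \<eta> \<Longrightarrow>
       norm S \<le> \<kappa> \<Longrightarrow> 0 \<le> r \<Longrightarrow> 0 \<le> s \<Longrightarrow> s < s' \<Longrightarrow> r + (s' - s) \<le> T \<Longrightarrow>
       (\<integral>w. indicator D (x + ((s' - s) *\<^sub>R b y + S *v (W s' w - W s w)))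
          * envelope v \<alpha> \<beta> r (x + ((s' - s) *\<^sub>R b y + S *v (W s' w - W s w))) \<partial>N)
       \<le> envelope v \<alpha> \<beta> (r + (s' - s)) x + (s' - s) * (e + C * (norm (S - \<sigma> y))\<^sup>2 + C' * (s' - s))" for x y S r s s'
      using \<eta>(2) by (intro C'_step[THEN conjunct2, rule_format]) auto
    define m where "m = (\<lambda>k. inverse (real (Suc k)))"
    have m0: "0 < m k" for k by (simp add: m_def)
    have mlim: "m \<longlonglongrightarrow> 0" unfolding m_def by (rule LIMSEQ_inverse_real_of_nat)
    have "\<exists>n s. s 0 = 0 \<and> s n = T \<and> (\<forall>i<n. s i < s (Suc i) \<and> s (Suc i) - s i \<le> m k \<and> P \<inter> {s i <..< s (Suc i)} = {})" for k
      using grid_exists[OF P(1) T m0[of k]] by metis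
    then obtain n s where s: "\<And>k. s k 0 = 0" "\<And>k. s k (n k) = T"
      "\<And>k i. i < n k \<Longrightarrow> s k i < s k (Suc i)" "\<And>k i. i < n k \<Longrightarrow> s k (Suc i) - s k i \<le> m k"
      "\<And>k i. i < n k \<Longrightarrow> P \<inter> {s k i <..< s k (Suc i)} = {}"
      by metis
    have s_mono: "s k i \<le> s k i'" if "i \<le> i'" "i' \<le> n k" for k i i'
      using that s(3) by (intro increasing_upto_mono[where n = "n k"]) auto
    have s0: "0 \<le> s k i" and sT: "s k i \<le> T" if "i \<le> n k" for k i
      using s_mono[of 0 i k] s_mono[of i "n k" k] that s(1,2)[of k] by auto
    \<comment> \<open>Adaptedness of X is known only before \<zeta>; the default value x0 makes the
      samples adapted at every grid time and is never seen on A.\<close>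
    define Y where "Y = (\<lambda>k i w. if ereal (s k i) < \<zeta> w then X (s k i) w else x0)"
    define Z where "Z = (\<lambda>k i. rec_nat (\<lambda>w. x0) (\<lambda>i z w. z w + ((s k (Suc i) - s k i) *\<^sub>R b (Y k i w)
        + V (s k (Suc i)) w *v (W (s k (Suc i)) w - W (s k i) w))) i)"
    define G where "G = (\<lambda>k. {w\<in>space M. \<forall>l\<le>n k. Y k l w \<in> inner_region (2 * \<delta>) D \<and> dist (Z k l w) (Y k l w) \<le> \<eta> \<and>
        (\<Sum>i<l. (s k (Suc i) - s k i) * (norm (V (s k (Suc i)) w - \<sigma> (Y k i w)))\<^sup>2) \<le> \<theta>})"
    have Ym: "Y k i \<in> borel_measurable (F (s k i))" if "i \<le> n k" for k i
    proof (rule measurableI)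
      fix B :: "(real^'n) set" assume B: "B \<in> sets borel"
      have 1: "{w\<in>space M. ereal (s k i) < \<zeta> w \<and> X (s k i) w \<in> B'} \<in> sets (F (s k i))" if "B' \<in> sets borel" for B'
        using s0[OF \<open>i \<le> n k\<close>] that by (rule Xm)
      have 2: "{w\<in>space M. ereal (s k i) < \<zeta> w} \<in> sets (F (s k i))" using 1[of UNIV] by simp
      have "Y k i -` B \<inter> space (F (s k i)) = {w\<in>space M. ereal (s k i) < \<zeta> w \<and> X (s k i) w \<in> B} \<union>
          (if x0 \<in> B then space (F (s k i)) - {w\<in>space M. ereal (s k i) < \<zeta> w} else {})"
        by (auto simp: Y_def split: if_splits)
      also have "\<dots> \<in> sets (F (s k i))"
        using sets.Un[OF 1[OF B] sets.compl_sets[OF 2]] 1[OF B] by simp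
      finally show "Y k i -` B \<inter> space (F (s k i)) \<in> sets (F (s k i))" .
    qed simp
    have chain: "G k \<in> sets (F T)" "Z k (n k) \<in> borel_measurable (F T)"
      "(\<integral>w. indicator (G k) w * (indicator D (Z k (n k) w) * v (Z k (n k) w)) \<partial>N)
      \<le> envelope v \<alpha> \<beta> T x0 + (e + C' * m k) * T + C * \<theta>" for k
    proof -
      have pos: "C \<ge> 0" "C' \<ge> 0" "e \<ge> 0" "\<theta> \<ge> 0" "0 \<le> m k" "\<eta> \<le> \<delta>"
        using C C' e(1) \<theta>(1) m0[of k] \<eta>(3) by auto
      have Vm: "V (s k (Suc i)) \<in> borel_measurable (F (s k i))" if "i < n k" for i
        using that by (intro P(2) s0 s(3,5)) auto
      have Vb: "norm (V (s k (Suc i)) w) \<le> \<kappa>" if "i < n k" "w \<in> space M" for i w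
        using that(2) by (rule P(5))
      have Z0: "Z k 0 w = x0" for w by (simp add: Z_def)
      have ZSuc: "Z k (Suc i) w = Z k i w + ((s k (Suc i) - s k i) *\<^sub>R b (Y k i w)
          + V (s k (Suc i)) w *v (W (s k (Suc i)) w - W (s k i) w))" for i w
        by (simp add: Z_def)
      note sk = s(1)[of k] s(2)[of k] s(3)[of _ k] s(4)[of _ k]
      note est = stopped_chain_estimate[where s = "s k" and Y = "Y k" and Z = "Z k"
          and \<xi> = "\<lambda>i. V (s k (Suc i))" and n = "n k" and m = "m k" and \<kappa> = \<kappa> and C = C and C' = C'
          and e = e and v = v and b = b and \<sigma> = \<sigma> and D = D and \<delta> = \<delta> and \<eta> = \<eta> and \<theta> = \<theta>
          and \<alpha> = \<alpha> and \<beta> = \<beta> and T = T]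
      show "G k \<in> sets (F T)" unfolding G_def
        by (rule est(1); fact v D cb cs nn \<delta> pos step' sk Ym Vm Vb Z0 ZSuc x0)
      show "Z k (n k) \<in> borel_measurable (F T)"
        by (rule est(2); fact v D cb cs nn \<delta> pos step' sk Ym Vm Vb Z0 ZSuc x0)
      show "(\<integral>w. indicator (G k) w * (indicator D (Z k (n k) w) * v (Z k (n k) w)) \<partial>N)
          \<le> envelope v \<alpha> \<beta> T x0 + (e + C' * m k) * T + C * \<theta>" unfolding G_def
        by (rule est(3); fact v D cb cs nn \<delta> pos step' sk Ym Vm Vb Z0 ZSuc x0)
    qed
    define E where "E = (\<lambda>k. {w\<in>G k. Y k (n k) w \<in> D\<^sub>s})"
    have GN: "G k \<in> sets N" for k using chain(1)[of k] sets_F_subset by blast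
    have EN: "E k \<in> sets N" for k
    proof -
      have "Y k (n k) -` D\<^sub>s \<inter> space N \<in> sets N"
        using Ds by (intro measurable_sets[OF measurable_F_N[OF Ym]]) auto
      moreover have "E k = G k \<inter> (Y k (n k) -` D\<^sub>s \<inter> space N)" by (auto simp: E_def G_def)
      ultimately show ?thesis using GN by auto
    qed
    \<comment> \<open>A Markov inequality: on \<open>E k\<close> the path ends in
      \<open>D\<^sub>s\<close> with v at least 1, so v is at least 1 - e at the nearby endpoint of
      the chain.\<close>
    have Ele: "measure N (E k) \<le> (envelope v \<alpha> \<beta> T x0 + (e + C' * m k) * T + C * \<theta>) / (1 - e)" for k
    proof -
      let ?f = "\<lambda>w. indicator (G k) w * (indicator D (Z k (n k) w) * v (Z k (n k) w))"
      obtain B where B: "B \<ge> 0" "\<And>z. \<bar>indicator D z * envelope v \<alpha> \<beta> 0 z\<bar> \<le> B"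
        using cutoff_envelope_bounded[OF v D(2)] by blast
      have "(\<lambda>w. indicator D (Z k (n k) w) * v (Z k (n k) w)) \<in> borel_measurable N"
        using measurable_compose[OF measurable_F_N[OF chain(2)] cutoff_envelope_measurable[OF v D(1), of \<alpha> \<beta> 0]] by simp
      then have int: "integrable N ?f"
        using GN B by (intro N.integrable_const_bound[of _ B] AE_I2) (auto simp: indicator_def split: if_splits)
      have "(1 - e) * measure N (E k) = (\<integral>w. (1 - e) * indicator (E k) w \<partial>N)"
        using EN sets.sets_into_space[OF EN] by (simp add: Int_absorb2)
      also have "\<dots> \<le> (\<integral>w. ?f w \<partial>N)"
      proof (rule integral_mono[OF _ int])
        show "integrable N (\<lambda>w. (1 - e) * indicator (E k) w)"
          using EN[of k]
          by (intro integrable_mult_right N.integrable_const_bound[of _ 1] AE_I2 borel_measurable_indicator)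
             (auto simp: indicator_def)
        fix w
        show "(1 - e) * indicator (E k) w \<le> ?f w"
        proof (cases "w \<in> E k")
          case True
          then have w: "w \<in> G k" "Y k (n k) w \<in> D\<^sub>s" by (auto simp: E_def)
          then have y: "Y k (n k) w \<in> inner_region (2 * \<delta>) D" "dist (Z k (n k) w) (Y k (n k) w) \<le> \<eta>"
            by (auto simp: G_def)
          have "Z k (n k) w \<in> inner_region \<delta> D" using y \<eta> by (intro inner_region_near[OF y(1)]) auto
          then have z: "Z k (n k) w \<in> D" using inner_region_subset[OF \<delta>] by blast
          have "dist (v (Z k (n k) w)) (v (Y k (n k) w)) < e"
            using z y(2) w(2) Ds(2) \<eta>(4) closure_subset[of D] by (intro \<eta>1(2)) auto
          then have "1 - e \<le> v (Z k (n k) w)" using v1[OF w(2)] by (simp add: dist_real_def)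
          then show ?thesis using True w z by simp
        next
          case False
          then show ?thesis using nn[of 0 "Z k (n k) w"] by (simp add: indicator_def)
        qed
      qed
      also note chain(3)[of k]
      finally show ?thesis using e by (simp add: field_simps)
    qed
    \<comment> \<open>Once the mesh is below the path's own moduli of continuity, no stopping reason
      occurs: the margin holds by A, the separation by the bound outside S1, the integrand error by
      the bound outside S2.\<close>
    have AE: "AE w in N. w \<in> A - S1 - S2 \<longrightarrow> (\<forall>\<^sub>F k in sequentially. w \<in> E k)"
      using sde AE_space
    proof eventually_elim
      case (elim w)
      show ?case
      proof
        assume "w \<in> A - S1 - S2"
        then have wM: "w \<in> space M" and w\<tau>: "T < \<tau> w" and wDs: "X T w \<in> D\<^sub>s"
          and wQ: "\<And>t. t \<in> {0..T} \<inter> \<rat> \<Longrightarrow> X t w \<in> inner_region (2 * \<delta>) D" and wS: "w \<notin> S1" "w \<notin> S2"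
          by (auto simp: A_def)
        have xc: "continuous_on {0..T} (\<lambda>t. X t w)"
          using Xc[OF wM] by (rule continuous_on_subset) (use before[OF wM w\<tau>] in auto)
        have inK: "X t w \<in> inner_region (2 * \<delta>) D" if "t \<in> {0..T}" for t
          using image_closure_subset[of "{0<..<T} \<inter> \<rat>" "\<lambda>t. X t w" "inner_region (2 * \<delta>) D"]
            xc wQ that by (auto simp: closed_inner_region closure_Rats_Int_greaterThanLessThan[OF T] image_subset_iff)
        have eq: "X t w = x0 + integral {0..t} (\<lambda>r. b (X r w)) + I t w" if "0 \<le> t" "t \<le> T" for t
          using elim(1) that w\<tau> by (auto dest!: spec[of _ t] simp: min_def)
        have JI: "norm (J t w - I t w) \<le> \<eta> / 2" if "0 \<le> t" "t \<le> T" for t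
        proof -
          have "ennreal (norm (J t w - I t w)) \<le> (SUP s\<in>{0..T}. ennreal (norm (J s w - I s w)))"
            using that by (intro SUP_upper) auto
          also have "\<dots> \<le> ennreal (\<eta> / 2)" using wS(1) wM by (simp add: S1_def not_less)
          finally show ?thesis using \<eta>(1) by simp
        qed
        have VH: "(\<integral>\<^sup>+r\<in>{0..T}. ennreal ((norm (V r w - \<sigma> (X r w)))\<^sup>2) \<partial>lborel) \<le> ennreal (\<theta> / 4)"
        proof -
          have "(\<integral>\<^sup>+r\<in>{0..T}. ennreal ((norm (V r w - \<sigma> (X r w)))\<^sup>2) \<partial>lborel)
            = (\<integral>\<^sup>+r\<in>{0..T}. ennreal ((norm (V r w - ?H r w))\<^sup>2) \<partial>lborel)"
            using w\<tau> by (intro nn_integral_cong) (auto simp: indicator_def)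
          then show ?thesis using wS(2) wM by (simp add: S2_def not_less)
        qed
        \<comment> \<open>The tolerances ub and us exhaust the drift budget \<eta> / 2 and the
          oscillation budget \<theta> / 4 over a time interval of length T.\<close>
        define ub where "ub = \<eta> / (2 * T)"
        define us where "us = sqrt (\<theta> / (4 * T))"
        have ub: "ub > 0" "T * ub \<le> \<eta> / 2" using \<eta> T by (auto simp: ub_def)
        have us: "us > 0" "T * us\<^sup>2 \<le> \<theta> / 4" using \<theta> T by (auto simp: us_def)
        have "uniformly_continuous_on {0..T} (\<lambda>t. b (X t w))"
          by (intro compact_uniformly_continuous continuous_on_compose2[OF cb xc]) auto
        then obtain d1 where d1: "d1 > 0" "\<And>t r. t \<in> {0..T} \<Longrightarrow> r \<in> {0..T} \<Longrightarrow> dist r t < d1 \<Longrightarrow> dist (b (X r w)) (b (X t w)) < ub"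
          using ub(1) unfolding uniformly_continuous_on_def by metis
        have sc: "continuous_on {0..T} (\<lambda>t. \<sigma> (X t w))"
          by (rule continuous_on_compose2[OF cs xc]) auto
        then have "uniformly_continuous_on {0..T} (\<lambda>t. \<sigma> (X t w))"
          by (intro compact_uniformly_continuous) auto
        then obtain d2 where d2: "d2 > 0" "\<And>t r. t \<in> {0..T} \<Longrightarrow> r \<in> {0..T} \<Longrightarrow> dist r t < d2 \<Longrightarrow> dist (\<sigma> (X r w)) (\<sigma> (X t w)) < us"
          using us(1) unfolding uniformly_continuous_on_def by metis
        have "\<forall>\<^sub>F k in sequentially. m k < min d1 d2"
          using d1(1) d2(1) by (intro order_tendstoD(2)[OF mlim]) auto
        then show "\<forall>\<^sub>F k in sequentially. w \<in> E k"
        proof eventually_elim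
          case (elim k)
          have Yx: "Y k l w = X (s k l) w" if "l \<le> n k" for l
            using before[OF wM w\<tau> sT[OF that]] by (simp add: Y_def)
          have near: "r \<in> {0..T}" "s k i \<in> {0..T}" "dist r (s k i) < d1" "dist r (s k i) < d2"
            if "i < n k" "s k i \<le> r" "r \<le> s k (Suc i)" for i r
          proof -
            have "dist r (s k i) \<le> m k" using s(4)[OF that(1)] that by (simp add: dist_real_def)
            then show "dist r (s k i) < d1" "dist r (s k i) < d2" using elim by auto
            show "r \<in> {0..T}" "s k i \<in> {0..T}" using that s0[of i k] sT[of i k] sT[of "Suc i" k] by auto
          qed
          have close: "dist (Z k l w) (X (s k l) w) \<le> \<eta>" if "l \<le> n k" for l
          proof (rule euler_path_close[where T = T and b = b and I = "\<lambda>t. I t w" and J = "\<lambda>t. J t w"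
                and u = ub and n = "n k" and s = "s k", OF xc cb eq P(6) JI s(1) s(2) s(3) less_imp_le[OF ub(1)] ub(2) _ _ _ that])
            show "norm (b (X r w) - b (X (s k i) w)) \<le> ub" if "i < n k" "s k i \<le> r" "r \<le> s k (Suc i)" for i r
              using d1(2)[OF near(2,1,3)[OF that]] by (simp add: dist_norm)
            show "Z k 0 w = x0" by (simp add: Z_def)
            show "Z k (Suc i) w = Z k i w + ((s k (Suc i) - s k i) *\<^sub>R b (X (s k i) w) + (J (s k (Suc i)) w - J (s k i) w))"
              if "i < n k" for i
              using P(4)[OF s0 s(3)[OF that] s(5)[OF that], of w] Yx[of i] that by (simp add: Z_def)
          qed auto
          have quad: "(\<Sum>i<l. (s k (Suc i) - s k i) * (norm (V (s k (Suc i)) w - \<sigma> (Y k i w)))\<^sup>2) \<le> \<theta>" if "l \<le> n k" for l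
          proof -
            have "(\<Sum>i<l. (s k (Suc i) - s k i) * (norm (V (s k (Suc i)) w - \<sigma> (X (s k i) w)))\<^sup>2) \<le> \<theta>"
            proof (rule riemann_quadratic_error[where V = "\<lambda>r. V r w" and s = "s k" and n = "n k", OF sc
                  simple_ito_measurable(1)[OF VJ] VH s(1) s(2) s(3) us(2) less_imp_le[OF \<theta>(1)] _ _ that])
              show "norm (\<sigma> (X r w) - \<sigma> (X (s k i) w)) \<le> us" if "i < n k" "s k i \<le> r" "r \<le> s k (Suc i)" for i r
                using d2(2)[OF near(2,1,4)[OF that]] by (simp add: dist_norm)
              show "V r w = V (s k (Suc i)) w" if "i < n k" "s k i < r" "r \<le> s k (Suc i)" for i r
                using that s0[of i k] s(5)[OF that(1)] by (intro P(3)) auto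
            qed auto
            also have "(\<Sum>i<l. (s k (Suc i) - s k i) * (norm (V (s k (Suc i)) w - \<sigma> (X (s k i) w)))\<^sup>2)
              = (\<Sum>i<l. (s k (Suc i) - s k i) * (norm (V (s k (Suc i)) w - \<sigma> (Y k i w)))\<^sup>2)"
              using that Yx by (intro sum.cong) auto
            finally show ?thesis .
          qed
          show "w \<in> E k"
            using wM wDs Yx close quad inK s0 sT s(2)[of k] by (auto simp: E_def G_def)
        qed
      qed
    qed
    have "(\<lambda>k. (envelope v \<alpha> \<beta> T x0 + (e + C' * m k) * T + C * \<theta>) / (1 - e))
        \<longlonglongrightarrow> (envelope v \<alpha> \<beta> T x0 + (e + C' * 0) * T + C * \<theta>) / (1 - e)"
      using e by (intro tendsto_intros mlim) auto
    from N.prob_le_of_AE_eventually[OF _ EN AE Ele this]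
    have "measure N (A - S1 - S2) \<le> (envelope v \<alpha> \<beta> T x0 + e * T + C * \<theta>) / (1 - e)"
      using AN S1N S2N by simp
    also have "\<dots> \<le> (envelope v \<alpha> \<beta> T x0 + e * T + e) / (1 - e)"
      using \<theta> e by (intro divide_right_mono) auto
    finally have "measure N (A - S1 - S2) \<le> (envelope v \<alpha> \<beta> T x0 + e * T + e) / (1 - e)" .
    moreover have "measure N A \<le> measure N (A - S1 - S2) + measure N S1 + measure N S2"
    proof -
      have "measure N A \<le> measure N ((A - S1 - S2) \<union> S1 \<union> S2)"
        using AN S1N S2N by (intro N.finite_measure_mono) auto
      also have "\<dots> \<le> measure N ((A - S1 - S2) \<union> S1) + measure N S2"
        using AN S1N S2N by (intro measure_Un_le) auto
      also have "measure N ((A - S1 - S2) \<union> S1) \<le> measure N (A - S1 - S2) + measure N S1"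
        using AN S1N S2N by (intro measure_Un_le) auto
      finally show ?thesis by simp
    qed
    ultimately show ?thesis using S by linarith
  qed
  have "((\<lambda>e. (envelope v \<alpha> \<beta> T x0 + e * T + e) / (1 - e) + 2 * e) \<longlongrightarrow> envelope v \<alpha> \<beta> T x0) (at_right 0)"
    by (auto intro!: tendsto_eq_intros)
  moreover have "\<forall>\<^sub>F e in at_right 0. measure N A \<le> (envelope v \<alpha> \<beta> T x0 + e * T + e) / (1 - e) + 2 * e"
    by (rule eventually_at_rightI[of 0 1]) (auto intro: approx)
  ultimately show "measure N A \<le> envelope v \<alpha> \<beta> T x0"
    by (intro tendsto_lowerbound[of _ _ "at_right 0"]) auto
qed

end

section \<open>Exhausting the reach-avoid event\<close>

theorem corollary5:
  fixes M :: "'a measure"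
    and W :: "real \<Rightarrow> 'a \<Rightarrow> real^'k"
    and b :: "real^'n \<Rightarrow> real^'n"
    and \<sigma> :: "real^'n \<Rightarrow> real^'k^'n"
    and X :: "real^'n \<Rightarrow> real \<Rightarrow> 'a \<Rightarrow> real^'n"
    and \<zeta> :: "real^'n \<Rightarrow> 'a \<Rightarrow> ereal"
    and D D\<^sub>s :: "(real^'n) set"
    and v :: "real^'n \<Rightarrow> real"
    and T \<alpha> \<beta> :: real
  assumes "prob_space M"
    and "wiener_process M W"
    and "local_lipschitz (UNIV :: real set) UNIV (\<lambda>_. b)"
    and "local_lipschitz (UNIV :: real set) UNIV (\<lambda>_. \<sigma>)"
    and "open D" and "bounded D"
    and "closed D\<^sub>s" and "D\<^sub>s \<subseteq> D"
    and "0 < T"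
    and "\<And>x0. x0 \<in> D - D\<^sub>s \<Longrightarrow> maximal_local_strong_solution M W b \<sigma> x0 (X x0) (\<zeta> x0)"
    and "twice_cont_diff v"
    and "\<And>x. x \<in> D \<Longrightarrow> generator b \<sigma> v x \<le> \<alpha> * v x + \<beta>"
    and "\<And>x. x \<in> frontier D \<Longrightarrow> 0 \<le> \<alpha> * v x + \<beta>"
    and "\<And>x. x \<in> closure D \<Longrightarrow> v x \<ge> indicator D\<^sub>s x"
  shows "\<forall>x0 \<in> D - D\<^sub>s.
    reach_avoid_prob M (X x0) (\<zeta> x0) D D\<^sub>s T \<le>
      (if \<alpha> = 0 then v x0 + \<beta> * T
       else exp (\<alpha> * T) * v x0 + \<beta> / \<alpha> * (exp (\<alpha> * T) - 1))"
proof
  fix x0 assume x0: "x0 \<in> D - D\<^sub>s"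
  interpret prob_space M by fact
  interpret wiener_space M W by unfold_locales fact
  let ?X = "X x0" and ?\<zeta> = "\<zeta> x0"
  note sol = assms(10)[OF x0, unfolded maximal_local_strong_solution_def, THEN conjunct1]
  obtain \<tau> :: "nat \<Rightarrow> 'a \<Rightarrow> real" and I where
    \<tau>: "\<And>n. stopping_time F (\<tau> n)" "\<And>n w. w \<in> space M \<Longrightarrow> ereal (\<tau> n w) < ?\<zeta> w"
      "\<And>w. w \<in> space M \<Longrightarrow> (\<lambda>n. ereal (\<tau> n w)) \<longlonglongrightarrow> ?\<zeta> w"
    and I: "\<And>n. has_ito_integral N F W (\<lambda>s w. if s \<le> \<tau> n w then \<sigma> (?X s w) else 0) (I n)"
      "\<And>n. AE w in N. \<forall>t\<ge>0. ?X (min t (\<tau> n w)) w =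
        x0 + integral {0..min t (\<tau> n w)} (\<lambda>s. b (?X s w)) + I n t w"
    using sol unfolding local_solution_def space_completion by blast
  have Xc: "\<And>w. w \<in> space M \<Longrightarrow> continuous_on {t. 0 \<le> t \<and> ereal t < ?\<zeta> w} (\<lambda>t. ?X t w)"
    and Xm: "\<And>t B. 0 \<le> t \<Longrightarrow> B \<in> sets borel \<Longrightarrow> {w\<in>space M. ereal t < ?\<zeta> w \<and> ?X t w \<in> B} \<in> sets (F t)"
    using sol unfolding local_solution_def space_completion by blast+
  have cont: "continuous_on UNIV b" "continuous_on UNIV \<sigma>"
    using local_lipschitz_continuous_on[OF assms(3), of 0] local_lipschitz_continuous_on[OF assms(4), of 0] by auto
  have v0: "0 \<le> v x" if "x \<in> closure D" for x
    using assms(14)[OF that] by (rule order_trans[OF indicator_pos_le])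
  have v1: "1 \<le> v x" if "x \<in> D\<^sub>s" for x
  proof -
    have "x \<in> closure D" using that \<open>D\<^sub>s \<subseteq> D\<close> closure_subset by blast
    from assms(14)[OF this] show ?thesis using that by simp
  qed
  have env: "0 \<le> envelope v \<alpha> \<beta> r x" if "0 \<le> r" "x \<in> D" for r x
  proof -
    have "x \<in> closure D" using that(2) closure_subset by blast
    from envelope_nonneg[OF \<open>twice_cont_diff v\<close> \<open>open D\<close> \<open>bounded D\<close> assms(12,13) v0 this that(1)]
    show ?thesis .
  qed
  define \<delta> where "\<delta> = (\<lambda>n. inverse (real (Suc n)))"
  define A where "A = (\<lambda>n. {w\<in>space M. T < \<tau> n w \<and> ?X T w \<in> D\<^sub>s \<and>
    (\<forall>t\<in>{0..T} \<inter> \<rat>. ?X t w \<in> inner_region (2 * \<delta> n) D)})"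
  have A: "A n \<in> sets N" "measure N (A n) \<le> envelope v \<alpha> \<beta> T x0" for n
  proof -
    have \<delta>n: "0 < \<delta> n" by (simp add: \<delta>_def)
    have xD: "x0 \<in> D" using x0 by simp
    note bnd = stopped_event_bound[OF \<open>twice_cont_diff v\<close> \<open>open D\<close> \<open>bounded D\<close> \<open>0 < T\<close> cont assms(12) env
        \<open>closed D\<^sub>s\<close> \<open>D\<^sub>s \<subseteq> D\<close> v1 \<delta>n xD Xc Xm \<tau>(1)[of n] \<tau>(2)[of _ n] I(1)[of n] I(2)[of n]]
    show "A n \<in> sets N" "measure N (A n) \<le> envelope v \<alpha> \<beta> T x0"
      unfolding A_def by (rule bnd; assumption)+
  qed
  let ?R = "{w \<in> space M. ereal T < ?\<zeta> w \<and> ?X T w \<in> D\<^sub>s \<and> (\<forall>t\<in>{0..<T}. ?X t w \<in> D)}"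
  \<comment> \<open>The path on {0..T} is a compact subset of D, the endpoint included since
    \<open>D\<^sub>s\<close> lies in D, so it has a positive margin; and \<tau> n eventually exceeds
    T because its limit \<zeta> does.\<close>
  have ev: "\<forall>\<^sub>F n in sequentially. w \<in> A n" if w: "w \<in> ?R" for w
  proof -
    have wM: "w \<in> space M" and T\<zeta>: "ereal T < ?\<zeta> w" using w by auto
    have inD: "?X t w \<in> D" if "t \<in> {0..T}" for t
      using w \<open>D\<^sub>s \<subseteq> D\<close> that by (cases "t = T") auto
    have "{0..T} \<subseteq> {t. 0 \<le> t \<and> ereal t < ?\<zeta> w}"
      using T\<zeta> by (auto intro: le_less_trans[of "ereal _" "ereal T"])
    then have "compact ((\<lambda>t. ?X t w) ` {0..T})"
      by (intro compact_continuous_image continuous_on_subset[OF Xc[OF wM]]) auto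
    then obtain d where d: "d > 0" "(\<lambda>t. ?X t w) ` {0..T} \<subseteq> inner_region d D"
      using inner_region_exhausts[OF \<open>open D\<close>] inD by (metis image_subsetI)
    have "\<forall>\<^sub>F n in sequentially. ereal T < ereal (\<tau> n w)"
      using \<tau>(3)[OF wM] T\<zeta> by (rule order_tendstoD(1))
    moreover have "\<forall>\<^sub>F n in sequentially. \<delta> n < d / 2"
      unfolding \<delta>_def using d(1) by (intro order_tendstoD(2)[OF LIMSEQ_inverse_real_of_nat]) auto
    ultimately show ?thesis
    proof eventually_elim
      case (elim n)
      then have "inner_region d D \<subseteq> inner_region (2 * \<delta> n) D" by (intro inner_region_antimono) auto
      then show ?case using elim w d(2) by (auto simp: A_def)
    qed
  qed
  have "measure N ?R \<le> envelope v \<alpha> \<beta> T x0"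
  \<comment> \<open>Outside the sigma-algebra \<open>measure\<close> is 0, and the envelope is
    nonnegative at x0.\<close>
  proof (cases "?R \<in> sets N")
    case True
    show ?thesis
      by (rule N.prob_le_of_AE_eventually[where C = A, OF True A(1) _ A(2) tendsto_const]) (use ev in auto)
  next
    case False
    then show ?thesis using env[of T x0] x0 \<open>0 < T\<close> by (simp add: measure_notin_sets)
  qed
  then show "reach_avoid_prob M (X x0) (\<zeta> x0) D D\<^sub>s T \<le>
      (if \<alpha> = 0 then v x0 + \<beta> * T
       else exp (\<alpha> * T) * v x0 + \<beta> / \<alpha> * (exp (\<alpha> * T) - 1))"
    unfolding reach_avoid_prob_def envelope_eq_bound .
qed

end
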